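(* Let $(W,S)$ be an irreducible finite Weyl group. The set of proper subsets $J\subsetneq S$ that are combinatorially smooth is the following, according to the type (with $S$ numbered as specified in the context). For each type the list is grouped according to which of the end nodes are elements of $J$. 1. Type $A_1$: $J=\emptyset$. Type $A_n$, $n\ge2$: (a) $J=\emptyset$; (b) $J=\{s_1,\dots,s_i\}$, $1\le i<n$; (c) $J=\{s_j,\dots,s_n\}$, $1<j\le n$; (d) $J=\{s_1,\dots,s_i,s_j,\dots,s_n\}$, $1\le i$, $i\le j-3$, $j\le n$. 2. Type $B_2$: (a) $J=\emptyset$; (b) $J=\{s_1\}$; (c) $J=\{s_2\}$. Type $B_n$, $n\ge3$ ($\alpha_n$ short): (a) $J=\emptyset$; (b) $J=\{s_1,\dots,s_i\}$, $1\le i<n$; (c) $J=\{s_n\}$; (d) $J=\{s_1,\dots,s_i,s_n\}$, $1\le i$ and $i\le n-3$. 3. Type $C_n$, $n\ge3$ ($\alpha_n$ long): (a) $J=\emptyset$; (b) $J=\{s_1,\dots,s_i\}$, $1\le i<n$; (c) $J=\{s_n\}$; (d) $J=\{s_1,\dots,s_i,s_n\}$, $1\le i$ and $i\le n-3$. 4. Type $D_n$, $n\ge4$: (a) $J=\emptyset$; (b) $J=\{s_1,\dots,s_i\}$, $1\le i\le n-3$; (c) $J=\{s_{n-1}\}$; (d) $J=\{s_n\}$; (e) $J=\{s_1,\dots,s_i,s_{n-1}\}$, $1\le i\le n-4$; (f) $J=\{s_1,\dots,s_i,s_n\}$, $1\le i\le n-4$. 5. Type $E_6$: (a) $\emptyset$;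 (b) $\{s_1\}$ or $\{s_1,s_2\}$; (c) $\{s_5\}$ or $\{s_4,s_5\}$; (d) $\{s_6\}$; (e) $\{s_1,s_5\}$, $\{s_1,s_2,s_5\}$ or $\{s_1,s_4,s_5\}$; (f) $\{s_1,s_6\}$; (g) $\{s_5,s_6\}$; (h) $\{s_1,s_5,s_6\}$. 6. Type $E_7$: (a) $\emptyset$; (b) $\{s_1\}$, $\{s_1,s_2\}$ or $\{s_1,s_2,s_3\}$; (c) $\{s_6\}$ or $\{s_5,s_6\}$; (d) $\{s_7\}$; (e) $\{s_1,s_6\}$, $\{s_1,s_2,s_6\}$, $\{s_1,s_2,s_3,s_6\}$, $\{s_1,s_5,s_6\}$ or $\{s_1,s_2,s_5,s_6\}$; (f) $\{s_6,s_7\}$; (g) $\{s_1,s_7\}$ or $\{s_1,s_2,s_7\}$; (h) $\{s_1,s_6,s_7\}$, $\{s_1,s_2,s_6,s_7\}$. 7. Type $E_8$: (a) $\emptyset$; (b) $\{s_1\}$, $\{s_1,s_2\}$, $\{s_1,s_2,s_3\}$ or $\{s_1,s_2,s_3,s_4\}$; (c) $\{s_7\}$ or $\{s_6,s_7\}$; (d) $\{s_8\}$; (e) $\{s_1,s_7\}$, $\{s_1,s_2,s_7\}$, $\{s_1,s_2,s_3,s_7\}$, $\{s_1,s_2,s_3,s_4,s_7\}$, $\{s_1,s_6,s_7\}$, $\{s_1,s_2,s_6,s_7\}$, $\{s_1,s_2,s_3,s_6,s_7\}$ or $\{s_1,s_2,s_5,s_6\}$; (f) $\{s_7,s_8\}$;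 (g) $\{s_1,s_8\}$, $\{s_1,s_2,s_8\}$ or $\{s_1,s_2,s_3,s_8\}$; (h) $\{s_1,s_7,s_8\}$, $\{s_1,s_2,s_7,s_8\}$. 8. Type $F_4$: (a) $\emptyset$; (b) $\{s_1\}$ or $\{s_1,s_2\}$; (c) $\{s_4\}$ or $\{s_3,s_4\}$; (d) $\{s_1,s_4\}$. 9. Type $G_2$: (a) $\emptyset$; (b) $\{s_1\}$; (c) $\{s_2\}$.
   Context: Let $V$ be the rational reflection representation of $W$ and $\mathcal{C}\subseteq V$ the closed Weyl chamber corresponding to $S$. For $J\subseteq S$ choose $\lambda\in\mathcal{C}$ with $\{s\in S\mid s(\lambda)=\lambda\}=J$ and put $\mathcal{P}_\lambda=\mathrm{Conv}(W\cdot\lambda)$; its face lattice depends only on $J$. $J$ is called combinatorially smooth if $\mathcal{P}_\lambda$ is a simple polytope, i.e. each vertex is the endpoint of exactly $\dim\mathcal{P}_\lambda$ edges. Numbering of $S$: $s_i$ is the simple reflection in the simple root $\alpha_i$. For $A_n,B_n,C_n,F_4,G_2$ it is the usual numbering along the chain, with end nodes $s_1$ and $s_n$ (in $B_n$, $\alpha_n$ is the short simple root; in $C_n$, $\alpha_n$ is the long simple root; in $F_4$ the double bond joins $s_2$ and $s_3$). For $D_n$ the end nodes are $s_1,s_{n-1},s_n$, and the two subsets $\{s_1,\dots,s_{n-2},s_{n-1}\}$ and $\{s_1,\dots,s_{n-2},s_n\}$ are chains of type $A_{n-1}$ (so $s_{n-1},s_n$ are both joined to $s_{n-2}$). For $E_n$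 ($n=6,7,8$), $s_1,\dots,s_{n-1}$ form, in this order, a chain of type $A_{n-1}$, and $s_n$ is joined only to $s_3$ for $E_6$, to $s_4$ for $E_7$, and to $s_5$ for $E_8$.
   Formalization: In type E_8 the printed list is wrong at two entries: {s_1,s_2,s_5,s_6} in (e) is not combinatorially smooth (12 edges at each vertex, not 8) and is removed, and {s_1,s_2,s_3,s_7,s_8}, which is smooth (4+2+2=8 edges), is added to (h). *)

theory Defs
  imports "HOL-Analysis.Cartesian_Space"
begin

section \<open>Polytopes in rational vector spaces\<close>

text \<open>The convexity notions of HOL-Analysis are tied to real vector spaces. The notions below
  are the corresponding ones for the rational vector space \<^typ>\<open>rat ^ 'n\<close>.\<close>

definition linear_functional :: "(rat ^ 'n \<Rightarrow> rat) \<Rightarrow> bool" where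
  "linear_functional f \<longleftrightarrow> Vector_Spaces.linear (*s) (*) f"

definition conv :: "(rat ^ 'n) set \<Rightarrow> (rat ^ 'n) set" where
  "conv X = {(\<Sum>x\<in>T. c x *s x) | T c.
      finite T \<and> T \<subseteq> X \<and> (\<forall>x\<in>T. 0 \<le> c x) \<and> (\<Sum>x\<in>T. c x) = 1}"

text \<open>The dimension of the affine hull (and \<open>0\<close> for the empty set).\<close>

definition polytope_dim :: "(rat ^ 'n) set \<Rightarrow> nat" where
  "polytope_dim P = vec.dim {x - y | x y. x \<in> P \<and> y \<in> P}"

definition is_face :: "(rat ^ 'n) set \<Rightarrow> (rat ^ 'n) set \<Rightarrow> bool" where
  "is_face F P \<longleftrightarrow> (\<exists>f b. linear_functional f \<and> (\<forall>x\<in>P. f x \<le> b) \<and> F = {x \<in> P. f x = b})"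

definition is_vertex :: "rat ^ 'n \<Rightarrow> (rat ^ 'n) set \<Rightarrow> bool" where
  "is_vertex v P \<longleftrightarrow> is_face {v} P"

definition is_edge :: "(rat ^ 'n) set \<Rightarrow> (rat ^ 'n) set \<Rightarrow> bool" where
  "is_edge e P \<longleftrightarrow> is_face e P \<and> polytope_dim e = 1"

definition simple_polytope :: "(rat ^ 'n) set \<Rightarrow> bool" where
  "simple_polytope P \<longleftrightarrow>
     (\<forall>v. is_vertex v P \<longrightarrow> card {e. is_edge e P \<and> is_vertex v e} = polytope_dim P)"


section \<open>Root systems, Weyl groups and their reflection representation\<close>

text \<open>\<open>coroot \<alpha> v\<close> is the value at \<open>v\<close> of the coroot belonging to the root \<open>\<alpha>\<close>; it is
  meaningful only when \<open>\<alpha>\<close> is a root.\<close>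

definition reflection :: "(rat ^ 'n \<Rightarrow> rat ^ 'n \<Rightarrow> rat) \<Rightarrow> rat ^ 'n \<Rightarrow> rat ^ 'n \<Rightarrow> rat ^ 'n" where
  "reflection coroot \<alpha> v = v - coroot \<alpha> v *s \<alpha>"

text \<open>Reduced crystallographic root systems. No invariant scalar product is chosen; the
  coroot of \<open>\<alpha>\<close> is the (unique) functional for which the conditions below hold.\<close>

locale root_system =
  fixes \<Phi> :: "(rat ^ 'n) set"
    and coroot :: "rat ^ 'n \<Rightarrow> rat ^ 'n \<Rightarrow> rat"
  assumes finite_roots: "finite \<Phi>"
    and span_roots: "vec.span \<Phi> = UNIV"
    and zero_not_root: "0 \<notin> \<Phi>"
    and coroot_linear: "\<alpha> \<in> \<Phi> \<Longrightarrow> linear_functional (coroot \<alpha>)"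
    and coroot_self: "\<alpha> \<in> \<Phi> \<Longrightarrow> coroot \<alpha> \<alpha> = 2"
    and reflection_root: "\<alpha> \<in> \<Phi> \<Longrightarrow> \<beta> \<in> \<Phi> \<Longrightarrow> reflection coroot \<alpha> \<beta> \<in> \<Phi>"
    and coroot_integral: "\<alpha> \<in> \<Phi> \<Longrightarrow> \<beta> \<in> \<Phi> \<Longrightarrow> coroot \<alpha> \<beta> \<in> \<int>"
    and reduced: "\<alpha> \<in> \<Phi> \<Longrightarrow> c *s \<alpha> \<in> \<Phi> \<Longrightarrow> c = 1 \<or> c = - 1"

text \<open>A root system together with a base \<open>\<Delta>\<close>, i.e. with a set of simple reflections.\<close>

locale irreducible_weyl_group = root_system \<Phi> coroot
  for \<Phi> :: "(rat ^ 'n) set" and coroot :: "rat ^ 'n \<Rightarrow> rat ^ 'n \<Rightarrow> rat" +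
  fixes \<Delta> :: "(rat ^ 'n) set"
  assumes simple_subset: "\<Delta> \<subseteq> \<Phi>"
    and simple_independent: "vec.independent \<Delta>"
    and simple_signs: "\<beta> \<in> \<Phi> \<Longrightarrow>
      \<exists>c :: rat ^ 'n \<Rightarrow> nat. \<beta> = (\<Sum>\<alpha>\<in>\<Delta>. of_nat (c \<alpha>) *s \<alpha>) \<or> \<beta> = - (\<Sum>\<alpha>\<in>\<Delta>. of_nat (c \<alpha>) *s \<alpha>)"
    and irreducible: "\<Phi> = X \<union> Y \<Longrightarrow> X \<inter> Y = {} \<Longrightarrow>
      (\<And>\<alpha> \<beta>. \<alpha> \<in> X \<Longrightarrow> \<beta> \<in> Y \<Longrightarrow> coroot \<alpha> \<beta> = 0) \<Longrightarrow> X = {} \<or> Y = {}"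

definition simple_reflections ::
    "(rat ^ 'n \<Rightarrow> rat ^ 'n \<Rightarrow> rat) \<Rightarrow> (rat ^ 'n) set \<Rightarrow> (rat ^ 'n \<Rightarrow> rat ^ 'n) set" where
  "simple_reflections coroot \<Delta> = reflection coroot ` \<Delta>"

text \<open>Since reflections are involutions, the monoid they generate is the group they generate.\<close>

inductive_set weyl_group ::
    "(rat ^ 'n \<Rightarrow> rat ^ 'n \<Rightarrow> rat) \<Rightarrow> (rat ^ 'n) set \<Rightarrow> (rat ^ 'n \<Rightarrow> rat ^ 'n) set"
  for coroot \<Delta> where
  weyl_id: "id \<in> weyl_group coroot \<Delta>"
| weyl_step: "s \<in> simple_reflections coroot \<Delta> \<Longrightarrow> w \<in> weyl_group coroot \<Delta> \<Longrightarrow>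
    s \<circ> w \<in> weyl_group coroot \<Delta>"

definition weyl_chamber ::
    "(rat ^ 'n \<Rightarrow> rat ^ 'n \<Rightarrow> rat) \<Rightarrow> (rat ^ 'n) set \<Rightarrow> (rat ^ 'n) set" where
  "weyl_chamber coroot \<Delta> = {v. \<forall>\<alpha>\<in>\<Delta>. 0 \<le> coroot \<alpha> v}"

definition orbit_polytope ::
    "(rat ^ 'n \<Rightarrow> rat ^ 'n \<Rightarrow> rat) \<Rightarrow> (rat ^ 'n) set \<Rightarrow> rat ^ 'n \<Rightarrow> (rat ^ 'n) set" where
  "orbit_polytope coroot \<Delta> x = conv {w x | w. w \<in> weyl_group coroot \<Delta>}"

text \<open>The face lattice of the polytope depends only on \<open>J\<close>, so it does not matter which
  \<open>x\<close> is used.\<close>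

definition combinatorially_smooth ::
    "(rat ^ 'n \<Rightarrow> rat ^ 'n \<Rightarrow> rat) \<Rightarrow> (rat ^ 'n) set \<Rightarrow> (rat ^ 'n \<Rightarrow> rat ^ 'n) set \<Rightarrow> bool" where
  "combinatorially_smooth coroot \<Delta> J \<longleftrightarrow>
     (\<exists>x\<in>weyl_chamber coroot \<Delta>. {s \<in> simple_reflections coroot \<Delta>. s x = x} = J \<and>
        simple_polytope (orbit_polytope coroot \<Delta> x))"

definition smooth_subsets ::
    "(rat ^ 'n \<Rightarrow> rat ^ 'n \<Rightarrow> rat) \<Rightarrow> (rat ^ 'n) set \<Rightarrow> (rat ^ 'n \<Rightarrow> rat ^ 'n) set set" where
  "smooth_subsets coroot \<Delta> =
     {J. J \<subset> simple_reflections coroot \<Delta> \<and> combinatorially_smooth coroot \<Delta> J}"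


section \<open>Types and numberings\<close>

datatype weyl_type = Type_A nat | Type_B nat | Type_C nat | Type_D nat | Type_E nat
  | Type_F4 | Type_G2

fun type_rank :: "weyl_type \<Rightarrow> nat" where
  "type_rank (Type_A n) = n"
| "type_rank (Type_B n) = n"
| "type_rank (Type_C n) = n"
| "type_rank (Type_D n) = n"
| "type_rank (Type_E n) = n"
| "type_rank Type_F4 = 4"
| "type_rank Type_G2 = 2"

text \<open>In type \<open>E\<close> the last node is joined to node \<open>3\<close>, \<open>4\<close>, \<open>5\<close> for rank \<open>6\<close>, \<open>7\<close>, \<open>8\<close>;
  this is not the numbering of Bourbaki.\<close>

fun joined :: "weyl_type \<Rightarrow> nat \<Rightarrow> nat \<Rightarrow> bool" where
  "joined (Type_D n) i j \<longleftrightarrow> (i < n \<and> j < n \<and> (j = i + 1 \<or> i = j + 1)) \<or> {i, j} = {n - 2, n}"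
| "joined (Type_E n) i j \<longleftrightarrow> (i < n \<and> j < n \<and> (j = i + 1 \<or> i = j + 1)) \<or> {i, j} = {n - 3, n}"
| "joined _ i j \<longleftrightarrow> j = i + 1 \<or> i = j + 1"

text \<open>\<open>cartan X i j\<close> is the value of the \<open>i\<close>-th simple coroot at the \<open>j\<close>-th simple root, so in a
  multiple bond the entry different from \<open>-1\<close> is the one in the row of the short root.
  Hence \<open>\<alpha>\<^sub>n\<close> is short in \<open>B\<^sub>n\<close> and long in \<open>C\<^sub>n\<close>; the short simple roots are
  \<open>\<alpha>\<^sub>3, \<alpha>\<^sub>4\<close> in \<open>F\<^sub>4\<close> and \<open>\<alpha>\<^sub>1\<close> in \<open>G\<^sub>2\<close>.\<close>

definition cartan :: "weyl_type \<Rightarrow> nat \<Rightarrow> nat \<Rightarrow> int" where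
  "cartan X i j =
     (if i = j then 2
      else if \<not> joined X i j then 0
      else case X of
          Type_B n \<Rightarrow> if i = n \<and> j = n - 1 then -2 else -1
        | Type_C n \<Rightarrow> if i = n - 1 \<and> j = n then -2 else -1
        | Type_F4 \<Rightarrow> if i = 3 \<and> j = 2 then -2 else -1
        | Type_G2 \<Rightarrow> if i = 1 \<and> j = 2 then -3 else -1
        | _ \<Rightarrow> -1)"

definition has_type ::
    "(rat ^ 'n \<Rightarrow> rat ^ 'n \<Rightarrow> rat) \<Rightarrow> (rat ^ 'n) set \<Rightarrow> (nat \<Rightarrow> rat ^ 'n) \<Rightarrow> weyl_type \<Rightarrow> bool" where
  "has_type coroot \<Delta> \<alpha> X \<longleftrightarrow> bij_betw \<alpha> {1..type_rank X} \<Delta> \<and>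
     (\<forall>i\<in>{1..type_rank X}. \<forall>j\<in>{1..type_rank X}. coroot (\<alpha> i) (\<alpha> j) = of_int (cartan X i j))"

definition refl_set ::
    "(rat ^ 'n \<Rightarrow> rat ^ 'n \<Rightarrow> rat) \<Rightarrow> (nat \<Rightarrow> rat ^ 'n) \<Rightarrow> nat set \<Rightarrow> (rat ^ 'n \<Rightarrow> rat ^ 'n) set" where
  "refl_set coroot \<alpha> I = (\<lambda>i. reflection coroot (\<alpha> i)) ` I"

text \<open>In type \<open>E\<^sub>8\<close> the published list has \<open>{s\<^sub>1, s\<^sub>2, s\<^sub>5, s\<^sub>6}\<close> instead of
  \<open>{s\<^sub>1, s\<^sub>2, s\<^sub>3, s\<^sub>7, s\<^sub>8}\<close>. This is an error: the first subset gives
  \<open>3 + 3 + 3 + 3 = 12\<close> edges at each vertex (from \<open>s\<^sub>3, s\<^sub>4, s\<^sub>7, s\<^sub>8\<close>), the second one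
  \<open>4 + 2 + 2 = 8\<close> (from \<open>s\<^sub>4, s\<^sub>5, s\<^sub>6\<close>). The theorem has the corrected list.\<close>

end

theory Submission
  imports Defs
begin

text \<open>Let \<open>x\<close> be dominant and let \<open>J\<close> be the set of simple roots orthogonal to \<open>x\<close>. Since \<open>x - w x\<close> is a
  nonnegative combination of simple roots for every \<open>w\<close> (lemma \<open>dominance\<close>), each simple root \<open>s\<close>
  outside \<open>J\<close> is the direction of an edge at \<open>x\<close>. The reflections in \<open>J\<close> fix \<open>x\<close>, so all elements of
  the set \<open>B\<close> of translates of these \<open>s\<close> under the group generated by \<open>J\<close> are edge directions too.
  As the diagram is connected, \<open>B\<close> spans the whole space. All vertices look alike, because the
  Weyl group permutes them transitively.

  If the polytope is simple, then \<open>B\<close> has at most as many elements as the dimension, so it is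
  linearly independent (\<open>simple_imp_independent\<close>). This is a strong restriction: each reflection in
  \<open>J\<close> then exchanges exactly two elements of \<open>B\<close> (\<open>independent_moved\<close>). Following the supports
  of the elements of \<open>B\<close>, one sees that among the connected sets built from one node outside \<open>J\<close> by
  adding nodes of \<open>J\<close>, there is only one to which a given node of \<open>J\<close> can be added
  (\<open>independent_unique_growth\<close>), and that the two ends of a multiple bond cannot be added one
  after the other (\<open>independent_no_multiple_bond\<close>). So a component of \<open>J\<close> is a simply laced path
  that is attached by one end to a single outside node, and no two components are attached to
  the same node.

  Conversely, suppose that the components of \<open>J\<close> are simply laced paths attached by one end, to
  different outside nodes. Then \<open>B\<close> has one element for each node (locale \<open>path_forest\<close>), and so it
  is a basis. For \<open>y\<close> in the polytope the coordinates of \<open>x - y\<close> in this basis are nonnegative: for the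
  far end of a path the coordinate is a positive multiple of a simple root coefficient, and
  the reflections in the path carry the sign to the other nodes (\<open>coord_nonneg\<close>). Therefore \<open>B\<close>
  generates the cone of the polytope at \<open>x\<close>, there are no further edges, and the polytope is simple.

  It remains to determine such \<open>J\<close> in each diagram. The diagrams are either chains with at most
  one multiple bond or simply laced forks, and in both cases \<open>J\<close> is described by its first and
  last gap in the chain and, for a fork, by whether it contains the node off the chain
  (\<open>chain_smooth_subsets\<close>, \<open>fork_smooth_subsets\<close>). Each such \<open>J\<close> does occur
  as the stabiliser of a dominant vector, since the simple coroots are linearly
  independent (\<open>dominant_with_stabiliser\<close>).\<close>

section \<open>Linear functionals, convex hulls and faces\<close>

lemma linear_functional_iff:
  "linear_functional f \<longleftrightarrow> (\<forall>u v. f (u + v) = f u + f v) \<and> (\<forall>c v. f (c *s v) = c * f v)"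
  unfolding linear_functional_def Vector_Spaces.linear_iff
  by (simp add: vec.vector_space_axioms vector_space_over_itself.vector_space_axioms)

lemma linear_functional_add: "linear_functional f \<Longrightarrow> f (u + v) = f u + f v"
  by (simp add: linear_functional_iff)

lemma linear_functional_scale: "linear_functional f \<Longrightarrow> f (c *s v) = c * f v"
  by (simp add: linear_functional_iff)

lemma linear_functional_zero: "linear_functional f \<Longrightarrow> f 0 = 0"
  using linear_functional_scale[of f 0 0] by simp

lemma linear_functional_neg: "linear_functional f \<Longrightarrow> f (- v) = - f v"
  using linear_functional_scale[of f "-1" v] by simp

lemma linear_functional_diff: "linear_functional f \<Longrightarrow> f (u - v) = f u - f v"
  using linear_functional_add[of f u "- v"] linear_functional_neg[of f v] by simp

lemma linear_functional_sum: "linear_functional f \<Longrightarrow> f (\<Sum>i\<in>A. g i) = (\<Sum>i\<in>A. f (g i))"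
  by (induction A rule: infinite_finite_induct)
     (simp_all add: linear_functional_zero linear_functional_add)

lemmas linear_functional_simps =
  linear_functional_add linear_functional_scale linear_functional_zero linear_functional_neg
  linear_functional_diff linear_functional_sum

lemma linear_functional_eq_on_span:
  assumes f: "linear_functional f" and g: "linear_functional g"
    and eq: "\<And>v. v \<in> X \<Longrightarrow> f v = g v" and v: "v \<in> vec.span X"
  shows "f v = g v"
  using v
  by (induction rule: vec.span_induct_alt)
     (simp_all add: linear_functional_simps[OF f] linear_functional_simps[OF g] eq)

lemma linear_functional_combination:
  assumes "\<And>i. i \<in> A \<Longrightarrow> linear_functional (f i)"
  shows "linear_functional (\<lambda>v. \<Sum>i\<in>A. c i * f i v)"
  unfolding linear_functional_iff
  using assms by (auto simp: linear_functional_add linear_functional_scale algebra_simps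
    sum.distrib sum_distrib_left intro!: sum.cong)

lemma linear_functional_representation:
  assumes "vec.independent X" and "vec.span X = UNIV"
  shows "linear_functional (\<lambda>v. vec.representation X v b)"
  unfolding linear_functional_iff
  using assms by (simp add: vec.representation_add vec.representation_scale)

lemma conv_superset: "X \<subseteq> conv X"
proof
  fix x assume "x \<in> X"
  then show "x \<in> conv X" unfolding conv_def
    by (intro CollectI exI[of _ "{x}"] exI[of _ "\<lambda>y. 1"]) simp
qed

lemma linear_functional_le_conv:
  assumes f: "linear_functional f" and le: "\<And>x. x \<in> X \<Longrightarrow> f x \<le> b" and y: "y \<in> conv X"
  shows "f y \<le> b"
proof -
  obtain T c where T: "y = (\<Sum>x\<in>T. c x *s x)" "finite T" "T \<subseteq> X" "\<forall>x\<in>T. 0 \<le> c x"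
    "(\<Sum>x\<in>T. c x) = 1"
    using y unfolding conv_def by blast
  have "f y = (\<Sum>x\<in>T. c x * f x)" by (simp add: T(1) linear_functional_simps[OF f])
  also have "\<dots> \<le> (\<Sum>x\<in>T. c x * b)" 
    using T(3,4) le by (intro sum_mono mult_left_mono) auto
  also have "\<dots> = b" by (simp add: sum_distrib_right[symmetric] T(5))
  finally show ?thesis .
qed

text \<open>A linear functional takes its maximum over a convex hull at a generator.\<close>

lemma vertex_conv_generator:
  assumes "is_vertex v (conv X)"
  shows "v \<in> X"
proof -
  obtain f b where f: "linear_functional f" and le: "\<And>y. y \<in> conv X \<Longrightarrow> f y \<le> b"
    and v: "{v} = {y \<in> conv X. f y = b}"
    using assms unfolding is_vertex_def is_face_def by metis
  have "v \<in> conv X" and fv: "f v = b" using v by auto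
  then obtain T c where T: "v = (\<Sum>x\<in>T. c x *s x)" "finite T" "T \<subseteq> X" "\<forall>x\<in>T. 0 \<le> c x"
    "(\<Sum>x\<in>T. c x) = 1"
    unfolding conv_def by blast
  have "\<exists>x\<in>T. c x > 0"
  proof (rule ccontr)
    assume "\<not> (\<exists>x\<in>T. c x > 0)"
    then have "(\<Sum>x\<in>T. c x) = 0" using T(4) by (intro sum.neutral) force
    then show False using T(5) by simp
  qed
  then obtain x where x: "x \<in> T" "c x > 0" by blast
  have "(\<Sum>x\<in>T. c x * (b - f x)) = b * (\<Sum>x\<in>T. c x) - f v"
    by (simp add: T(1) linear_functional_simps[OF f] algebra_simps sum_subtractf sum_distrib_left)
  then have "(\<Sum>x\<in>T. c x * (b - f x)) = 0" using T(5) fv by simp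
  moreover have "\<forall>x\<in>T. 0 \<le> c x * (b - f x)"
    using T(3,4) le conv_superset[of X] by (simp add: subset_iff)
  ultimately have "c x * (b - f x) = 0"
    using sum_nonneg_eq_0_iff[OF T(2), of "\<lambda>x. c x * (b - f x)"] x(1) by blast
  then have "f x = b" using x(2) by simp
  moreover have "x \<in> X" using x(1) T(3) by (rule set_rev_mp)
  ultimately have "x \<in> {v}" unfolding v using conv_superset[of X] by (simp add: subset_iff)
  with \<open>x \<in> X\<close> show ?thesis by simp
qed

text \<open>Reflections generate the Weyl group, so the symmetries of an orbit polytope can be treated one
  involution at a time.\<close>

definition linear_involution :: "(rat ^ 'n \<Rightarrow> rat ^ 'n) \<Rightarrow> bool" where
  "linear_involution s \<longleftrightarrow> (\<forall>u v. s (u + v) = s u + s v) \<and> (\<forall>c v. s (c *s v) = c *s s v) \<and>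
     (\<forall>v. s (s v) = v)"

context
  fixes s :: "rat ^ 'n \<Rightarrow> rat ^ 'n"
  assumes s: "linear_involution s"
begin

lemma involution_simps:
  "s (u + v) = s u + s v" "s (c *s v) = c *s s v" "s (s v) = v" "s 0 = 0" "s (- v) = - s v"
  "s (u - v) = s u - s v"
proof -
  show 1: "s (u + v) = s u + s v" and 2: "s (c *s v) = c *s s v" and "s (s v) = v" for u v c
    using s by (auto simp: linear_involution_def)
  show "s 0 = 0" using 2[of 0 0] by simp
  show 3: "s (- v) = - s v" for v using 2[of "-1" v] by simp
  show "s (u - v) = s u - s v" using 1[of u "- v"] 3 by simp
qed

lemma involution_sum: "s (\<Sum>i\<in>A. g i) = (\<Sum>i\<in>A. s (g i))"
  by (induction A rule: infinite_finite_induct) (simp_all add: involution_simps)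

lemma involution_inj: "inj s"
  by (metis injI involution_simps(3))

lemma involution_image_image: "s ` s ` X = X"
  by (simp add: image_image involution_simps)

lemma involution_linear: "Vector_Spaces.linear (*s) (*s) s"
  unfolding Vector_Spaces.linear_iff by (simp add: vec.vector_space_axioms involution_simps)

lemma involution_functional: "linear_functional f \<Longrightarrow> linear_functional (\<lambda>v. f (s v))"
  by (simp add: linear_functional_iff involution_simps)

lemma involution_conv:
  assumes "s ` X = X"
  shows "s ` conv X = conv X"
proof -
  have sub: "s y \<in> conv X" if "y \<in> conv X" for y
  proof -
    obtain T c where T: "y = (\<Sum>x\<in>T. c x *s x)" "finite T" "T \<subseteq> X" "\<forall>x\<in>T. 0 \<le> c x"
      "(\<Sum>x\<in>T. c x) = 1"
      using \<open>y \<in> conv X\<close> unfolding conv_def by blast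
    have inj: "inj_on s T" using involution_inj by (rule inj_on_subset) simp
    have "s y = (\<Sum>x\<in>T. c x *s s x)" by (simp add: T(1) involution_sum involution_simps)
    also have "\<dots> = (\<Sum>x\<in>s ` T. c (s x) *s x)"
      by (simp add: sum.reindex[OF inj] involution_simps)
    finally have "s y = (\<Sum>x\<in>s ` T. c (s x) *s x)" .
    moreover have "(\<Sum>x\<in>s ` T. c (s x)) = 1"
      using T(5) by (simp add: sum.reindex[OF inj] involution_simps)
    moreover have "finite (s ` T)" "s ` T \<subseteq> X" "\<forall>x\<in>s ` T. 0 \<le> c (s x)"
      using T assms by (auto simp: involution_simps)
    ultimately show ?thesis unfolding conv_def
      by (intro CollectI exI[of _ "s ` T"] exI[of _ "\<lambda>x. c (s x)"]) simp
  qed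
  show ?thesis
  proof
    show "s ` conv X \<subseteq> conv X" using sub by blast
    show "conv X \<subseteq> s ` conv X"
    proof
      fix y assume "y \<in> conv X"
      then show "y \<in> s ` conv X" using sub by (intro rev_image_eqI[of "s y"]) (simp_all add: involution_simps)
    qed
  qed
qed

lemma involution_face:
  assumes "is_face F P"
  shows "is_face (s ` F) (s ` P)"
proof -
  obtain f b where f: "linear_functional f" "\<forall>x\<in>P. f x \<le> b" "F = {x \<in> P. f x = b}"
    using assms unfolding is_face_def by blast
  then have "linear_functional (\<lambda>v. f (s v)) \<and> (\<forall>x\<in>s ` P. f (s x) \<le> b) \<and>
      s ` F = {x \<in> s ` P. f (s x) = b}"
    by (auto simp: involution_functional involution_simps)
  then show ?thesis unfolding is_face_def by blast
qed

lemma involution_polytope_dim: "polytope_dim (s ` P) = polytope_dim P"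
proof -
  have "{x - y | x y. x \<in> s ` P \<and> y \<in> s ` P} = s ` {x - y | x y. x \<in> P \<and> y \<in> P}"
  proof (intro equalityI subsetI)
    fix z assume "z \<in> {x - y | x y. x \<in> s ` P \<and> y \<in> s ` P}"
    then obtain x y where "x \<in> P" "y \<in> P" "z = s (x - y)" by (auto simp: involution_simps)
    then show "z \<in> s ` {x - y | x y. x \<in> P \<and> y \<in> P}" by blast
  next
    fix z assume "z \<in> s ` {x - y | x y. x \<in> P \<and> y \<in> P}"
    then obtain x y where "x \<in> P" "y \<in> P" "z = s x - s y" by (auto simp: involution_simps)
    then show "z \<in> {x - y | x y. x \<in> s ` P \<and> y \<in> s ` P}" by blast
  qed
  moreover have "inj_on s (vec.span X)" for X
    using involution_inj by (rule inj_on_subset) simp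
  ultimately show ?thesis
    unfolding polytope_dim_def by (simp add: vec.dim_image_eq[OF involution_linear])
qed

end

lemma is_faceI:
  "linear_functional f \<Longrightarrow> (\<And>x. x \<in> P \<Longrightarrow> f x \<le> b) \<Longrightarrow> F = {x \<in> P. f x = b} \<Longrightarrow> is_face F P"
  unfolding is_face_def by (intro exI[of _ f] exI[of _ b]) simp

lemma is_faceE:
  assumes "is_face F P"
  obtains f b where "linear_functional f" "\<And>x. x \<in> P \<Longrightarrow> f x \<le> b" "F = {x \<in> P. f x = b}"
  using assms unfolding is_face_def by auto

definition edges_at :: "rat ^ 'n \<Rightarrow> (rat ^ 'n) set \<Rightarrow> (rat ^ 'n) set set" where
  "edges_at v P = {e. is_edge e P \<and> is_vertex v e}"

lemma involution_edges_at:
  assumes s: "linear_involution s" and P: "s ` P = P" and e: "e \<in> edges_at v P"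
  shows "s ` e \<in> edges_at (s v) P"
proof -
  have "is_face (s ` e) P" using involution_face[OF s, of e P] e P
    by (simp add: edges_at_def is_edge_def)
  moreover have "is_face (s ` {v}) (s ` e)" using involution_face[OF s, of "{v}" e] e
    by (simp add: edges_at_def is_vertex_def)
  ultimately show ?thesis using e
    by (simp add: edges_at_def is_edge_def is_vertex_def involution_polytope_dim[OF s])
qed

lemma involution_card_edges_at:
  assumes s: "linear_involution s" and P: "s ` P = P"
  shows "card (edges_at (s v) P) = card (edges_at v P)"
proof -
  have "(\<lambda>e. s ` e) ` edges_at v P = edges_at (s v) P"
  proof
    show "(\<lambda>e. s ` e) ` edges_at v P \<subseteq> edges_at (s v) P"
      using involution_edges_at[OF s P] by blast
    show "edges_at (s v) P \<subseteq> (\<lambda>e. s ` e) ` edges_at v P"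
    proof
      fix e assume "e \<in> edges_at (s v) P"
      from involution_edges_at[OF s P this] have "s ` e \<in> edges_at v P"
        by (simp add: involution_simps[OF s])
      then show "e \<in> (\<lambda>e. s ` e) ` edges_at v P"
        by (rule rev_image_eqI) (simp add: involution_image_image[OF s])
    qed
  qed
  moreover have "inj_on (\<lambda>e. s ` e) X" for X
    by (rule inj_on_inverseI[of _ "\<lambda>e. s ` e"]) (rule involution_image_image[OF s])
  ultimately show ?thesis by (metis card_image)
qed


section \<open>The Weyl group and the dominance order\<close>

context root_system
begin

abbreviation refl :: "rat ^ 'n \<Rightarrow> rat ^ 'n \<Rightarrow> rat ^ 'n" where
  "refl \<equiv> reflection coroot"

lemmas coroot_simps = linear_functional_simps[OF coroot_linear]

lemma refl_involution: "\<alpha> \<in> \<Phi> \<Longrightarrow> linear_involution (refl \<alpha>)"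
  unfolding linear_involution_def reflection_def
  by (auto simp: coroot_simps coroot_self vec.scale_left_distrib vec.scale_right_diff_distrib
      vec.scale_left_diff_distrib algebra_simps)

lemmas refl_simps = involution_simps[OF refl_involution]

lemma refl_self: "\<alpha> \<in> \<Phi> \<Longrightarrow> refl \<alpha> \<alpha> = - \<alpha>"
  unfolding reflection_def by (simp add: coroot_self vec_eq_iff)

lemma refl_fixed_iff: "\<alpha> \<in> \<Phi> \<Longrightarrow> refl \<alpha> v = v \<longleftrightarrow> coroot \<alpha> v = 0"
  using zero_not_root by (auto simp: reflection_def)

text \<open>The product of two reflections in the same vector \<open>\<beta>\<close> is the unipotent map
  \<open>v \<mapsto> v + (f v - g v) *s \<beta>\<close>; its orbits in a finite set are finite only if \<open>f = g\<close>.
  Hence a root determines its coroot.\<close>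

lemma coroot_unique:
  assumes f: "linear_functional f" "f \<beta> = 2" "\<And>v. v \<in> \<Phi> \<Longrightarrow> v - f v *s \<beta> \<in> \<Phi>"
    and g: "linear_functional g" "g \<beta> = 2" "\<And>v. v \<in> \<Phi> \<Longrightarrow> v - g v *s \<beta> \<in> \<Phi>"
  shows "f = g"
proof
  fix v
  show "f v = g v"
  proof (rule linear_functional_eq_on_span[OF f(1) g(1), of \<Phi>])
    show "v \<in> vec.span \<Phi>" using span_roots by simp
    fix \<gamma> assume \<gamma>: "\<gamma> \<in> \<Phi>"
    define h where "h = f \<gamma> - g \<gamma>"
    have step: "w + (f w - g w) *s \<beta> \<in> \<Phi>" if "w \<in> \<Phi>" for w
    proof -
      have "(w - f w *s \<beta>) - g (w - f w *s \<beta>) *s \<beta> = w + (f w - g w) *s \<beta>"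
        by (simp add: linear_functional_simps[OF g(1)] g(2) vec_eq_iff algebra_simps)
      then show ?thesis using g(3)[OF f(3)[OF that]] by metis
    qed
    have "\<gamma> + (of_nat k * h) *s \<beta> \<in> \<Phi>" for k :: nat
    proof (induction k)
      case 0 show ?case using \<gamma> by simp
    next
      case (Suc k)
      from step[OF Suc] show ?case
        by (simp add: linear_functional_simps[OF f(1)] linear_functional_simps[OF g(1)] f(2) g(2)
            h_def algebra_simps vec.scale_left_distrib)
    qed
    then have "finite (range (\<lambda>k::nat. \<gamma> + (of_nat k * h) *s \<beta>))"
      using finite_roots by (rule_tac finite_subset[of _ \<Phi>]) auto
    then have "\<not> inj (\<lambda>k::nat. \<gamma> + (of_nat k * h) *s \<beta>)"
      using finite_imageD by blast
    moreover have "\<beta> \<noteq> 0" using f linear_functional_zero by force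
    ultimately show "f \<gamma> = g \<gamma>" by (auto simp: inj_on_def h_def)
  qed
qed

lemma coroot_refl:
  assumes \<alpha>: "\<alpha> \<in> \<Phi>" and \<beta>: "\<beta> \<in> \<Phi>"
  shows "coroot (refl \<alpha> \<beta>) v = coroot \<beta> (refl \<alpha> v)"
proof -
  have r: "refl \<alpha> \<beta> \<in> \<Phi>" using reflection_root \<alpha> \<beta> by blast
  have "coroot (refl \<alpha> \<beta>) = (\<lambda>v. coroot \<beta> (refl \<alpha> v))"
  proof (rule coroot_unique[of _ "refl \<alpha> \<beta>"])
    show "linear_functional (coroot (refl \<alpha> \<beta>))" "coroot (refl \<alpha> \<beta>) (refl \<alpha> \<beta>) = 2"
      using r coroot_linear coroot_self by auto
    show "v - coroot (refl \<alpha> \<beta>) v *s refl \<alpha> \<beta> \<in> \<Phi>" if "v \<in> \<Phi>" for v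
      using reflection_root[OF r that] by (simp add: reflection_def)
    show "linear_functional (\<lambda>v. coroot \<beta> (refl \<alpha> v))"
      using involution_functional[OF refl_involution[OF \<alpha>] coroot_linear[OF \<beta>]] .
    show "coroot \<beta> (refl \<alpha> (refl \<alpha> \<beta>)) = 2" using \<alpha> \<beta> by (simp add: refl_simps coroot_self)
    show "v - coroot \<beta> (refl \<alpha> v) *s refl \<alpha> \<beta> \<in> \<Phi>" if "v \<in> \<Phi>" for v
    proof -
      have "refl \<alpha> (refl \<beta> (refl \<alpha> v)) \<in> \<Phi>" using \<alpha> \<beta> that by (intro reflection_root)
      moreover have "refl \<alpha> (refl \<beta> (refl \<alpha> v)) = v - coroot \<beta> (refl \<alpha> v) *s refl \<alpha> \<beta>"
        by (subst (2) reflection_def) (simp add: refl_simps[OF \<alpha>])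
      ultimately show ?thesis by simp
    qed
  qed
  then show ?thesis by metis
qed

end

locale based_root_system = root_system \<Phi> coroot
  for \<Phi> :: "(rat ^ 'n) set" and coroot :: "rat ^ 'n \<Rightarrow> rat ^ 'n \<Rightarrow> rat" +
  fixes \<Delta> :: "(rat ^ 'n) set"
  assumes simple_subset: "\<Delta> \<subseteq> \<Phi>"
    and simple_independent: "vec.independent \<Delta>"
    and simple_signs: "\<beta> \<in> \<Phi> \<Longrightarrow>
      \<exists>c :: rat ^ 'n \<Rightarrow> nat. \<beta> = (\<Sum>\<alpha>\<in>\<Delta>. of_nat (c \<alpha>) *s \<alpha>) \<or> \<beta> = - (\<Sum>\<alpha>\<in>\<Delta>. of_nat (c \<alpha>) *s \<alpha>)"
begin

lemma finite_simple: "finite \<Delta>"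
  using simple_subset finite_roots finite_subset by blast

lemma simple_root: "\<alpha> \<in> \<Delta> \<Longrightarrow> \<alpha> \<in> \<Phi>"
  using simple_subset by blast

lemma span_simple: "vec.span \<Delta> = UNIV"
proof -
  have "\<beta> \<in> vec.span \<Delta>" if "\<beta> \<in> \<Phi>" for \<beta>
  proof -
    have "(\<Sum>\<alpha>\<in>\<Delta>. of_nat (c \<alpha>) *s \<alpha>) \<in> vec.span \<Delta>" for c :: "rat ^ 'n \<Rightarrow> nat"
      by (intro vec.span_sum vec.span_scale vec.span_base)
    then show ?thesis using simple_signs[OF that] vec.span_neg by blast
  qed
  then have "vec.span \<Phi> \<subseteq> vec.span \<Delta>" by (intro vec.span_minimal) auto
  then show ?thesis using span_roots by blast
qed

lemma card_simple: "card \<Delta> = vec.dim (UNIV :: (rat ^ 'n) set)"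
  using vec.dim_span_eq_card_independent[OF simple_independent] span_simple by simp

definition coeff :: "rat ^ 'n \<Rightarrow> rat ^ 'n \<Rightarrow> rat" where
  "coeff \<alpha> v = vec.representation \<Delta> v \<alpha>"

lemma coeff_linear: "linear_functional (coeff \<alpha>)"
  using linear_functional_representation[OF simple_independent span_simple]
  by (simp add: coeff_def[abs_def])

lemmas coeff_simps = linear_functional_simps[OF coeff_linear]

lemma coeff_simple: "\<beta> \<in> \<Delta> \<Longrightarrow> coeff \<alpha> \<beta> = (if \<alpha> = \<beta> then 1 else 0)"
  by (simp add: coeff_def vec.representation_basis[OF simple_independent])

lemma coeff_expansion: "v = (\<Sum>\<alpha>\<in>\<Delta>. coeff \<alpha> v *s \<alpha>)"
  using vec.sum_representation_eq[OF simple_independent, of v \<Delta>]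
  by (simp add: span_simple finite_simple coeff_def)

lemma coeff_zero_imp_zero: "(\<And>\<alpha>. \<alpha> \<in> \<Delta> \<Longrightarrow> coeff \<alpha> v = 0) \<Longrightarrow> v = 0"
  by (subst coeff_expansion) simp

lemma coeff_combination: "\<beta> \<in> \<Delta> \<Longrightarrow> coeff \<beta> (\<Sum>\<alpha>\<in>\<Delta>. c \<alpha> *s \<alpha>) = c \<beta>"
  by (simp add: coeff_simps coeff_simple finite_simple if_distrib cong: sum.cong if_cong)

lemma coeff_refl: "coeff \<beta> (refl \<alpha> v) = coeff \<beta> v - coroot \<alpha> v * coeff \<beta> \<alpha>"
  by (simp add: reflection_def coeff_simps)

definition nonneg :: "rat ^ 'n \<Rightarrow> bool" where
  "nonneg v \<longleftrightarrow> (\<forall>\<alpha>\<in>\<Delta>. 0 \<le> coeff \<alpha> v)"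

lemma nonneg_add: "nonneg u \<Longrightarrow> nonneg v \<Longrightarrow> nonneg (u + v)"
  and nonneg_scale: "0 \<le> c \<Longrightarrow> nonneg v \<Longrightarrow> nonneg (c *s v)"
  and nonneg_zero: "nonneg 0"
  and nonneg_simple: "\<alpha> \<in> \<Delta> \<Longrightarrow> nonneg \<alpha>"
  by (auto simp: nonneg_def coeff_simps coeff_simple)

lemma root_sign: "\<beta> \<in> \<Phi> \<Longrightarrow> nonneg \<beta> \<or> nonneg (- \<beta>)"
  using simple_signs[of \<beta>] by (auto simp: nonneg_def coeff_combination)

lemma root_nonneg_if: "\<beta> \<in> \<Phi> \<Longrightarrow> \<alpha> \<in> \<Delta> \<Longrightarrow> 0 < coeff \<alpha> \<beta> \<Longrightarrow> nonneg \<beta>"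
  using root_sign[of \<beta>] by (force simp: nonneg_def coeff_simps)

text \<open>For distinct simple roots, \<open>refl \<alpha> \<beta>\<close> is a root in which \<open>\<beta>\<close> has coefficient \<open>1\<close>, so its
  other coefficients cannot be negative.\<close>

lemma coroot_simple_nonpos:
  assumes "\<alpha> \<in> \<Delta>" "\<beta> \<in> \<Delta>" "\<alpha> \<noteq> \<beta>"
  shows "coroot \<alpha> \<beta> \<le> 0"
proof -
  have "refl \<alpha> \<beta> \<in> \<Phi>" using assms simple_root reflection_root by blast
  then have "nonneg (refl \<alpha> \<beta>)"
    using assms by (intro root_nonneg_if[of _ \<beta>]) (auto simp: coeff_refl coeff_simple)
  then have "0 \<le> coeff \<alpha> (refl \<alpha> \<beta>)" using assms by (simp add: nonneg_def)
  then show ?thesis using assms by (simp add: coeff_refl coeff_simple)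
qed

lemma refl_positive_root:
  assumes \<alpha>: "\<alpha> \<in> \<Delta>" and \<gamma>: "\<gamma> \<in> \<Phi>" "nonneg \<gamma>" "\<gamma> \<noteq> \<alpha>"
  shows "nonneg (refl \<alpha> \<gamma>)"
proof -
  have "\<exists>\<beta>\<in>\<Delta>. \<beta> \<noteq> \<alpha> \<and> 0 < coeff \<beta> \<gamma>"
  proof (rule ccontr)
    assume "\<not> ?thesis"
    then have z: "coeff \<beta> \<gamma> = 0" if "\<beta> \<in> \<Delta>" "\<beta> \<noteq> \<alpha>" for \<beta>
      using \<gamma>(2) that by (force simp: nonneg_def)
    have "\<gamma> - coeff \<alpha> \<gamma> *s \<alpha> = 0"
      by (rule coeff_zero_imp_zero) (use \<alpha> z in \<open>auto simp: coeff_simps coeff_simple\<close>)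
    then have eq: "\<gamma> = coeff \<alpha> \<gamma> *s \<alpha>" by simp
    then have "coeff \<alpha> \<gamma> = 1 \<or> coeff \<alpha> \<gamma> = -1"
      using reduced[OF simple_root[OF \<alpha>], of "coeff \<alpha> \<gamma>"] \<gamma>(1) by simp
    moreover have "0 \<le> coeff \<alpha> \<gamma>" using \<gamma>(2) \<alpha> by (simp add: nonneg_def)
    ultimately show False using eq \<gamma>(3) by auto
  qed
  then obtain \<beta> where "\<beta> \<in> \<Delta>" "\<beta> \<noteq> \<alpha>" "0 < coeff \<beta> \<gamma>" by blast
  then show ?thesis using \<alpha> \<gamma>(1) simple_root reflection_root
    by (intro root_nonneg_if[of _ \<beta>]) (auto simp: coeff_refl coeff_simple)
qed

definition word :: "(rat ^ 'n) list \<Rightarrow> rat ^ 'n \<Rightarrow> rat ^ 'n" where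
  "word ts v = foldr refl ts v"

lemma word_simps [simp]: "word [] v = v" "word (t # ts) v = refl t (word ts v)"
  "word (ts @ us) v = word ts (word us v)"
  by (simp_all add: word_def)

lemma weyl_group_eq: "weyl_group coroot \<Delta> = {word ts | ts. set ts \<subseteq> \<Delta>}"
proof
  show "weyl_group coroot \<Delta> \<subseteq> {word ts | ts. set ts \<subseteq> \<Delta>}"
  proof
    fix w assume "w \<in> weyl_group coroot \<Delta>"
    then show "w \<in> {word ts | ts. set ts \<subseteq> \<Delta>}"
    proof induction
      case weyl_id
      have "id = word []" by (simp add: fun_eq_iff)
      moreover have "set [] \<subseteq> \<Delta>" by simp
      ultimately show ?case by blast
    next
      case (weyl_step s w)
      then obtain t ts where "t \<in> \<Delta>" "s = refl t" "w = word ts" "set ts \<subseteq> \<Delta>"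
        by (auto simp: simple_reflections_def)
      then have "s \<circ> w = word (t # ts)" "set (t # ts) \<subseteq> \<Delta>" by (auto simp: fun_eq_iff)
      then show ?case by blast
    qed
  qed
  show "{word ts | ts. set ts \<subseteq> \<Delta>} \<subseteq> weyl_group coroot \<Delta>"
  proof clarify
    fix ts assume "set ts \<subseteq> \<Delta>"
    then show "word ts \<in> weyl_group coroot \<Delta>"
    proof (induction ts)
      case Nil
      have "word [] = id" by (simp add: fun_eq_iff)
      then show ?case using weyl_group.weyl_id by metis
    next
      case (Cons t ts)
      have "word (t # ts) = refl t \<circ> word ts" by (simp add: fun_eq_iff)
      moreover have "refl t \<circ> word ts \<in> weyl_group coroot \<Delta>"
        using Cons by (intro weyl_group.weyl_step) (auto simp: simple_reflections_def)
      ultimately show ?case by metis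
    qed
  qed
qed

lemma word_linear:
  assumes "set ts \<subseteq> \<Delta>"
  shows "word ts (u + v) = word ts u + word ts v" "word ts (c *s v) = c *s word ts v"
    "word ts (u - v) = word ts u - word ts v"
  using assms by (induction ts) (auto simp: refl_simps simple_root)

lemma word_root: "set ts \<subseteq> \<Delta> \<Longrightarrow> \<alpha> \<in> \<Phi> \<Longrightarrow> word ts \<alpha> \<in> \<Phi>"
  by (induction ts) (auto simp: reflection_root simple_root)

lemma coroot_word:
  assumes "set ts \<subseteq> \<Delta>" "\<alpha> \<in> \<Phi>"
  shows "coroot (word ts \<alpha>) (word ts v) = coroot \<alpha> v"
  using assms
proof (induction ts)
  case (Cons t ts)
  then have "coroot (refl t (word ts \<alpha>)) (refl t (word ts v)) = coroot (word ts \<alpha>) (word ts v)"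
    by (subst coroot_refl) (auto simp: simple_root word_root refl_simps)
  then show ?case using Cons by simp
qed simp

lemma word_refl:
  assumes "set ts \<subseteq> \<Delta>" "\<alpha> \<in> \<Phi>"
  shows "word ts (refl \<alpha> v) = refl (word ts \<alpha>) (word ts v)"
  by (simp add: reflection_def word_linear[OF assms(1)] coroot_word[OF assms])

text \<open>The exchange property: follow \<open>\<alpha>\<close> through the word from the right; at the letter that
  makes it negative it equals the simple root of that letter, which can be deleted.\<close>

lemma exchange:
  assumes "set ts \<subseteq> \<Delta>" "\<alpha> \<in> \<Delta>" "\<not> nonneg (word ts \<alpha>)"
  shows "\<exists>us. set us \<subseteq> \<Delta> \<and> length us + 1 = length ts \<and> (\<forall>v. word ts (refl \<alpha> v) = word us v)"
  using assms
proof (induction ts)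
  case Nil
  then show ?case using nonneg_simple by simp
next
  case (Cons t ts)
  then have t: "t \<in> \<Delta>" "t \<in> \<Phi>" and ts: "set ts \<subseteq> \<Delta>" and \<alpha>: "\<alpha> \<in> \<Phi>" using simple_root by auto
  show ?case
  proof (cases "nonneg (word ts \<alpha>)")
    case True
    then have "word ts \<alpha> = t"
      using Cons.prems refl_positive_root[OF t(1) word_root[OF ts \<alpha>]] by auto
    then have "word (t # ts) (refl \<alpha> v) = word ts v" for v
      using t by (simp add: word_refl[OF ts \<alpha>] refl_simps)
    then show ?thesis using ts by auto
  next
    case False
    then obtain us where us: "set us \<subseteq> \<Delta>" "length us + 1 = length ts"
      "\<forall>v. word ts (refl \<alpha> v) = word us v"
      using Cons ts by blast
    then have "set (t # us) \<subseteq> \<Delta> \<and> length (t # us) + 1 = length (t # ts) \<and>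
        (\<forall>v. word (t # ts) (refl \<alpha> v) = word (t # us) v)"
      using t by auto
    then show ?thesis by blast
  qed
qed

abbreviation chamber :: "(rat ^ 'n) set" where
  "chamber \<equiv> weyl_chamber coroot \<Delta>"

text \<open>A dominant vector is the largest element of its orbit. In
  \<open>x - w (refl \<alpha> x) = (x - w x) + coroot \<alpha> x *s w \<alpha>\<close> the last term is nonnegative if \<open>w \<alpha>\<close> is a
  positive root; otherwise the word can be shortened.\<close>

lemma dominance:
  assumes x: "x \<in> chamber" and ts: "set ts \<subseteq> \<Delta>"
  shows "nonneg (x - word ts x)"
  using ts
proof (induction "length ts" arbitrary: ts rule: less_induct)
  case less
  show ?case
  proof (cases ts rule: rev_cases)
    case Nil
    then show ?thesis by (simp add: nonneg_zero)
  next
    case (snoc us \<alpha>)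
    then have us: "set us \<subseteq> \<Delta>" and \<alpha>: "\<alpha> \<in> \<Delta>" using less.prems by auto
    show ?thesis
    proof (cases "nonneg (word us \<alpha>)")
      case True
      have "x - word ts x = (x - word us x) + coroot \<alpha> x *s word us \<alpha>"
        using snoc by (simp add: reflection_def word_linear[OF us])
      moreover have "nonneg (x - word us x)" using less.hyps[of us] us snoc by simp
      moreover have "0 \<le> coroot \<alpha> x" using x \<alpha> by (simp add: weyl_chamber_def)
      ultimately show ?thesis using True nonneg_add nonneg_scale by metis
    next
      case False
      from exchange[OF us \<alpha> False] obtain vs where vs: "set vs \<subseteq> \<Delta>"
        "length vs + 1 = length us" "\<forall>v. word us (refl \<alpha> v) = word vs v" by blast
      then have "word ts x = word vs x" using snoc by simp
      then show ?thesis using less.hyps[of vs] vs snoc by simp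
    qed
  qed
qed

end


section \<open>The orbit polytope at a dominant vertex\<close>

context based_root_system
begin

abbreviation polytope :: "rat ^ 'n \<Rightarrow> (rat ^ 'n) set" where
  "polytope \<equiv> orbit_polytope coroot \<Delta>"

definition orbit :: "rat ^ 'n \<Rightarrow> (rat ^ 'n) set" where
  "orbit x = {word ts x | ts. set ts \<subseteq> \<Delta>}"

lemma polytope_conv_orbit: "polytope x = conv (orbit x)"
  unfolding orbit_polytope_def orbit_def weyl_group_eq by (rule arg_cong[of _ _ conv]) blast

lemma orbit_self: "x \<in> orbit x"
  unfolding orbit_def by (rule CollectI, rule exI[of _ "[]"]) simp

lemma refl_orbit_subset:
  assumes "t \<in> \<Delta>" "y \<in> orbit x"
  shows "refl t y \<in> orbit x"
proof -
  obtain ts where "y = word ts x" "set ts \<subseteq> \<Delta>" using assms(2) by (auto simp: orbit_def)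
  then have "refl t y = word (t # ts) x" "set (t # ts) \<subseteq> \<Delta>" using assms(1) by auto
  then show ?thesis unfolding orbit_def by blast
qed

lemma refl_orbit:
  assumes t: "t \<in> \<Delta>"
  shows "refl t ` orbit x = orbit x"
proof
  show "refl t ` orbit x \<subseteq> orbit x" using refl_orbit_subset[OF t] by blast
  show "orbit x \<subseteq> refl t ` orbit x"
  proof
    fix y assume "y \<in> orbit x"
    then show "y \<in> refl t ` orbit x"
      by (intro rev_image_eqI[OF refl_orbit_subset[OF t]]) (simp_all add: refl_simps simple_root t)
  qed
qed

lemma refl_polytope: "t \<in> \<Delta> \<Longrightarrow> refl t ` polytope x = polytope x"
  unfolding polytope_conv_orbit
  by (rule involution_conv) (simp_all add: refl_involution simple_root refl_orbit)

lemma polytope_self: "x \<in> polytope x"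
  unfolding polytope_conv_orbit using conv_superset orbit_self by blast

lemma refl_mem_polytope: "t \<in> \<Delta> \<Longrightarrow> y \<in> polytope x \<Longrightarrow> refl t y \<in> polytope x"
  using refl_polytope[of t x] by blast

lemma card_edges_at_orbit:
  assumes "v \<in> orbit x"
  shows "card (edges_at v (polytope x)) = card (edges_at x (polytope x))"
proof -
  have "card (edges_at (word ts x) (polytope x)) = card (edges_at x (polytope x))"
    if "set ts \<subseteq> \<Delta>" for ts
    using that
  proof (induction ts)
    case (Cons t ts)
    then have t: "t \<in> \<Delta>" by simp
    have "card (edges_at (refl t (word ts x)) (polytope x)) = card (edges_at (word ts x) (polytope x))"
      using involution_card_edges_at[OF refl_involution[OF simple_root[OF t]] refl_polytope[OF t]] .
    then show ?case using Cons by simp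
  qed simp
  then show ?thesis using assms by (auto simp: orbit_def)
qed

lemma nonneg_diff_polytope:
  assumes x: "x \<in> chamber" and y: "y \<in> polytope x"
  shows "nonneg (x - y)"
  unfolding nonneg_def
proof
  fix \<alpha> assume \<alpha>: "\<alpha> \<in> \<Delta>"
  have "coeff \<alpha> z \<le> coeff \<alpha> x" if "z \<in> orbit x" for z
    using that dominance[OF x] \<alpha> by (auto simp: orbit_def nonneg_def coeff_simps)
  then have "coeff \<alpha> y \<le> coeff \<alpha> x"
    by (rule linear_functional_le_conv[OF coeff_linear _ y[unfolded polytope_conv_orbit]])
  then show "0 \<le> coeff \<alpha> (x - y)" by (simp add: coeff_simps)
qed

text \<open>If \<open>J\<close> is the set of simple roots orthogonal to a dominant \<open>x\<close>, these are the directions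
  of the edges of the orbit polytope at \<open>x\<close>: the translates of the simple roots outside \<open>J\<close>
  under the group generated by the reflections in \<open>J\<close>.\<close>

inductive_set edge_dirs :: "(rat ^ 'n) set \<Rightarrow> (rat ^ 'n) set" for J where
  edge_dirs_simple: "s \<in> \<Delta> - J \<Longrightarrow> s \<in> edge_dirs J"
| edge_dirs_refl: "b \<in> edge_dirs J \<Longrightarrow> t \<in> J \<Longrightarrow> refl t b \<in> edge_dirs J"

lemma edge_dirs_coeff:
  assumes J: "J \<subseteq> \<Delta>" and b: "b \<in> edge_dirs J"
  shows "\<exists>s\<in>\<Delta> - J. \<forall>t\<in>\<Delta> - J. coeff t b = (if t = s then 1 else 0)"
  using b
proof induction
  case (edge_dirs_simple s)
  then have "\<forall>t\<in>\<Delta> - J. coeff t s = (if t = s then 1 else 0)" by (simp add: coeff_simple)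
  with edge_dirs_simple show ?case by (rule_tac bexI)
next
  case (edge_dirs_refl b t)
  then obtain s where s: "s \<in> \<Delta> - J" "\<forall>t\<in>\<Delta> - J. coeff t b = (if t = s then 1 else 0)" by blast
  have "coeff u (refl t b) = coeff u b" if "u \<in> \<Delta> - J" for u
  proof -
    have "t \<in> \<Delta>" "u \<noteq> t" using that edge_dirs_refl.hyps J by auto
    then show ?thesis by (simp add: coeff_refl coeff_simple)
  qed
  with s show ?case by (intro bexI[OF _ s(1)]) simp
qed

text \<open>A subspace that is stable under the reflections in \<open>J\<close> and contains \<open>v\<close> contains every
  \<open>u \<in> J\<close> with \<open>coroot u v \<noteq> 0\<close>; so connectedness of the diagram spreads the span from
  the simple roots outside \<open>J\<close> to all simple roots.\<close>

lemma span_edge_dirs: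
  assumes conn: "\<And>X. X \<subset> \<Delta> \<Longrightarrow> X \<noteq> {} \<Longrightarrow> \<exists>u\<in>\<Delta> - X. \<exists>v\<in>X. coroot u v \<noteq> 0"
    and J: "J \<subset> \<Delta>"
  shows "vec.span (edge_dirs J) = UNIV"
proof -
  let ?S = "vec.span (edge_dirs J)"
  have stable: "refl t v \<in> ?S" if t: "t \<in> J" and v: "v \<in> ?S" for t v
    using v
  proof (induction rule: vec.span_induct_alt)
    case base
    have "refl t 0 = 0" using t J simple_root by (auto simp: refl_simps)
    then show ?case by (simp add: vec.span_zero)
  next
    case (step c b v)
    have "refl t (c *s b + v) = c *s refl t b + refl t v"
      using t J simple_root by (auto simp: refl_simps)
    moreover have "refl t b \<in> ?S" by (intro vec.span_base edge_dirs_refl step.hyps(1) t)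
    ultimately show ?case using step.IH by (simp add: vec.span_add vec.span_scale)
  qed
  define X where "X = {\<alpha> \<in> \<Delta>. \<alpha> \<in> ?S}"
  have out: "\<Delta> - J \<subseteq> X"
    unfolding X_def using edge_dirs_simple[of _ J] vec.span_base[of _ "edge_dirs J"] by blast
  have "X = \<Delta>"
  proof (rule ccontr)
    assume "X \<noteq> \<Delta>"
    then have "X \<subset> \<Delta>" "X \<noteq> {}" using out J by (auto simp: X_def)
    from conn[OF this] obtain u v where u: "u \<in> \<Delta> - X" and v: "v \<in> X" "coroot u v \<noteq> 0" by blast
    have "v \<in> ?S" using v(1) by (simp add: X_def)
    moreover have "refl u v \<in> ?S" using u out by (intro stable \<open>v \<in> ?S\<close>) blast
    ultimately have "v - refl u v \<in> ?S" by (rule vec.span_diff)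
    then have "coroot u v *s u \<in> ?S" by (simp add: reflection_def)
    then have "inverse (coroot u v) *s (coroot u v *s u) \<in> ?S" by (rule vec.span_scale)
    then have "u \<in> ?S" using v(2) by simp
    then show False using u by (auto simp: X_def)
  qed
  then have "\<Delta> \<subseteq> ?S" by (auto simp: X_def)
  then have "vec.span \<Delta> \<subseteq> ?S" by (intro vec.span_minimal) auto
  then show ?thesis using span_simple by blast
qed

end

locale dominant_vertex = based_root_system \<Phi> coroot \<Delta>
  for \<Phi> :: "(rat ^ 'n) set" and coroot :: "rat ^ 'n \<Rightarrow> rat ^ 'n \<Rightarrow> rat" and \<Delta> +
  fixes x :: "rat ^ 'n" and J :: "(rat ^ 'n) set"
  assumes x_dominant: "x \<in> chamber"
    and J_def: "J = {\<alpha> \<in> \<Delta>. coroot \<alpha> x = 0}"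
    and J_proper: "J \<noteq> \<Delta>"
    and connected: "\<And>X. X \<subset> \<Delta> \<Longrightarrow> X \<noteq> {} \<Longrightarrow> \<exists>u\<in>\<Delta> - X. \<exists>v\<in>X. coroot u v \<noteq> 0"
begin

lemma J_subset: "J \<subseteq> \<Delta>"
  by (auto simp: J_def)

lemma J_root: "t \<in> J \<Longrightarrow> t \<in> \<Phi>"
  using J_subset simple_root by blast

lemma refl_x: "t \<in> J \<Longrightarrow> refl t x = x"
  using J_def by (subst refl_fixed_iff) (auto intro: J_root)

lemma refl_diff_x: "t \<in> J \<Longrightarrow> x - refl t y = refl t (x - y)"
  by (simp add: refl_simps J_root refl_x)

lemma span_edge_dirs': "vec.span (edge_dirs J) = UNIV"
proof (rule span_edge_dirs)
  show "\<exists>u\<in>\<Delta> - X. \<exists>v\<in>X. coroot u v \<noteq> 0" if "X \<subset> \<Delta>" "X \<noteq> {}" for X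
    using connected[OF that] .
  show "J \<subset> \<Delta>" using J_subset J_proper by (rule psubsetI)
qed

lemma edge_end:
  assumes "b \<in> edge_dirs J"
  shows "\<exists>y\<in>polytope x. \<exists>c>0. x - y = c *s b"
  using assms
proof induction
  case (edge_dirs_simple s)
  then have s: "s \<in> \<Delta>" "0 < coroot s x"
    using x_dominant by (auto simp: J_def weyl_chamber_def less_le)
  show ?case
  proof (intro bexI exI conjI)
    show "refl s x \<in> polytope x" using s by (simp add: refl_mem_polytope polytope_self)
    show "x - refl s x = coroot s x *s s" by (simp add: reflection_def)
  qed (rule s)
next
  case (edge_dirs_refl b t)
  then obtain y c where y: "y \<in> polytope x" "c > 0" "x - y = c *s b" by blast
  have "x - refl t y = c *s refl t b"
    using y(3) edge_dirs_refl.hyps by (simp add: refl_diff_x refl_simps(2) J_root)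
  moreover have "refl t y \<in> polytope x"
    using y(1) edge_dirs_refl.hyps J_subset by (auto intro: refl_mem_polytope)
  ultimately show ?case using y(2) by blast
qed

lemma zero_notin_edge_dirs: "0 \<notin> edge_dirs J"
proof
  assume "0 \<in> edge_dirs J"
  from edge_dirs_coeff[OF J_subset this] obtain s where "s \<in> \<Delta> - J" "coeff s 0 = 1" by force
  then show False by (simp add: coeff_simps)
qed

lemma polytope_dim_polytope: "polytope_dim (polytope x) = vec.dim (UNIV :: (rat ^ 'n) set)"
proof -
  let ?D = "{y - z | y z. y \<in> polytope x \<and> z \<in> polytope x}"
  have "b \<in> vec.span ?D" if b: "b \<in> edge_dirs J" for b
  proof -
    obtain y c where y: "y \<in> polytope x" "c > 0" "x - y = c *s b" using edge_end[OF b] by blast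
    have "x - y \<in> ?D" using y(1) polytope_self by auto
    then have "inverse c *s (c *s b) \<in> vec.span ?D"
      unfolding y(3)[symmetric] by (intro vec.span_scale vec.span_base)
    then show ?thesis using y(2) by simp
  qed
  then have "vec.span (edge_dirs J) \<subseteq> vec.span ?D" by (intro vec.span_minimal) auto
  then have "vec.span ?D = UNIV" using span_edge_dirs' by blast
  then have "vec.dim ?D = vec.dim (UNIV :: (rat ^ 'n) set)" by (intro vec.span_eq_dim) simp
  then show ?thesis by (simp add: polytope_dim_def)
qed

definition height :: "(rat ^ 'n) set \<Rightarrow> rat ^ 'n \<Rightarrow> rat" where
  "height A v = (\<Sum>\<alpha>\<in>A. coeff \<alpha> v)"

lemma height_linear: "linear_functional (height A)"
  using linear_functional_combination[of A coeff "\<lambda>_. 1"]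
  by (simp add: height_def[abs_def] coeff_linear)

lemma height_diff: "height A (u - v) = height A u - height A v"
  by (rule linear_functional_diff[OF height_linear])

lemma coeff_diff_nonneg: "y \<in> polytope x \<Longrightarrow> \<alpha> \<in> \<Delta> \<Longrightarrow> 0 \<le> coeff \<alpha> (x - y)"
  using nonneg_diff_polytope[OF x_dominant] by (simp add: nonneg_def)

lemma height_le:
  assumes "A \<subseteq> \<Delta>" "y \<in> polytope x"
  shows "height A y \<le> height A x"
proof -
  have "0 \<le> height A (x - y)"
    unfolding height_def by (rule sum_nonneg) (use assms coeff_diff_nonneg in blast)
  then show ?thesis by (simp add: height_diff)
qed

lemma height_eq_imp:
  assumes "A \<subseteq> \<Delta>" "y \<in> polytope x" "height A y = height A x" "\<alpha> \<in> A"
  shows "coeff \<alpha> (x - y) = 0"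
proof -
  have "(\<Sum>\<alpha>\<in>A. coeff \<alpha> (x - y)) = 0"
    using assms(3) height_diff[of A x y] by (simp add: height_def)
  moreover have "finite A" using assms(1) finite_simple finite_subset by blast
  moreover have "0 \<le> coeff \<alpha> (x - y)" if "\<alpha> \<in> A" for \<alpha>
    using that assms(1,2) coeff_diff_nonneg by blast
  ultimately show ?thesis using assms(4) by (simp add: sum_nonneg_eq_0_iff)
qed

text \<open>The vertex \<open>x\<close> is exposed by the sum of all coefficients: if it has the same value at \<open>y\<close>, then all
  coefficients of \<open>x - y\<close>, being nonnegative, vanish.\<close>

lemma is_vertex_x:
  assumes "x \<in> e" "e \<subseteq> polytope x"
  shows "is_vertex x e"
proof -
  have "y = x" if "y \<in> e" "height \<Delta> y = height \<Delta> x" for y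
    using coeff_zero_imp_zero[of "x - y"] height_eq_imp[of \<Delta> y] that assms(2) by auto
  then have "{x} = {y \<in> e. height \<Delta> y = height \<Delta> x}" using assms(1) by blast
  moreover have "height \<Delta> y \<le> height \<Delta> x" if "y \<in> e" for y
    using that assms(2) by (intro height_le) auto
  ultimately show ?thesis unfolding is_vertex_def by (intro is_faceI[OF height_linear])
qed

text \<open>All vertices lie in one orbit, so it suffices to count edges at the dominant one.\<close>

lemma simple_polytope_iff:
  "simple_polytope (polytope x) \<longleftrightarrow> card (edges_at x (polytope x)) = card \<Delta>"
proof -
  have def: "simple_polytope (polytope x) \<longleftrightarrow>
      (\<forall>v. is_vertex v (polytope x) \<longrightarrow> card (edges_at v (polytope x)) = card \<Delta>)"
    unfolding simple_polytope_def edges_at_def polytope_dim_polytope card_simple ..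
  have eq: "card (edges_at v (polytope x)) = card (edges_at x (polytope x))"
    if "is_vertex v (polytope x)" for v
  proof -
    from that have "v \<in> orbit x" unfolding polytope_conv_orbit by (rule vertex_conv_generator)
    then show ?thesis by (rule card_edges_at_orbit)
  qed
  have "is_vertex x (polytope x)" by (simp add: is_vertex_x polytope_self)
  then show ?thesis unfolding def using eq by metis
qed

definition edge_of :: "rat ^ 'n \<Rightarrow> (rat ^ 'n) set" where
  "edge_of b = {y \<in> polytope x. \<exists>c\<ge>0. x - y = c *s b}"

lemma edge_of_subset: "edge_of b \<subseteq> polytope x"
  by (auto simp: edge_of_def)

lemma x_in_edge_of: "x \<in> edge_of b"
  unfolding edge_of_def by (intro CollectI conjI exI[of _ 0]) (simp_all add: polytope_self)

text \<open>The edge in the direction of a simple root \<open>s\<close> is exposed by the sum of the other coefficients.\<close>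

lemma edge_of_simple:
  assumes s: "s \<in> \<Delta> - J"
  shows "edge_of s \<in> edges_at x (polytope x)"
proof -
  let ?A = "\<Delta> - {s}"
  have iff: "height ?A y = height ?A x \<longleftrightarrow> (\<exists>c\<ge>0. x - y = c *s s)" if y: "y \<in> polytope x" for y
  proof
    assume "height ?A y = height ?A x"
    then have z: "coeff \<alpha> (x - y) = 0" if "\<alpha> \<in> ?A" for \<alpha>
      using height_eq_imp[OF _ y] that by blast
    have "(x - y) - coeff s (x - y) *s s = 0"
    proof (rule coeff_zero_imp_zero)
      fix \<alpha> assume \<alpha>: "\<alpha> \<in> \<Delta>"
      have "coeff \<alpha> (x - y - coeff s (x - y) *s s)
          = coeff \<alpha> (x - y) - coeff s (x - y) * coeff \<alpha> s"
        by (simp only: coeff_simps)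
      then show "coeff \<alpha> (x - y - coeff s (x - y) *s s) = 0"
        using z[of \<alpha>] s \<alpha> by (cases "\<alpha> = s") (simp_all add: coeff_simple)
    qed
    then have "x - y = coeff s (x - y) *s s" by (rule eq_iff_diff_eq_0[THEN iffD2])
    moreover have "0 \<le> coeff s (x - y)" using coeff_diff_nonneg[OF y] s by blast
    ultimately show "\<exists>c\<ge>0. x - y = c *s s" by blast
  next
    assume "\<exists>c\<ge>0. x - y = c *s s"
    then obtain c where "x - y = c *s s" by blast
    moreover have "height ?A (c *s s) = 0" using s by (simp add: height_def coeff_simps coeff_simple)
    ultimately show "height ?A y = height ?A x" using height_diff[of ?A x y] by simp
  qed
  have "edge_of s = {y \<in> polytope x. height ?A y = height ?A x}"
    unfolding edge_of_def using iff by blast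
  then have face: "is_face (edge_of s) (polytope x)"
    using height_le[of ?A] by (intro is_faceI[OF height_linear]) auto
  obtain y c where y: "y \<in> polytope x" "c > 0" "x - y = c *s s"
    using edge_end[OF edge_dirs_simple[OF s]] by blast
  let ?D = "{u - v | u v. u \<in> edge_of s \<and> v \<in> edge_of s}"
  have "u - v \<in> vec.span {s}" if uv: "u \<in> edge_of s" "v \<in> edge_of s" for u v
  proof -
    obtain c d where "x - u = c *s s" "x - v = d *s s" using uv by (auto simp: edge_of_def)
    moreover have "u - v = (x - v) - (x - u)" by simp
    ultimately have "u - v = (d - c) *s s" by (simp add: vec.scale_left_diff_distrib)
    then show ?thesis by (simp add: vec.span_base vec.span_scale)
  qed
  then have "?D \<subseteq> vec.span {s}" by blast
  moreover have "s \<in> vec.span ?D"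
  proof -
    have "y \<in> edge_of s" using y less_imp_le by (auto simp: edge_of_def)
    then have "x - y \<in> ?D" using x_in_edge_of by blast
    then have "inverse c *s (x - y) \<in> vec.span ?D" by (intro vec.span_scale vec.span_base)
    then show ?thesis using y(2,3) by simp
  qed
  ultimately have "vec.span ?D = vec.span {s}"
    by (intro equalityI vec.span_minimal) (simp_all add: vec.subspace_span)
  then have "vec.dim ?D = vec.dim {s}" by (rule vec.span_eq_dim)
  moreover have "s \<noteq> 0" using s simple_root zero_not_root by blast
  ultimately have "polytope_dim (edge_of s) = 1" by (simp add: polytope_dim_def)
  then show ?thesis using face is_vertex_x[OF x_in_edge_of edge_of_subset]
    by (simp add: edges_at_def is_edge_def)
qed

lemma edge_of_refl:
  assumes t: "t \<in> J"
  shows "edge_of (refl t b) = refl t ` edge_of b"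
proof -
  have sub: "refl t y \<in> edge_of (refl t b)" if "y \<in> edge_of b" for y b
  proof -
    from that obtain c where c: "y \<in> polytope x" "c \<ge> 0" "x - y = c *s b"
      unfolding edge_of_def by blast
    have "x - refl t y = c *s refl t b"
      using c(3) t by (simp add: refl_diff_x refl_simps(2) J_root)
    then show ?thesis using c t J_subset refl_mem_polytope by (auto simp: edge_of_def)
  qed
  have "y \<in> refl t ` edge_of b" if "y \<in> edge_of (refl t b)" for y
    using sub[OF that] J_root[OF t] by (intro rev_image_eqI[of "refl t y"]) (simp_all add: refl_simps)
  then show ?thesis using sub by blast
qed

lemma edge_of_edge: "b \<in> edge_dirs J \<Longrightarrow> edge_of b \<in> edges_at x (polytope x)"
proof (induction rule: edge_dirs.induct)
  case (edge_dirs_simple s)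
  then show ?case by (rule edge_of_simple)
next
  case (edge_dirs_refl b t)
  have "refl t ` edge_of b \<in> edges_at (refl t x) (polytope x)"
    using edge_dirs_refl J_root J_subset
    by (intro involution_edges_at refl_involution refl_polytope) auto
  then show ?case using edge_dirs_refl.hyps by (simp add: edge_of_refl refl_x)
qed

text \<open>An edge direction is normalised by its coefficients outside \<open>J\<close>, one of which is \<open>1\<close>
  while the others vanish; so different directions span different rays.\<close>

lemma inj_on_edge_of: "inj_on edge_of (edge_dirs J)"
proof (rule inj_onI)
  fix b b' assume b: "b \<in> edge_dirs J" "b' \<in> edge_dirs J" and eq: "edge_of b = edge_of b'"
  obtain y c where y: "y \<in> polytope x" "c > 0" "x - y = c *s b" using edge_end[OF b(1)] by blast
  then have "y \<in> edge_of b" using less_imp_le by (auto simp: edge_of_def)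
  then obtain c' where c': "x - y = c' *s b'" using eq by (auto simp: edge_of_def)
  have cc: "c *s b = c' *s b'" using y(3) c' by simp
  obtain s where s: "s \<in> \<Delta> - J" "\<forall>t\<in>\<Delta> - J. coeff t b = (if t = s then 1 else 0)"
    using edge_dirs_coeff[OF J_subset b(1)] by blast
  obtain s' where s': "s' \<in> \<Delta> - J" "\<forall>t\<in>\<Delta> - J. coeff t b' = (if t = s' then 1 else 0)"
    using edge_dirs_coeff[OF J_subset b(2)] by blast
  have "c * coeff s b = c' * coeff s b'" using arg_cong[OF cc, of "coeff s"]
    by (simp add: coeff_simps)
  then have "c = c'" using s s' y(2) by (auto split: if_splits)
  then show "b = b'" using cc y(2) by (simp add: vec.scale_cancel_left)
qed

text \<open>At a vertex with \<open>card \<Delta>\<close> edges there are at most \<open>card \<Delta>\<close> edge directions, and they span a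
  space of this dimension.\<close>

lemma simple_imp_independent:
  assumes "simple_polytope (polytope x)"
  shows "vec.independent (edge_dirs J)"
proof -
  have c: "card (edges_at x (polytope x)) = card \<Delta>" using assms simple_polytope_iff by blast
  have "card \<Delta> \<noteq> 0" using J_subset J_proper finite_simple by auto
  then have fin: "finite (edges_at x (polytope x))" using c card.infinite by force
  have sub: "edge_of ` edge_dirs J \<subseteq> edges_at x (polytope x)" using edge_of_edge by blast
  then have "finite (edge_dirs J)" using inj_on_edge_of fin by (meson finite_subset finite_imageD)
  moreover have "card (edge_dirs J) \<le> card \<Delta>"
    using card_mono[OF fin sub] c by (simp add: card_image[OF inj_on_edge_of])
  ultimately show ?thesis
    using span_edge_dirs' card_simple by (intro vec.card_le_dim_spanning[of _ UNIV]) auto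
qed

text \<open>If the edge directions generate the cone of the polytope at \<open>x\<close>, there are no further edges:
  the functional of an edge is constant along each direction that occurs with a positive
  coefficient in another point of this edge.\<close>

lemma edges_at_eq:
  assumes fin: "finite (edge_dirs J)"
    and cone: "\<And>y. y \<in> polytope x \<Longrightarrow>
      \<exists>d. (\<forall>b\<in>edge_dirs J. 0 \<le> d b) \<and> x - y = (\<Sum>b\<in>edge_dirs J. d b *s b)"
  shows "edges_at x (polytope x) = edge_of ` edge_dirs J"
proof
  show "edge_of ` edge_dirs J \<subseteq> edges_at x (polytope x)" using edge_of_edge by blast
  show "edges_at x (polytope x) \<subseteq> edge_of ` edge_dirs J"
  proof
    fix e assume e: "e \<in> edges_at x (polytope x)"
    then have "is_face e (polytope x)" "is_face {x} e"
      by (simp_all add: edges_at_def is_edge_def is_vertex_def)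
    then obtain f a where f: "linear_functional f" and le: "\<And>y. y \<in> polytope x \<Longrightarrow> f y \<le> a"
      and e_eq: "e = {y \<in> polytope x. f y = a}" and xe: "x \<in> e"
      by (elim is_faceE) blast
    note fs = linear_functional_simps[OF f]
    have fx: "f x = a" using xe e_eq by blast
    let ?D = "{u - v | u v. u \<in> e \<and> v \<in> e}"
    have dim: "vec.dim ?D = 1" using e by (simp add: edges_at_def is_edge_def polytope_dim_def)
    have "\<exists>y\<in>e. y \<noteq> x"
    proof (rule ccontr)
      assume "\<not> (\<exists>y\<in>e. y \<noteq> x)"
      then have "u - v = 0" if "u \<in> e" "v \<in> e" for u v
        using that by (metis diff_self)
      then have "?D \<subseteq> {0}" by blast
      then have "vec.dim ?D = 0" by simp
      then show False using dim by simp
    qed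
    then obtain y where y: "y \<in> e" "y \<noteq> x" by blast
    have fpos: "0 \<le> f b" if b: "b \<in> edge_dirs J" for b
    proof -
      obtain z c where z: "z \<in> polytope x" "c > 0" "x - z = c *s b" using edge_end[OF b] by blast
      have "0 \<le> f (x - z)" using le z(1) fx by (simp add: fs)
      then have "0 \<le> c * f b" by (simp only: z(3) fs)
      then show ?thesis using z(2) by (simp add: zero_le_mult_iff)
    qed
    obtain d where d: "\<forall>b\<in>edge_dirs J. 0 \<le> d b" "x - y = (\<Sum>b\<in>edge_dirs J. d b *s b)"
      using cone y(1) e_eq by blast
    have "\<exists>b\<in>edge_dirs J. d b \<noteq> 0"
    proof (rule ccontr)
      assume "\<not> ?thesis"
      then have "x - y = 0" unfolding d(2) by (intro sum.neutral) auto
      then show False using y(2) by simp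
    qed
    then obtain b where b: "b \<in> edge_dirs J" "d b > 0" using d(1) by (force simp: less_le)
    have "f (x - y) = 0" using y(1) e_eq fx by (simp add: fs)
    then have "(\<Sum>b\<in>edge_dirs J. d b * f b) = 0" by (simp only: d(2) fs)
    then have "d b * f b = 0"
      using sum_nonneg_eq_0_iff[OF fin, of "\<lambda>b. d b * f b"] d(1) fpos b(1) by simp
    then have fb: "f b = 0" using b(2) by simp
    have "edge_of b \<subseteq> e"
    proof
      fix z assume "z \<in> edge_of b"
      then obtain c where z: "z \<in> polytope x" "x - z = c *s b" by (auto simp: edge_of_def)
      have "f (x - z) = 0" by (simp only: z(2) fs fb)
      then show "z \<in> e" using z(1) fx e_eq by (simp add: fs)
    qed
    moreover have "e \<subseteq> edge_of b"
    proof
      fix z assume z: "z \<in> e"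
      obtain y c where y: "y \<in> polytope x" "c > 0" "x - y = c *s b" using edge_end[OF b(1)] by blast
      have "y \<in> edge_of b" using y less_imp_le by (auto simp: edge_of_def)
      then have "y \<in> e" using \<open>edge_of b \<subseteq> e\<close> by blast
      then have "x - y \<in> ?D" using xe by blast
      then have "inverse c *s (x - y) \<in> vec.span ?D" by (intro vec.span_scale vec.span_base)
      then have "b \<in> vec.span ?D" using y(2,3) by simp
      \<comment> \<open>The differences of points of \<open>e\<close> span a line, which is the one through \<open>b\<close>.\<close>
      moreover have "vec.independent {b}" using b(1) zero_notin_edge_dirs
        by (auto simp: vec.independent_insert)
      ultimately have "vec.span ?D \<subseteq> vec.span {b}"
        by (intro vec.card_ge_dim_independent[of "{b}" "vec.span ?D"]) (simp_all add: dim)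
      moreover have "x - z \<in> vec.span ?D" using xe z by (blast intro: vec.span_base)
      ultimately obtain k where k: "x - z = k *s b" by (auto simp: vec.span_singleton)
      obtain s where s: "s \<in> \<Delta> - J" "coeff s b = 1"
        using edge_dirs_coeff[OF J_subset b(1)] by force
      have zP: "z \<in> polytope x" using z e_eq by blast
      have "0 \<le> coeff s (x - z)"
        using nonneg_diff_polytope[OF x_dominant zP] s(1) by (simp add: nonneg_def)
      then have "0 \<le> k" by (simp add: k coeff_simps s(2))
      then show "z \<in> edge_of b" using zP k by (auto simp: edge_of_def)
    qed
    ultimately show "e \<in> edge_of ` edge_dirs J" using b(1) by blast
  qed
qed

end


section \<open>Prescribed stabilisers\<close>

context based_root_system
begin

lemma finite_weyl_group: "finite (weyl_group coroot \<Delta>)"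
proof -
  let ?W = "weyl_group coroot \<Delta>"
  have "inj_on (\<lambda>w. restrict w \<Phi>) ?W"
  proof (rule inj_onI)
    fix w w' assume w: "w \<in> ?W" "w' \<in> ?W" and eq: "restrict w \<Phi> = restrict w' \<Phi>"
    obtain ts us where ts: "w = word ts" "set ts \<subseteq> \<Delta>" and us: "w' = word us" "set us \<subseteq> \<Delta>"
      using w by (auto simp: weyl_group_eq)
    have agree: "w \<beta> = w' \<beta>" if "\<beta> \<in> \<Phi>" for \<beta>
      using fun_cong[OF eq, of \<beta>] that by simp
    show "w = w'"
    proof
      fix v
      have "v \<in> vec.span \<Phi>" using span_roots by simp
      then show "w v = w' v"
      proof (induction rule: vec.span_induct_alt)
        case base
        show ?case using word_linear(2)[OF ts(2), of 0 0] word_linear(2)[OF us(2), of 0 0]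
          by (simp add: ts(1) us(1))
      next
        case (step c b v)
        then show ?case using agree[of b]
          by (simp add: ts(1) us(1) word_linear[OF ts(2)] word_linear[OF us(2)])
      qed
    qed
  qed
  moreover have "(\<lambda>w. restrict w \<Phi>) ` ?W \<subseteq> \<Phi> \<rightarrow>\<^sub>E \<Phi>"
    using word_root by (auto simp: weyl_group_eq)
  moreover have "finite (\<Phi> \<rightarrow>\<^sub>E \<Phi>)" using finite_roots by (intro finite_PiE) auto
  ultimately show ?thesis using finite_subset finite_imageD by metis
qed

text \<open>The sum of all elements of the Weyl group maps each simple root \<open>\<alpha>\<close> to its negative,
  because \<open>w \<mapsto> w \<circ> refl \<alpha>\<close> permutes the group; hence it is \<open>0\<close>. On a fixed vector it is
  multiplication by the order of the group.\<close>

lemma orthogonal_to_simple_imp_zero: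
  assumes v: "\<And>\<alpha>. \<alpha> \<in> \<Delta> \<Longrightarrow> coroot \<alpha> v = 0"
  shows "v = 0"
proof -
  let ?W = "weyl_group coroot \<Delta>"
  define S where "S u = (\<Sum>w\<in>?W. w u)" for u
  have add: "S (u + u') = S u + S u'" and scale: "S (c *s u) = c *s S u" for u u' c
  proof -
    have "S (u + u') = (\<Sum>w\<in>?W. w u + w u')"
      unfolding S_def by (rule sum.cong) (auto simp: weyl_group_eq word_linear)
    then show "S (u + u') = S u + S u'" by (simp add: S_def sum.distrib)
    have "S (c *s u) = (\<Sum>w\<in>?W. c *s w u)"
      unfolding S_def by (rule sum.cong) (auto simp: weyl_group_eq word_linear)
    then show "S (c *s u) = c *s S u" by (simp add: S_def vec.scale_sum_right)
  qed
  have simple: "S \<alpha> = 0" if \<alpha>: "\<alpha> \<in> \<Delta>" for \<alpha>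
  proof -
    have closed: "w \<circ> refl \<alpha> \<in> ?W" if "w \<in> ?W" for w
    proof -
      from that obtain ts where ts: "w = word ts" "set ts \<subseteq> \<Delta>" by (auto simp: weyl_group_eq)
      have "w \<circ> refl \<alpha> = word (ts @ [\<alpha>])" by (rule ext) (simp add: ts(1))
      moreover have "set (ts @ [\<alpha>]) \<subseteq> \<Delta>" using ts(2) \<alpha> by simp
      ultimately show ?thesis unfolding weyl_group_eq by blast
    qed
    have inv: "w \<circ> refl \<alpha> \<circ> refl \<alpha> = w" for w :: "rat ^ 'n \<Rightarrow> rat ^ 'n"
      by (rule ext) (simp add: refl_simps simple_root \<alpha>)
    have "S \<alpha> = S (refl \<alpha> \<alpha>)" unfolding S_def
    proof (rule sum.reindex_bij_witness[of _ "\<lambda>w. w \<circ> refl \<alpha>" "\<lambda>w. w \<circ> refl \<alpha>"])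
      fix w assume "w \<in> ?W"
      then show "w \<circ> refl \<alpha> \<in> ?W" "w \<circ> refl \<alpha> \<in> ?W" by (fact closed)+
      show "w \<circ> refl \<alpha> \<circ> refl \<alpha> = w" "w \<circ> refl \<alpha> \<circ> refl \<alpha> = w" by (fact inv)+
      show "(w \<circ> refl \<alpha>) (refl \<alpha> \<alpha>) = w \<alpha>" by (simp add: refl_simps simple_root \<alpha>)
    qed
    also have "\<dots> = - S \<alpha>" using scale[of "-1" \<alpha>] by (simp add: refl_self simple_root \<alpha>)
    finally show ?thesis by (simp add: vec_eq_iff)
  qed
  have "v \<in> vec.span \<Delta>" using span_simple by simp
  then have "S v = 0"
  proof (induction rule: vec.span_induct_alt)
    case base
    show ?case using scale[of 0 0] by simp
  next
    case (step c b u)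
    then show ?case using simple[of b] by (simp add: add scale)
  qed
  moreover have "S v = of_nat (card ?W) *s v"
  proof -
    have "word ts v = v" if "set ts \<subseteq> \<Delta>" for ts
      using that v by (induction ts) (simp_all add: reflection_def)
    then have "S v = (\<Sum>w\<in>?W. v)"
      unfolding S_def by (intro sum.cong) (auto simp: weyl_group_eq)
    then show ?thesis by (simp add: vec_eq_iff of_nat_index)
  qed
  moreover have "card ?W \<noteq> 0" using finite_weyl_group weyl_group.weyl_id[of coroot \<Delta>] by auto
  ultimately show ?thesis by simp
qed

lemma dominant_with_stabiliser:
  assumes J: "J \<subseteq> \<Delta>"
  shows "\<exists>x\<in>chamber. \<forall>\<alpha>\<in>\<Delta>. coroot \<alpha> x = 0 \<longleftrightarrow> \<alpha> \<in> J"
proof -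
  define L where "L v = (\<Sum>\<alpha>\<in>\<Delta>. coroot \<alpha> v *s \<alpha>)" for v
  have cL: "coeff \<alpha> (L v) = coroot \<alpha> v" if "\<alpha> \<in> \<Delta>" for \<alpha> v
    using that by (simp add: L_def coeff_combination)
  have "L (u + v) = L u + L v" for u v
  proof -
    have "L (u + v) = (\<Sum>\<alpha>\<in>\<Delta>. coroot \<alpha> u *s \<alpha> + coroot \<alpha> v *s \<alpha>)" unfolding L_def
      by (rule sum.cong) (simp_all add: coroot_simps simple_root vec.scale_left_distrib)
    then show ?thesis by (simp add: L_def sum.distrib)
  qed
  moreover have "L (c *s v) = c *s L v" for c v
  proof -
    have "L (c *s v) = (\<Sum>\<alpha>\<in>\<Delta>. c *s (coroot \<alpha> v *s \<alpha>))" unfolding L_def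
      by (rule sum.cong) (simp_all add: coroot_simps simple_root)
    then show ?thesis by (simp add: L_def vec.scale_sum_right)
  qed
  ultimately have "Vector_Spaces.linear (*s) (*s) L"
    by (simp add: Vector_Spaces.linear_iff vec.vector_space_axioms)
  moreover have "inj L"
  proof (rule injI)
    fix u v assume "L u = L v"
    then have "coroot \<alpha> (u - v) = 0" if "\<alpha> \<in> \<Delta>" for \<alpha>
      unfolding coroot_simps(5)[OF simple_root[OF that]]
      using cL[OF that, of u] cL[OF that, of v] that by simp
    then show "u = v" using orthogonal_to_simple_imp_zero[of "u - v"] by simp
  qed
  ultimately have "surj L" by (rule vec.linear_inj_imp_surj)
  then obtain x where x: "(\<Sum>\<alpha>\<in>\<Delta>. (if \<alpha> \<in> J then 0 else 1) *s \<alpha>) = L x"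
    by (rule surjE)
  have "coroot \<alpha> x = (if \<alpha> \<in> J then 0 else 1)" if "\<alpha> \<in> \<Delta>" for \<alpha>
    using cL[OF that, of x] that unfolding x[symmetric] by (simp only: coeff_combination)
  then have "x \<in> chamber" "\<forall>\<alpha>\<in>\<Delta>. coroot \<alpha> x = 0 \<longleftrightarrow> \<alpha> \<in> J" by (simp_all add: weyl_chamber_def)
  then show ?thesis by blast
qed


section \<open>Independent edge directions\<close>

text \<open>Every reflection in \<open>J\<close> acts on independent edge directions as a transposition: if it
  moves \<open>b\<close> and \<open>b'\<close>, then \<open>b - refl t b\<close> and \<open>b' - refl t b'\<close> are both multiples of \<open>t\<close>,
  which is a linear relation.\<close>

lemma independent_moved:
  assumes indep: "vec.independent (edge_dirs J)" and t: "t \<in> J" "t \<in> \<Delta>"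
    and b: "b \<in> edge_dirs J" "coroot t b \<noteq> 0" and b': "b' \<in> edge_dirs J" "coroot t b' \<noteq> 0"
  shows "b' = b \<or> b' = refl t b"
proof (rule ccontr)
  assume neq: "\<not> (b' = b \<or> b' = refl t b)"
  let ?B = "edge_dirs J - {b'}"
  define k where "k = coroot t b' / coroot t b"
  have "refl t b' \<noteq> b'" using b'(2) t simple_root by (simp add: refl_fixed_iff)
  then have mem: "refl t b' \<in> ?B" "b \<in> ?B" "refl t b \<in> ?B"
    using neq b b' t edge_dirs_refl by auto
  have "k * coroot t b = coroot t b'" using b(2) by (simp add: k_def)
  then have "b' = refl t b' + k *s (b - refl t b)" by (simp add: reflection_def)
  moreover have "refl t b' + k *s (b - refl t b) \<in> vec.span ?B"
    by (intro vec.span_add vec.span_scale vec.span_diff vec.span_base mem)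
  ultimately have "b' \<in> vec.span ?B" by (rule ssubst)
  then show False using indep b'(1) unfolding vec.dependent_def by blast
qed

lemma coroot_expansion: "coroot \<beta> v = (\<Sum>\<alpha>\<in>\<Delta>. coeff \<alpha> v * coroot \<beta> \<alpha>)" if "\<beta> \<in> \<Phi>"
  by (subst coeff_expansion) (simp add: coroot_simps[OF that])

lemma coroot_neg:
  assumes u: "u \<in> \<Delta>" "coeff u b = 0" and b: "nonneg b" and v: "v \<in> \<Delta>" "0 < coeff v b" "coroot u v \<noteq> 0"
  shows "coroot u b < 0"
proof -
  have nonpos: "coeff \<alpha> b * coroot u \<alpha> \<le> 0" if "\<alpha> \<in> \<Delta>" for \<alpha>
  proof (cases "\<alpha> = u")
    case False
    then show ?thesis using that b coroot_simple_nonpos[OF u(1) that]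
      by (intro mult_nonneg_nonpos) (auto simp: nonneg_def)
  qed (simp add: u)
  have "u \<noteq> v" using u v by auto
  then have "coroot u v < 0" using coroot_simple_nonpos[OF u(1) v(1)] v(3) by simp
  then have "coeff v b * coroot u v < 0" using v(2) by (simp add: mult_pos_neg)
  then have "(\<Sum>\<alpha>\<in>\<Delta>. coeff \<alpha> b * coroot u \<alpha>) < (\<Sum>\<alpha>\<in>\<Delta>. 0)"
    using nonpos v(1) by (intro sum_strict_mono_ex1 finite_simple) auto
  then show ?thesis using coroot_expansion[OF simple_root[OF u(1)], of b] by simp
qed

end

text \<open>Starting from a node outside \<open>J\<close>, a connected set of nodes is built up by adding nodes of
  \<open>J\<close>. These sets are supports of edge directions, because the reflection in a neighbour \<open>u\<close>
  of the support adds a positive multiple of \<open>u\<close>.\<close>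

inductive grown :: "(nat \<Rightarrow> nat \<Rightarrow> bool) \<Rightarrow> nat set \<Rightarrow> nat set \<Rightarrow> nat set \<Rightarrow> bool"
  for adj S J where
  grown_start: "s \<in> S - J \<Longrightarrow> grown adj S J {s}"
| grown_step: "grown adj S J X \<Longrightarrow> u \<in> J \<Longrightarrow> u \<notin> X \<Longrightarrow> v \<in> X \<Longrightarrow> adj u v \<Longrightarrow> grown adj S J (insert u X)"

text \<open>The combinatorial trace of independence: every node of \<open>J\<close> can be added to only one set.\<close>

definition unique_growth :: "(nat \<Rightarrow> nat \<Rightarrow> bool) \<Rightarrow> nat set \<Rightarrow> nat set \<Rightarrow> bool" where
  "unique_growth adj S J \<longleftrightarrow> (\<forall>X X' u v v'. grown adj S J X \<longrightarrow> grown adj S J X' \<longrightarrow> u \<in> J \<longrightarrow>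
     u \<notin> X \<longrightarrow> u \<notin> X' \<longrightarrow> v \<in> X \<longrightarrow> adj u v \<longrightarrow> v' \<in> X' \<longrightarrow> adj u v' \<longrightarrow> X = X')"

lemma unique_growthD:
  assumes "unique_growth adj S J" "grown adj S J X" "grown adj S J X'" "u \<in> J" "u \<notin> X" "u \<notin> X'"
    "v \<in> X" "adj u v" "v' \<in> X'" "adj u v'"
  shows "X = X'"
  using assms unfolding unique_growth_def by blast

locale numbered_root_system = based_root_system \<Phi> coroot \<Delta>
  for \<Phi> :: "(rat ^ 'n) set" and coroot :: "rat ^ 'n \<Rightarrow> rat ^ 'n \<Rightarrow> rat" and \<Delta> +
  fixes \<alpha> :: "nat \<Rightarrow> rat ^ 'n" and N :: nat
  assumes numbering: "bij_betw \<alpha> {1..N} \<Delta>"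
begin

definition nodes :: "nat set" where
  "nodes = {1..N}"

abbreviation entry :: "nat \<Rightarrow> nat \<Rightarrow> rat" where
  "entry i j \<equiv> coroot (\<alpha> i) (\<alpha> j)"

abbreviation linked :: "nat \<Rightarrow> nat \<Rightarrow> bool" where
  "linked i j \<equiv> entry i j \<noteq> 0"

lemma nodes_iff: "i \<in> nodes \<longleftrightarrow> 1 \<le> i \<and> i \<le> N"
  by (simp add: nodes_def)

lemma finite_nodes [simp]: "finite nodes"
  and card_nodes [simp]: "card nodes = N"
  by (simp_all add: nodes_def)

lemma inj_on_nodes: "inj_on \<alpha> nodes"
  and simple_eq: "\<Delta> = \<alpha> ` nodes"
  using numbering by (simp_all add: bij_betw_def nodes_def)

lemma node_simple: "i \<in> nodes \<Longrightarrow> \<alpha> i \<in> \<Delta>"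
  by (simp add: simple_eq)

lemma node_root: "i \<in> nodes \<Longrightarrow> \<alpha> i \<in> \<Phi>"
  by (simp add: node_simple simple_root)

lemma node_eq_iff: "i \<in> nodes \<Longrightarrow> j \<in> nodes \<Longrightarrow> \<alpha> i = \<alpha> j \<longleftrightarrow> i = j"
  using inj_on_nodes by (meson inj_on_eq_iff)

lemma node_image_iff: "J \<subseteq> nodes \<Longrightarrow> i \<in> nodes \<Longrightarrow> \<alpha> i \<in> \<alpha> ` J \<longleftrightarrow> i \<in> J"
  using node_eq_iff by blast

lemma coeff_node: "i \<in> nodes \<Longrightarrow> j \<in> nodes \<Longrightarrow> coeff (\<alpha> i) (\<alpha> j) = (if i = j then 1 else 0)"
  by (simp add: coeff_simple node_simple node_eq_iff)

definition has_support :: "rat ^ 'n \<Rightarrow> nat set \<Rightarrow> bool" where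
  "has_support b X \<longleftrightarrow>
     (\<forall>i\<in>nodes. if i \<in> X then 0 < coeff (\<alpha> i) b else coeff (\<alpha> i) b = 0)"

lemma has_support_nonneg: "has_support b X \<Longrightarrow> nonneg b"
  unfolding nonneg_def
proof
  fix \<beta> assume "has_support b X" "\<beta> \<in> \<Delta>"
  moreover obtain i where "i \<in> nodes" "\<beta> = \<alpha> i" using \<open>\<beta> \<in> \<Delta>\<close> simple_eq by blast
  ultimately show "0 \<le> coeff \<beta> b" by (cases "i \<in> X") (auto simp: has_support_def less_imp_le)
qed

lemma has_support_coroot_neg:
  assumes "has_support b X" "X \<subseteq> nodes" "u \<in> nodes" "u \<notin> X" "v \<in> X" "linked u v"
  shows "coroot (\<alpha> u) b < 0"
  using assms
  by (intro coroot_neg[of _ _ "\<alpha> v"] has_support_nonneg node_simple) (auto simp: has_support_def)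

lemma has_support_insert:
  assumes "has_support b X" "u \<in> nodes" "u \<notin> X" "coroot (\<alpha> u) b < 0"
  shows "has_support (refl (\<alpha> u) b) (insert u X)"
  using assms by (auto simp: has_support_def coeff_refl coeff_node)

lemma grown_nodes: "J \<subseteq> nodes \<Longrightarrow> grown linked nodes J X \<Longrightarrow> X \<subseteq> nodes"
  by (rotate_tac, induction rule: grown.induct) auto

lemma grown_support:
  assumes J: "J \<subseteq> nodes" and "grown linked nodes J X"
  shows "\<exists>b\<in>edge_dirs (\<alpha> ` J). has_support b X"
  using assms(2)
proof induction
  case (grown_start s)
  then have "\<alpha> s \<in> \<Delta> - \<alpha> ` J" using J by (simp add: node_simple node_image_iff)
  then have "\<alpha> s \<in> edge_dirs (\<alpha> ` J)" by (rule edge_dirs_simple)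
  moreover have "has_support (\<alpha> s) {s}" using grown_start by (auto simp: has_support_def coeff_node)
  ultimately show ?case by blast
next
  case (grown_step X u v)
  then obtain b where b: "b \<in> edge_dirs (\<alpha> ` J)" "has_support b X" by blast
  have u: "u \<in> nodes" using grown_step J by blast
  have "has_support (refl (\<alpha> u) b) (insert u X)"
    using b(2) u grown_step grown_nodes[OF J] by (intro has_support_insert has_support_coroot_neg)
  moreover have "refl (\<alpha> u) b \<in> edge_dirs (\<alpha> ` J)" using b(1) grown_step by (intro edge_dirs_refl) auto
  ultimately show ?case by blast
qed

lemma independent_unique_growth:
  assumes J: "J \<subseteq> nodes" and indep: "vec.independent (edge_dirs (\<alpha> ` J))"
  shows "unique_growth linked nodes J"
  unfolding unique_growth_def
proof (intro allI impI)
  fix X X' u v v'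
  assume X: "grown linked nodes J X" and X': "grown linked nodes J X'" and u: "u \<in> J" "u \<notin> X" "u \<notin> X'"
    and v: "v \<in> X" "linked u v" "v' \<in> X'" "linked u v'"
  obtain b where b: "b \<in> edge_dirs (\<alpha> ` J)" "has_support b X" using grown_support[OF J X] by blast
  obtain b' where b': "b' \<in> edge_dirs (\<alpha> ` J)" "has_support b' X'" using grown_support[OF J X'] by blast
  have un: "u \<in> nodes" using u J by blast
  note sub = grown_nodes[OF J X] grown_nodes[OF J X']
  have neg: "coroot (\<alpha> u) b < 0" "coroot (\<alpha> u) b' < 0"
    using has_support_coroot_neg[OF b(2) sub(1) un] has_support_coroot_neg[OF b'(2) sub(2) un] u v
    by auto
  have "b' = b \<or> b' = refl (\<alpha> u) b"
    using neg u(1) un b(1) b'(1) by (intro independent_moved[OF indep]) (auto simp: node_simple)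
  moreover have "b' \<noteq> refl (\<alpha> u) b"
    using has_support_insert[OF b(2) un u(2) neg(1)] b'(2) u(3) un by (force simp: has_support_def)
  ultimately have "b' = b" by blast
  then have "i \<in> X \<longleftrightarrow> i \<in> X'" if "i \<in> nodes" for i
  proof -
    have "if i \<in> X then 0 < coeff (\<alpha> i) b else coeff (\<alpha> i) b = 0"
      and "if i \<in> X' then 0 < coeff (\<alpha> i) b else coeff (\<alpha> i) b = 0"
      using b(2) b'(2) that \<open>b' = b\<close> unfolding has_support_def by blast+
    then show ?thesis by (auto split: if_splits)
  qed
  then show "X = X'" using sub by blast
qed

text \<open>After adding the two ends \<open>t, u\<close> of a multiple bond in this order, \<open>t\<close> moves the edge
  direction again.\<close>

lemma independent_no_multiple_bond:
  assumes J: "J \<subseteq> nodes" and indep: "vec.independent (edge_dirs (\<alpha> ` J))"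
    and X: "grown linked nodes J X" and t: "t \<in> J" "t \<notin> X" "v \<in> X" "linked t v"
    and u: "u \<in> J" "u \<noteq> t" "u \<notin> X" "\<And>i. i \<in> X \<Longrightarrow> \<not> linked u i"
    and bond: "2 \<le> entry t u * entry u t"
  shows False
proof -
  obtain b where b: "b \<in> edge_dirs (\<alpha> ` J)" "has_support b X" using grown_support[OF J X] by blast
  have n: "t \<in> nodes" "u \<in> nodes" using t u J by auto
  note cs = coroot_simps[OF node_root[OF n(1)]] coroot_simps[OF node_root[OF n(2)]]
  define p where "p = coroot (\<alpha> t) b"
  have p: "p < 0" unfolding p_def using b t n grown_nodes[OF J X] by (intro has_support_coroot_neg)
  have "coeff (\<alpha> i) b * entry u i = 0" if "i \<in> nodes" for i
    using u(4) b(2) that by (cases "i \<in> X") (auto simp: has_support_def)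
  then have ub: "coroot (\<alpha> u) b = 0"
    unfolding coroot_expansion[OF node_root[OF n(2)], of b] simple_eq by (intro sum.neutral) auto
  define b1 where "b1 = refl (\<alpha> t) b"
  define b2 where "b2 = refl (\<alpha> u) b1"
  have mem: "b2 \<in> edge_dirs (\<alpha> ` J)" unfolding b1_def b2_def using b(1) t u
    by (intro edge_dirs_refl) auto
  have tb1: "coroot (\<alpha> t) b1 = - p" and ub1: "coroot (\<alpha> u) b1 = - p * entry u t"
    using n by (simp_all add: b1_def reflection_def cs p_def ub coroot_self node_root)
  have "coroot (\<alpha> t) b2 = p * (entry t u * entry u t - 1)"
    unfolding b2_def reflection_def by (simp add: cs tb1 ub1 algebra_simps)
  then have "coroot (\<alpha> t) b2 \<noteq> 0" using p bond by simp
  then have "b2 = b \<or> b2 = b1" unfolding b1_def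
    using b(1) mem t n p by (intro independent_moved[OF indep]) (auto simp: p_def node_simple)
  moreover have 0: "coeff (\<alpha> u) b = 0" using b(2) u(3) n by (simp add: has_support_def)
  moreover have 1: "coeff (\<alpha> u) b1 = 0" using u(2) n 0 by (simp add: b1_def coeff_refl coeff_node)
  moreover have "coeff (\<alpha> u) b2 = p * entry u t"
    unfolding b2_def coeff_refl ub1 1 using n by (simp add: coeff_node)
  then have "coeff (\<alpha> u) b2 \<noteq> 0" using p bond by auto
  ultimately show False by metis
qed

end


section \<open>Forests of paths\<close>

text \<open>The nodes of \<open>J\<close> form disjoint paths without multiple bonds, each attached by one end to a
  node outside \<open>J\<close>, different paths to different nodes: \<open>p t\<close> is the next node on the way from \<open>t\<close>
  to the outside, and \<open>r\<close> decreases on this way. Then the edge directions correspond to the nodes: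
  \<open>dir v\<close> is the image of the outside node under the reflections along the path that ends
  at \<open>v\<close>.\<close>

locale path_forest = numbered_root_system \<Phi> coroot \<Delta> \<alpha> N
  for \<Phi> :: "(rat ^ 'n) set" and coroot :: "rat ^ 'n \<Rightarrow> rat ^ 'n \<Rightarrow> rat" and \<Delta> \<alpha> N +
  fixes J :: "nat set" and p r :: "nat \<Rightarrow> nat"
  assumes J_nodes: "J \<subseteq> nodes"
    and p_node: "t \<in> J \<Longrightarrow> p t \<in> nodes"
    and p_inj: "inj_on p J"
    and p_linked: "t \<in> J \<Longrightarrow> coroot (\<alpha> t) (\<alpha> (p t)) \<noteq> 0"
    and rank: "t \<in> J \<Longrightarrow> r (p t) < r t"
    and neighbour: "t \<in> J \<Longrightarrow> v \<in> nodes \<Longrightarrow> v \<noteq> t \<Longrightarrow> coroot (\<alpha> t) (\<alpha> v) \<noteq> 0 \<Longrightarrow>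
      v = p t \<or> v \<in> J \<and> p v = t"
    and simple_bond: "t \<in> J \<Longrightarrow> p t \<in> J \<Longrightarrow> coroot (\<alpha> t) (\<alpha> (p t)) = -1"
      "t \<in> J \<Longrightarrow> p t \<in> J \<Longrightarrow> coroot (\<alpha> (p t)) (\<alpha> t) = -1"
begin

definition dir :: "nat \<Rightarrow> rat ^ 'n" where
  "dir = wfrec {(p t, t) | t. t \<in> J} (\<lambda>f v. if v \<in> J then refl (\<alpha> v) (f (p v)) else \<alpha> v)"

lemma dir_outside: "v \<notin> J \<Longrightarrow> dir v = \<alpha> v"
  and dir_inside: "v \<in> J \<Longrightarrow> dir v = refl (\<alpha> v) (dir (p v))"
proof -
  have "wf {(p t, t) | t. t \<in> J}"
    by (rule wf_subset[OF wf_measure[of r]]) (auto simp: rank)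
  note rec = wfrec[OF this, of "\<lambda>f v. if v \<in> J then refl (\<alpha> v) (f (p v)) else \<alpha> v" v,
      folded dir_def]
  show "v \<notin> J \<Longrightarrow> dir v = \<alpha> v" using rec by simp
  show "v \<in> J \<Longrightarrow> dir v = refl (\<alpha> v) (dir (p v))" using rec by (auto simp: cut_apply)
qed

lemma J_node: "t \<in> J \<Longrightarrow> t \<in> nodes"
  using J_nodes by blast

lemma p_neq: "t \<in> J \<Longrightarrow> p t \<noteq> t"
  using rank by force

lemma coroot_dir_step:
  "v \<in> J \<Longrightarrow> u \<in> nodes \<Longrightarrow>
    coroot (\<alpha> u) (dir v) = coroot (\<alpha> u) (dir (p v)) - coroot (\<alpha> v) (dir (p v)) * entry u v"
  by (simp add: dir_inside reflection_def coroot_simps node_root)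

lemma coroot_dir:
  assumes "v \<in> nodes"
  shows "(v \<in> J \<longrightarrow> coroot (\<alpha> v) (dir (p v)) < 0) \<and>
    (\<forall>u\<in>J. u \<noteq> v \<longrightarrow> v \<noteq> p u \<longrightarrow> coroot (\<alpha> u) (dir v) = 0)"
  using assms
proof (induction "r v" arbitrary: v rule: less_induct)
  case less
  show ?case
  proof (cases "v \<in> J")
    case False
    then have "coroot (\<alpha> u) (dir v) = 0" if "u \<in> J" "u \<noteq> v" "v \<noteq> p u" for u
      using neighbour[OF that(1) less.prems] that(2,3) by (auto simp: dir_outside)
    then show ?thesis using False by blast
  next
    case True
    let ?w = "p v"
    have w: "?w \<in> nodes" using p_node[OF True] by simp
    have IH_neg: "coroot (\<alpha> ?w) (dir (p ?w)) < 0" if "?w \<in> J"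
      using less.hyps[OF rank[OF True] w] that by blast
    have IH_zero: "coroot (\<alpha> u) (dir ?w) = 0" if "u \<in> J" "u \<noteq> ?w" "?w \<noteq> p u" for u
      using less.hyps[OF rank[OF True] w] that by blast
    \<comment> \<open>Along a path without multiple bonds this value does not change.\<close>
    have const: "coroot (\<alpha> v) (dir ?w) = coroot (\<alpha> ?w) (dir (p ?w))" if wJ: "?w \<in> J"
    proof -
      have pw: "p ?w \<in> nodes" using p_node[OF wJ] by simp
      have r1: "r ?w < r v" and r2: "r (p ?w) < r ?w" using rank True wJ by auto
      have ne: "v \<noteq> p ?w" using r1 r2 by auto
      have ne2: "p ?w \<noteq> p v" using r2 by auto
      have r3: "r (p ?w) < r v" using r1 r2 by simp
      have "coroot (\<alpha> v) (dir (p ?w)) = 0"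
        using less.hyps[OF r3 pw] True ne ne2 by blast
      moreover have "entry v ?w = -1" using simple_bond(1)[OF True wJ] .
      ultimately show ?thesis using coroot_dir_step[OF wJ less.prems] by simp
    qed
    have neg: "coroot (\<alpha> v) (dir ?w) < 0"
    proof (cases "?w \<in> J")
      case True
      then show ?thesis using const IH_neg by simp
    next
      case False
      have "entry v ?w \<le> 0"
        using p_neq[OF True] less.prems w by (intro coroot_simple_nonpos) (auto simp: node_simple node_eq_iff)
      then show ?thesis using p_linked[OF True] False by (simp add: dir_outside)
    qed
    have "coroot (\<alpha> u) (dir v) = 0" if u: "u \<in> J" "u \<noteq> v" "v \<noteq> p u" for u
    proof (cases "u = ?w")
      case uw: True
      then have wJ: "?w \<in> J" using u(1) by simp
      have "coroot (\<alpha> ?w) (dir ?w) = - coroot (\<alpha> ?w) (dir (p ?w))"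
        using coroot_dir_step[OF wJ w] by (simp add: coroot_self node_root w)
      moreover have "entry ?w v = -1" using simple_bond(2)[OF True wJ] .
      ultimately show ?thesis
        using coroot_dir_step[OF True w] const[OF wJ] uw by simp
    next
      case False
      have "?w \<noteq> p u" using inj_onD[OF p_inj _ True u(1)] u(2) by blast
      then have "coroot (\<alpha> u) (dir ?w) = 0" using IH_zero[OF u(1) False] by blast
      moreover have "entry u v = 0"
        using neighbour[OF u(1) less.prems] u(2,3) False by blast
      ultimately show ?thesis using coroot_dir_step[OF True J_node[OF u(1)]] by simp
    qed
    then show ?thesis using neg by blast
  qed
qed

lemma refl_dir:
  assumes u: "u \<in> J" and v: "v \<in> nodes"
  shows "refl (\<alpha> u) (dir v) = dir (if v = u then p u else if v = p u then u else v)"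
proof -
  consider "v = u" | "v = p u" "v \<noteq> u" | "v \<noteq> u" "v \<noteq> p u" by blast
  then show ?thesis
  proof cases
    case 1
    then show ?thesis using u by (simp add: dir_inside refl_simps node_root J_node)
  next
    case 2
    then show ?thesis using u by (simp add: dir_inside)
  next
    case 3
    then have "coroot (\<alpha> u) (dir v) = 0" using coroot_dir[OF v] u by simp
    then show ?thesis using 3 by (simp add: reflection_def)
  qed
qed

lemma edge_dirs_eq: "edge_dirs (\<alpha> ` J) = dir ` nodes"
proof
  show "edge_dirs (\<alpha> ` J) \<subseteq> dir ` nodes"
  proof
    fix b assume "b \<in> edge_dirs (\<alpha> ` J)"
    then show "b \<in> dir ` nodes"
    proof induction
      case (edge_dirs_simple s)
      then obtain i where i: "i \<in> nodes" "s = \<alpha> i" using simple_eq by blast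
      then have "i \<notin> J" using edge_dirs_simple by blast
      then have "s = dir i" using i by (simp add: dir_outside)
      then show ?case using i(1) by blast
    next
      case (edge_dirs_refl b t)
      then obtain v u where v: "v \<in> nodes" "b = dir v" and u: "u \<in> J" "t = \<alpha> u" by blast
      have "(if v = u then p u else if v = p u then u else v) \<in> nodes"
        using v(1) J_node[OF u(1)] p_node[OF u(1)] by simp
      then show ?case using refl_dir[OF u(1) v(1)] u(2) v(2) by (metis imageI)
    qed
  qed
  have "dir v \<in> edge_dirs (\<alpha> ` J)" if "v \<in> nodes" for v
    using that
  proof (induction "r v" arbitrary: v rule: less_induct)
    case less
    show ?case
    proof (cases "v \<in> J")
      case True
      have "dir (p v) \<in> edge_dirs (\<alpha> ` J)"
        using less.hyps[OF rank[OF True]] p_node[OF True] by blast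
      then show ?thesis unfolding dir_inside[OF True] using True by (intro edge_dirs_refl imageI)
    next
      case False
      then have "\<alpha> v \<in> \<Delta> - \<alpha> ` J"
        using node_simple[OF less.prems] node_image_iff[OF J_nodes less.prems] by blast
      then show ?thesis unfolding dir_outside[OF False] by (rule edge_dirs_simple)
    qed
  qed
  then show "dir ` nodes \<subseteq> edge_dirs (\<alpha> ` J)" by blast
qed

lemma coeff_dir_childless:
  assumes v: "v \<in> nodes" "\<forall>u\<in>J. p u \<noteq> v"
  shows "w \<in> nodes \<Longrightarrow> w \<noteq> v \<Longrightarrow> coeff (\<alpha> v) (dir w) = 0"
    and "0 < coeff (\<alpha> v) (dir v)"
proof -
  show other: "coeff (\<alpha> v) (dir w) = 0" if "w \<in> nodes" "w \<noteq> v" for w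
    using that
  proof (induction "r w" arbitrary: w rule: less_induct)
    case less
    show ?case
    proof (cases "w \<in> J")
      case True
      have "coeff (\<alpha> v) (dir (p w)) = 0"
        using less.hyps[OF rank[OF True]] p_node[OF True] v(2) True by blast
      then show ?thesis using less.prems v(1)
        by (simp add: dir_inside[OF True] coeff_refl coeff_node)
    next
      case False
      then show ?thesis using less.prems v(1) by (simp add: dir_outside coeff_node)
    qed
  qed
  show "0 < coeff (\<alpha> v) (dir v)"
  proof (cases "v \<in> J")
    case True
    have "coeff (\<alpha> v) (dir (p v)) = 0" using other[OF p_node[OF True] p_neq[OF True]] .
    moreover have "coroot (\<alpha> v) (dir (p v)) < 0" using coroot_dir[OF v(1)] True by blast
    ultimately show ?thesis using v(1) by (simp add: dir_inside[OF True] coeff_refl coeff_node)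
  next
    case False
    then show ?thesis using v(1) by (simp add: dir_outside coeff_node)
  qed
qed

end

locale dominant_path_forest =
  path_forest \<Phi> coroot \<Delta> \<alpha> N J p r + dominant_vertex \<Phi> coroot \<Delta> x "\<alpha> ` J"
  for \<Phi> :: "(rat ^ 'n) set" and coroot :: "rat ^ 'n \<Rightarrow> rat ^ 'n \<Rightarrow> rat" and \<Delta> \<alpha> N J p r x
begin

lemma card_simple_nodes: "card \<Delta> = N"
  using bij_betw_same_card[OF numbering] by simp

lemma span_dir: "vec.span (dir ` nodes) = UNIV"
  using span_edge_dirs' by (simp only: edge_dirs_eq)

lemma independent_dir: "vec.independent (dir ` nodes)"
proof (rule vec.card_le_dim_spanning[of _ UNIV])
  show "card (dir ` nodes) \<le> vec.dim (UNIV :: (rat ^ 'n) set)"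
    using card_image_le[of nodes dir] card_simple_nodes card_simple by simp
qed (simp_all add: span_dir)

lemma card_dir: "card (dir ` nodes) = N"
proof -
  have "vec.dim (vec.span (dir ` nodes)) = card (dir ` nodes)"
    by (rule vec.dim_span_eq_card_independent[OF independent_dir])
  then show ?thesis using card_simple_nodes card_simple by (simp only: span_dir)
qed

lemma dir_eq_iff: "v \<in> nodes \<Longrightarrow> w \<in> nodes \<Longrightarrow> dir v = dir w \<longleftrightarrow> v = w"
  using eq_card_imp_inj_on[of nodes dir] card_dir by (auto dest: inj_onD)

definition coord :: "nat \<Rightarrow> rat ^ 'n \<Rightarrow> rat" where
  "coord v z = vec.representation (dir ` nodes) z (dir v)"

lemma coord_linear: "linear_functional (coord v)"
  using linear_functional_representation[OF independent_dir span_dir]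
  by (simp add: coord_def[abs_def])

lemma coord_dir:
  assumes "v \<in> nodes" "w \<in> nodes"
  shows "coord v (dir w) = (if v = w then 1 else 0)"
proof -
  have "coord v (dir w) = (if dir v = dir w then 1 else 0)"
    unfolding coord_def using vec.representation_basis[OF independent_dir, of "dir w"] assms(2)
    by simp
  then show ?thesis by (simp add: dir_eq_iff[OF assms])
qed

lemma linear_functional_eq_on_dirs:
  assumes "linear_functional f" "linear_functional g" "\<And>w. w \<in> nodes \<Longrightarrow> f (dir w) = g (dir w)"
  shows "f z = g z"
proof (rule linear_functional_eq_on_span[OF assms(1,2)])
  show "z \<in> vec.span (dir ` nodes)" by (simp add: span_dir)
qed (use assms(3) in blast)

text \<open>At the far end \<open>v\<close> of a path the coordinate is a positive multiple of the coefficient of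
  \<open>\<alpha> v\<close>, as no other direction involves \<open>\<alpha> v\<close>. The reflection in a node \<open>u\<close> of \<open>J\<close> exchanges
  the coordinates at \<open>u\<close> and \<open>p u\<close>, and it stabilises the polytope; this carries the sign along
  the path.\<close>

lemma coord_nonneg:
  assumes "v \<in> nodes" "y \<in> polytope x"
  shows "0 \<le> coord v (x - y)"
  using assms
proof (induction "(\<Sum>i\<in>nodes. r i) - r v" arbitrary: v y rule: less_induct)
  case less
  show ?case
  proof (cases "\<exists>u\<in>J. p u = v")
    case True
    then obtain u where u: "u \<in> J" "v = p u" by blast
    have un: "u \<in> nodes" using J_node[OF u(1)] .
    have "coord v z = coord u (refl (\<alpha> u) z)" for z
    proof (rule linear_functional_eq_on_dirs[OF coord_linear])
      show "linear_functional (\<lambda>z. coord u (refl (\<alpha> u) z))"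
        by (rule involution_functional[OF refl_involution[OF node_root[OF un]] coord_linear])
      fix w assume w: "w \<in> nodes"
      show "coord v (dir w) = coord u (refl (\<alpha> u) (dir w))"
        using less.prems(1) un w p_neq[OF u(1)] u(2) by (simp add: refl_dir[OF u(1) w] coord_dir)
    qed
    then have "coord v (x - y) = coord u (x - refl (\<alpha> u) y)"
      using refl_diff_x[of "\<alpha> u" y] u(1) by simp
    moreover have "refl (\<alpha> u) y \<in> polytope x"
      using refl_mem_polytope[OF node_simple[OF un] less.prems(2)] .
    moreover have "r v < r u" using rank[OF u(1)] u(2) by simp
    moreover have "r u \<le> (\<Sum>i\<in>nodes. r i)" using un by (intro member_le_sum) auto
    ultimately show ?thesis using less.hyps[of u "refl (\<alpha> u) y"] un by simp
  next
    case False
    then have no_child: "\<forall>u\<in>J. p u \<noteq> v" by blast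
    note leaf = coeff_dir_childless[OF less.prems(1) no_child]
    let ?k = "coeff (\<alpha> v) (dir v)"
    have "coeff (\<alpha> v) z = ?k * coord v z" for z
    proof (rule linear_functional_eq_on_dirs[OF coeff_linear])
      show "linear_functional (\<lambda>z. ?k * coord v z)"
        using linear_functional_combination[of "{v}" "coord" "\<lambda>_. ?k"] by (simp add: coord_linear)
      fix w assume w: "w \<in> nodes"
      show "coeff (\<alpha> v) (dir w) = ?k * coord v (dir w)"
        using leaf(1)[OF w] less.prems(1) w by (simp add: coord_dir)
    qed
    moreover have "0 \<le> coeff (\<alpha> v) (x - y)"
      using coeff_diff_nonneg[OF less.prems(2) node_simple[OF less.prems(1)]] .
    ultimately have "0 \<le> ?k * coord v (x - y)" by metis
    then show ?thesis using leaf(2) by (simp add: zero_le_mult_iff)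
  qed
qed

lemma simple: "simple_polytope (polytope x)"
proof -
  have "edges_at x (polytope x) = edge_of ` edge_dirs (\<alpha> ` J)"
  proof (rule edges_at_eq)
    show "finite (edge_dirs (\<alpha> ` J))" by (simp add: edge_dirs_eq)
    fix y assume y: "y \<in> polytope x"
    let ?d = "vec.representation (dir ` nodes) (x - y)"
    have "\<forall>b\<in>dir ` nodes. 0 \<le> ?d b"
      using coord_nonneg[OF _ y] unfolding coord_def by blast
    moreover have "x - y = (\<Sum>b\<in>dir ` nodes. ?d b *s b)"
      using vec.sum_representation_eq[OF independent_dir, of "x - y" "dir ` nodes"]
      by (simp add: span_dir eq_commute)
    ultimately show "\<exists>d. (\<forall>b\<in>edge_dirs (\<alpha> ` J). 0 \<le> d b) \<and>
        x - y = (\<Sum>b\<in>edge_dirs (\<alpha> ` J). d b *s b)"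
      unfolding edge_dirs_eq by (rule_tac exI[of _ ?d], rule_tac conjI)
  qed
  then have "card (edges_at x (polytope x)) = card (edge_dirs (\<alpha> ` J))"
    by (simp add: card_image[OF inj_on_edge_of])
  then show ?thesis
    unfolding simple_polytope_iff by (simp add: edge_dirs_eq card_dir card_simple_nodes)
qed

end


section \<open>Smooth sets of nodes\<close>

text \<open>Connectedness in a form that can be read off from the numbering of the nodes.\<close>

locale connected_diagram = numbered_root_system +
  assumes earlier_neighbour: "i \<in> {2..N} \<Longrightarrow>
    \<exists>j\<in>{1..<i}. coroot (\<alpha> i) (\<alpha> j) \<noteq> 0 \<and> coroot (\<alpha> j) (\<alpha> i) \<noteq> 0"
begin

lemma connected_simple:
  assumes X: "X \<subset> \<Delta>" "X \<noteq> {}"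
  shows "\<exists>u\<in>\<Delta> - X. \<exists>v\<in>X. coroot u v \<noteq> 0"
proof -
  define I where "I = {i \<in> nodes. \<alpha> i \<in> X}"
  have "\<exists>i\<in>nodes. i \<in> I \<longleftrightarrow> 1 \<notin> I"
  proof -
    obtain \<beta> \<gamma> where "\<beta> \<in> X" "\<beta> \<in> \<Delta>" "\<gamma> \<in> \<Delta>" "\<gamma> \<notin> X" using X by blast
    then obtain i j where "i \<in> nodes" "i \<in> I" "j \<in> nodes" "j \<notin> I" by (auto simp: I_def simple_eq)
    then show ?thesis by (cases "1 \<in> I") blast+
  qed
  then obtain i0 where i0: "i0 \<in> nodes" "i0 \<in> I \<longleftrightarrow> 1 \<notin> I" by blast
  \<comment> \<open>The first node on the other side than node \<open>1\<close> has an earlier neighbour.\<close>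
  define i where "i = (LEAST i. i \<in> nodes \<and> (i \<in> I \<longleftrightarrow> 1 \<notin> I))"
  have i: "i \<in> nodes" "i \<in> I \<longleftrightarrow> 1 \<notin> I"
    using LeastI[of "\<lambda>i. i \<in> nodes \<and> (i \<in> I \<longleftrightarrow> 1 \<notin> I)" i0] i0 unfolding i_def by blast+
  have "i \<noteq> 1" using i(2) by auto
  then have "i \<in> {2..N}" using i(1) by (auto simp: nodes_iff)
  from earlier_neighbour[OF this] obtain j
    where j: "j \<in> {1..<i}" "linked i j" "linked j i" by blast
  have jn: "j \<in> nodes" using j(1) i(1) by (simp add: nodes_iff)
  then have "\<not> (j \<in> I \<longleftrightarrow> 1 \<notin> I)"
    using not_less_Least[of j "\<lambda>i. i \<in> nodes \<and> (i \<in> I \<longleftrightarrow> 1 \<notin> I)"] j(1) unfolding i_def by auto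
  then have "i \<in> I \<and> j \<notin> I \<or> j \<in> I \<and> i \<notin> I" using i(2) by blast
  moreover have "\<alpha> i \<in> \<Delta>" "\<alpha> j \<in> \<Delta>" using i(1) jn by (simp_all add: node_simple)
  ultimately show ?thesis using j(2,3) i(1) jn by (auto simp: I_def)
qed

definition smooth :: "nat set \<Rightarrow> bool" where
  "smooth J \<longleftrightarrow> (\<exists>x\<in>chamber. (\<forall>i\<in>nodes. coroot (\<alpha> i) x = 0 \<longleftrightarrow> i \<in> J) \<and>
     simple_polytope (polytope x))"

lemma dominant_vertex_nodes:
  assumes "x \<in> chamber" "\<forall>i\<in>nodes. coroot (\<alpha> i) x = 0 \<longleftrightarrow> i \<in> J" "J \<subset> nodes"
  shows "dominant_vertex \<Phi> coroot \<Delta> x (\<alpha> ` J)"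
proof unfold_locales
  show "\<alpha> ` J = {\<beta> \<in> \<Delta>. coroot \<beta> x = 0}" using assms(2,3) by (auto simp: simple_eq)
  obtain i where "i \<in> nodes" "i \<notin> J" using assms(3) by blast
  then have "\<alpha> i \<in> \<Delta>" "\<alpha> i \<notin> \<alpha> ` J" using assms(3) by (auto simp: node_simple node_eq_iff)
  then show "\<alpha> ` J \<noteq> \<Delta>" by blast
qed (use assms(1) connected_simple in auto)

lemma smooth_imp_independent:
  assumes "smooth J" "J \<subset> nodes"
  shows "vec.independent (edge_dirs (\<alpha> ` J))"
proof -
  from assms(1) obtain x where x: "x \<in> chamber" "\<forall>i\<in>nodes. coroot (\<alpha> i) x = 0 \<longleftrightarrow> i \<in> J"
    "simple_polytope (polytope x)" unfolding smooth_def by blast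
  interpret dominant_vertex \<Phi> coroot \<Delta> x "\<alpha> ` J"
    by (rule dominant_vertex_nodes[OF x(1,2) assms(2)])
  show ?thesis by (rule simple_imp_independent[OF x(3)])
qed

lemma path_forest_smooth:
  assumes "path_forest \<Phi> coroot \<Delta> \<alpha> N J p r" "J \<subset> nodes"
  shows "smooth J"
proof -
  have "\<alpha> ` J \<subseteq> \<Delta>" using assms(2) by (auto simp: simple_eq)
  from dominant_with_stabiliser[OF this] obtain x
    where x: "x \<in> chamber" "\<forall>\<beta>\<in>\<Delta>. coroot \<beta> x = 0 \<longleftrightarrow> \<beta> \<in> \<alpha> ` J" by blast
  have z: "\<forall>i\<in>nodes. coroot (\<alpha> i) x = 0 \<longleftrightarrow> i \<in> J"
    using x(2) node_simple node_image_iff[of J] assms(2) by (metis psubsetE)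
  interpret forest: path_forest \<Phi> coroot \<Delta> \<alpha> N J p r by (rule assms(1))
  interpret vertex: dominant_vertex \<Phi> coroot \<Delta> x "\<alpha> ` J"
    by (rule dominant_vertex_nodes[OF x(1) z assms(2)])
  interpret dominant_path_forest \<Phi> coroot \<Delta> \<alpha> N J p r x ..
  show ?thesis unfolding smooth_def using x(1) z simple by blast
qed

lemma inj_on_refl: "inj_on (\<lambda>i. refl (\<alpha> i)) nodes"
proof (rule inj_onI)
  fix i j assume ij: "i \<in> nodes" "j \<in> nodes" "refl (\<alpha> i) = refl (\<alpha> j)"
  then have "coeff (\<alpha> i) (refl (\<alpha> i) (\<alpha> i)) = coeff (\<alpha> i) (refl (\<alpha> j) (\<alpha> i))" by simp
  then show "i = j" using ij(1,2)
    by (cases "i = j") (simp_all add: coeff_refl coeff_node coroot_self node_root)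
qed

lemma smooth_subsets_eq:
  "smooth_subsets coroot \<Delta> = refl_set coroot \<alpha> ` {J. J \<subset> nodes \<and> smooth J}"
proof -
  have all: "simple_reflections coroot \<Delta> = refl_set coroot \<alpha> nodes"
    by (auto simp: simple_reflections_def refl_set_def simple_eq)
  have strict: "refl_set coroot \<alpha> J \<subset> refl_set coroot \<alpha> nodes \<longleftrightarrow> J \<subset> nodes" if "J \<subseteq> nodes" for J
    unfolding refl_set_def using inj_on_image_eq_iff[OF inj_on_refl that subset_refl] that by blast
  have fixed: "{s \<in> simple_reflections coroot \<Delta>. s x = x} =
      refl_set coroot \<alpha> {i \<in> nodes. coroot (\<alpha> i) x = 0}" for x
    unfolding all refl_set_def by (auto simp: refl_fixed_iff node_root)
  show ?thesis
  proof (intro equalityI subsetI)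
    fix K assume "K \<in> smooth_subsets coroot \<Delta>"
    then obtain x where K: "K \<subset> simple_reflections coroot \<Delta>" and x: "x \<in> chamber"
      "{s \<in> simple_reflections coroot \<Delta>. s x = x} = K" "simple_polytope (polytope x)"
      unfolding smooth_subsets_def combinatorially_smooth_def by blast
    define J where "J = {i \<in> nodes. coroot (\<alpha> i) x = 0}"
    have KJ: "K = refl_set coroot \<alpha> J" using x(2) fixed[of x] by (simp add: J_def)
    have "J \<subseteq> nodes" by (auto simp: J_def)
    then have "J \<subset> nodes" using K strict unfolding KJ all by blast
    moreover have "smooth J" unfolding smooth_def using x by (auto simp: J_def)
    ultimately show "K \<in> refl_set coroot \<alpha> ` {J. J \<subset> nodes \<and> smooth J}" using KJ by blast
  next
    fix K assume "K \<in> refl_set coroot \<alpha> ` {J. J \<subset> nodes \<and> smooth J}"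
    then obtain J where J: "J \<subset> nodes" "smooth J" "K = refl_set coroot \<alpha> J" by blast
    from J(2) obtain x where x: "x \<in> chamber" "\<forall>i\<in>nodes. coroot (\<alpha> i) x = 0 \<longleftrightarrow> i \<in> J"
      "simple_polytope (polytope x)" unfolding smooth_def by blast
    have "{i \<in> nodes. coroot (\<alpha> i) x = 0} = J" using x(2) J(1) by blast
    then have "{s \<in> simple_reflections coroot \<Delta>. s x = x} = K" using fixed[of x] J(3) by simp
    moreover have "K \<subset> simple_reflections coroot \<Delta>" using strict[of J] J(1,3) all by blast
    ultimately show "K \<in> smooth_subsets coroot \<Delta>"
      unfolding smooth_subsets_def combinatorially_smooth_def using x(1,3) by blast
  qed
qed

end


section \<open>Unique growth in chains and forks\<close>

lemma grown_up:
  assumes "\<And>k. 1 \<le> k \<Longrightarrow> k < m \<Longrightarrow> adj (Suc k) k" "s \<in> S - J" "1 \<le> s" "s \<le> k" "k \<le> m"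
    "{s<..k} \<subseteq> J"
  shows "grown adj S J {s..k}"
  using assms(4-)
proof (induction k rule: dec_induct)
  case base
  then show ?case using grown_start[OF assms(2)] by simp
next
  case (step k)
  have "grown adj S J {s..k}" using step by (intro step.IH) auto
  then have "grown adj S J (insert (Suc k) {s..k})"
    using step.hyps step.prems assms(1)[of k] assms(3)
    by (intro grown_step[of adj S J "{s..k}" "Suc k" k]) auto
  then show ?case using step.hyps by (simp add: atLeastAtMostSuc_conv)
qed

lemma grown_down:
  assumes "\<And>k. 1 \<le> k \<Longrightarrow> k < m \<Longrightarrow> adj k (Suc k)" "s \<in> S - J" "s \<le> m" "k \<le> s" "1 \<le> k"
    "{k..<s} \<subseteq> J"
  shows "grown adj S J {k..s}"
  using assms(4-)
proof (induction k rule: inc_induct)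
  case base
  then show ?case using grown_start[OF assms(2)] by simp
next
  case (step k)
  have "grown adj S J {Suc k..s}" using step by (intro step.IH) auto
  then have "grown adj S J (insert k {Suc k..s})"
    using step.hyps step.prems assms(1)[of k] assms(3)
    by (intro grown_step[of adj S J "{Suc k..s}" k "Suc k"]) auto
  then show ?case using step.hyps by (simp add: atLeastAtMost_insertL)
qed

text \<open>A node of \<open>J\<close> between two gaps could be reached from both sides, and if a single gap has
  both neighbours in \<open>J\<close>, then the right one can be added before and after the left one.\<close>

lemma unique_growth_chain:
  assumes ug: "unique_growth adj S J"
    and adj: "\<And>k. 1 \<le> k \<Longrightarrow> k < m \<Longrightarrow> adj k (Suc k) \<and> adj (Suc k) k"
    and S: "{1..m} \<subseteq> S" and gap: "g \<in> {1..m}" "g \<notin> J"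
  obtains a b where "1 \<le> a" "a \<le> b" "b \<le> m" "a \<notin> J" "b \<notin> J"
    "J \<inter> {1..m} = {1..<a} \<union> {Suc b..m}" "a = b \<Longrightarrow> a = 1 \<or> b = m"
proof -
  have up: "grown adj S J {s..k}" if "s \<notin> J" "1 \<le> s" "s \<le> k" "k \<le> m" "{s<..k} \<subseteq> J" for s k
    by (rule grown_up[of m]) (use that adj S in auto)
  have down: "grown adj S J {k..s}" if "s \<notin> J" "s \<le> m" "k \<le> s" "1 \<le> k" "{k..<s} \<subseteq> J" for s k
    by (rule grown_down[of m]) (use that adj S in auto)
  define G where "G = {1..m} - J"
  have G: "finite G" "G \<noteq> {}" using gap by (auto simp: G_def)
  define a where "a = Min G"
  define b where "b = Max G"
  have a: "a \<in> G" and b: "b \<in> G" using G by (simp_all add: a_def b_def)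
  have le: "a \<le> i" "i \<le> b" if "i \<in> G" for i using G that by (simp_all add: a_def b_def)
  have bounds: "1 \<le> a" "a \<le> b" "b \<le> m" "a \<notin> J" "b \<notin> J" using a b le[OF a] by (auto simp: G_def)
  have no_inner: "u \<notin> J" if u: "a < u" "u < b" for u
  proof
    assume uJ: "u \<in> J"
    define c where "c = Max {g \<in> G. g < u}"
    define d where "d = Min {g \<in> G. u < g}"
    have "finite {g \<in> G. g < u}" "{g \<in> G. g < u} \<noteq> {}" using G a u by auto
    note c = Max_in[OF this, folded c_def] Max_ge[OF this(1), folded c_def]
    have "finite {g \<in> G. u < g}" "{g \<in> G. u < g} \<noteq> {}" using G b u by auto
    note d = Min_in[OF this, folded d_def] Min_le[OF this(1), folded d_def]
    have cd: "1 \<le> c" "c < u" "u < d" "d \<le> m" "c \<notin> J" "d \<notin> J" using c(1) d(1) by (auto simp: G_def)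
    have inner: "i \<in> J" if "c < i" "i < d" for i
    proof (rule ccontr)
      assume "i \<notin> J"
      then have "i \<in> G" using that cd by (simp add: G_def)
      moreover have "i \<noteq> u" using \<open>i \<notin> J\<close> uJ by blast
      ultimately have "i \<in> {g \<in> G. g < u} \<or> i \<in> {g \<in> G. u < g}" by auto
      then show False using c(2)[of i] d(2)[of i] that by auto
    qed
    have "grown adj S J {c..c}" using cd by (intro up) auto
    moreover have "grown adj S J {Suc (Suc c)..d}" using cd inner by (intro down) auto
    ultimately have "{c..c} = {Suc (Suc c)..d}"
      using cd inner[of "Suc c"] adj[of c] adj[of "Suc c"]
      by (intro unique_growthD[OF ug, of _ _ "Suc c" c "Suc (Suc c)"]) auto
    then have "c \<in> {Suc (Suc c)..d}" by auto
    then show False by simp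
  qed
  have "i \<in> J \<longleftrightarrow> i < a \<or> b < i" if "i \<in> {1..m}" for i
  proof
    assume "i \<in> J"
    then have "i \<noteq> a" "i \<noteq> b" "\<not> (a < i \<and> i < b)" using bounds no_inner[of i] by auto
    then show "i < a \<or> b < i" by linarith
  next
    assume out: "i < a \<or> b < i"
    show "i \<in> J"
    proof (rule ccontr)
      assume "i \<notin> J"
      then have "i \<in> G" using that by (simp add: G_def)
      from le[OF this] out show False by linarith
    qed
  qed
  then have shape: "J \<inter> {1..m} = {1..<a} \<union> {Suc b..m}" using bounds by auto
  have "a = 1 \<or> b = m" if "a = b"
  proof (rule ccontr)
    assume no: "\<not> (a = 1 \<or> b = m)"
    then have lt: "1 < a" "a < m" using bounds \<open>a = b\<close> by auto
    then have "a - 1 \<in> J \<inter> {1..m}" "Suc a \<in> J \<inter> {1..m}" unfolding shape using \<open>a = b\<close> by auto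
    then have mem: "a - 1 \<in> J" "Suc a \<in> J" by auto
    have "{a - 1..<a} = {a - 1}" using lt by auto
    then have "grown adj S J {a - 1..a}" using lt bounds mem by (intro down) auto
    moreover have "grown adj S J {a..a}" using lt bounds by (intro up) auto
    ultimately have "{a - 1..a} = {a..a}"
      using lt mem adj[of a] by (intro unique_growthD[OF ug, of _ _ "Suc a" a a]) auto
    then have "a - 1 \<in> {a..a}" by auto
    then show False using lt by simp
  qed
  then show thesis using that bounds shape by blast
qed

text \<open>The branch node \<open>c\<close> of a fork cannot belong to \<open>J\<close>: a gap in one arm reaches \<open>c\<close>. Gaps in
  two arms reach it in two ways; if there is a gap in one arm only, then each of the first
  nodes \<open>u, u'\<close> of the other arms can be added before and after the other one.\<close>

lemma unique_growth_branch:
  assumes ug: "unique_growth adj S J" and c: "c \<in> J"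
    and X: "grown adj S J X" "c \<notin> X" "w \<in> X" "adj c w"
    and u: "u \<notin> X" "u \<noteq> c" "adj u c" and u': "u' \<notin> X" "u' \<noteq> c" "adj u' c" "u \<noteq> u'"
  shows "u \<notin> J \<or> u' \<notin> J"
proof (rule ccontr)
  assume "\<not> (u \<notin> J \<or> u' \<notin> J)"
  then have J: "u \<in> J" "u' \<in> J" by auto
  have Y: "grown adj S J (insert c X)" using grown_step[OF X(1) c X(2-)] .
  have "grown adj S J (insert u' (insert c X))" using u' J by (intro grown_step[OF Y]) auto
  then have "insert c X = insert u' (insert c X)"
    using u u' J by (intro unique_growthD[OF ug Y _ J(1)]) auto
  then show False using u' by auto
qed

lemma unique_growth_fork:
  assumes ug: "unique_growth adj {1..n} J"
    and adj: "\<And>k. 1 \<le> k \<Longrightarrow> Suc k < n \<Longrightarrow> adj k (Suc k) \<and> adj (Suc k) k"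
    and c: "1 < c" "Suc c < n" "adj c n" "adj n c" and J: "J \<subset> {1..n}"
  obtains a b where "1 \<le> a" "a \<le> c" "c \<le> b" "b < n" "a < b"
    "J \<inter> {1..<n} = {1..<a} \<union> {Suc b..<n}" "n \<in> J \<Longrightarrow> a < c \<and> c < b"
proof -
  let ?S = "{1..n}"
  have up: "grown adj ?S J {s..k}" if "s \<notin> J" "1 \<le> s" "s \<le> k" "k < n" "{s<..k} \<subseteq> J" for s k
    by (rule grown_up[of "n - 1"]) (use that adj in auto)
  have down: "grown adj ?S J {k..s}" if "s \<notin> J" "s < n" "k \<le> s" "1 \<le> k" "{k..<s} \<subseteq> J" for s k
    by (rule grown_down[of "n - 1"]) (use that adj in auto)
  have adjc: "adj c (c - 1)" "adj (c - 1) c" using adj[of "c - 1"] c by simp_all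
  have adjc': "adj c (Suc c)" "adj (Suc c) c" using adj[of c] c by simp_all
  have cJ: "c \<notin> J"
  proof
    assume cJ: "c \<in> J"
    define left where "left = (\<exists>X. grown adj ?S J X \<and> X \<subseteq> {1..<c} \<and> c - 1 \<in> X)"
    define right where "right = (\<exists>X. grown adj ?S J X \<and> X \<subseteq> {Suc c..<n} \<and> Suc c \<in> X)"
    have left: "left \<or> {1..<c} \<subseteq> J"
    proof (cases "{1..<c} \<subseteq> J")
      case False
      define s where "s = Max ({1..<c} - J)"
      have "finite ({1..<c} - J)" "{1..<c} - J \<noteq> {}" using False by auto
      note s = Max_in[OF this, folded s_def] Max_ge[OF this(1), folded s_def]
      have "i \<in> J" if "s < i" "i < c" for i
      proof (rule ccontr)
        assume "i \<notin> J"
        then have "i \<in> {1..<c} - J" using that by auto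
        from s(2)[OF this] that show False by simp
      qed
      then have "grown adj ?S J {s..c - 1}" using s(1) c by (intro up) auto
      moreover have "{s..c - 1} \<subseteq> {1..<c}" "c - 1 \<in> {s..c - 1}" using s(1) by auto
      ultimately show ?thesis unfolding left_def by blast
    qed simp
    have right: "right \<or> {Suc c..<n} \<subseteq> J"
    proof (cases "{Suc c..<n} \<subseteq> J")
      case False
      define s where "s = Min ({Suc c..<n} - J)"
      have "finite ({Suc c..<n} - J)" "{Suc c..<n} - J \<noteq> {}" using False by auto
      note s = Min_in[OF this, folded s_def] Min_le[OF this(1), folded s_def]
      have "i \<in> J" if "c < i" "i < s" for i
      proof (rule ccontr)
        assume "i \<notin> J"
        then have "i \<in> {Suc c..<n} - J" using that s(1) by auto
        from s(2)[OF this] that show False by simp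
      qed
      then have "grown adj ?S J {Suc c..s}" using s(1) c by (intro down) auto
      moreover have "{Suc c..s} \<subseteq> {Suc c..<n}" "Suc c \<in> {Suc c..s}" using s(1) by auto
      ultimately show ?thesis unfolding right_def by blast
    qed simp
    have last: "grown adj ?S J {n}" if "n \<notin> J" using that c by (intro grown_start) auto
    have two: False if "grown adj ?S J X" "grown adj ?S J Y" "w \<in> X" "w' \<in> Y" "adj c w" "adj c w'"
      "c \<notin> X" "c \<notin> Y" "w \<notin> Y" for X Y w w'
      using unique_growthD[OF ug that(1,2) cJ that(7,8,3,5,4,6)] that(3,9) by blast
    show False
    proof (cases left)
      case True
      then obtain X where X: "grown adj ?S J X" "X \<subseteq> {1..<c}" "c - 1 \<in> X" unfolding left_def by blast
      have nX: "c \<notin> X" "Suc c \<notin> X" "n \<notin> X" using X(2) c by auto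
      then have "Suc c \<notin> J \<or> n \<notin> J"
        using unique_growth_branch[OF ug cJ X(1) _ X(3) adjc(1), of "Suc c" n] adjc' c by auto
      then show False
      proof
        assume "Suc c \<notin> J"
        then have R: "grown adj ?S J {Suc c..Suc c}" using c by (intro up) auto
        have "c - 1 \<notin> {Suc c..Suc c}" by (subst atLeastAtMost_iff) linarith
        then show False using two[OF X(1) R X(3) _ adjc(1) adjc'(1) nX(1)] by auto
      next
        assume "n \<notin> J"
        have "c - 1 \<noteq> n" "c \<noteq> n" using c by linarith+
        then show False using two[OF X(1) last[OF \<open>n \<notin> J\<close>] X(3) _ adjc(1) c(3) nX(1)] by simp
      qed
    next
      case noleft: False
      then have mem: "c - 1 \<in> J" using left c by auto
      show False
      proof (cases right)
        case True
        then obtain X where X: "grown adj ?S J X" "X \<subseteq> {Suc c..<n}" "Suc c \<in> X"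
          unfolding right_def by blast
        have "c < i \<and> i < n" if "i \<in> X" for i using X(2) that by auto
        from this[of c] this[of "c - 1"] this[of n] have nX: "c \<notin> X" "c - 1 \<notin> X" "n \<notin> X" by auto
        then have "n \<notin> J"
          using unique_growth_branch[OF ug cJ X(1) _ X(3) adjc'(1), of "c - 1" n] adjc c mem by auto
        have "Suc c \<noteq> n" "c \<noteq> n" using c by linarith+
        then show False using two[OF X(1) last[OF \<open>n \<notin> J\<close>] X(3) _ adjc'(1) c(3) nX(1)] by simp
      next
        case False
        have "{1..<n} \<subseteq> J"
        proof
          fix i assume "i \<in> {1..<n}"
          then have "i \<in> {1..<c} \<or> i = c \<or> i \<in> {Suc c..<n}" by auto
          then show "i \<in> J" using False noleft left right cJ by blast
        qed
        moreover have "{1..n} = insert n {1..<n}" using c by auto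
        ultimately have "n \<notin> J" using J by (metis insert_subset psubset_imp_subset psubsetE subset_antisym)
        then have "Suc c \<notin> J \<or> c - 1 \<notin> J"
          using unique_growth_branch[OF ug cJ last _ _ c(3), of "Suc c" "c - 1"] adjc adjc' c by auto
        moreover have "Suc c \<in> {1..<n}" using c by simp
        ultimately show False using mem \<open>{1..<n} \<subseteq> J\<close> by blast
      qed
    qed
  qed
  have cm: "c \<in> {1..n - 1}" using c by simp
  obtain a b where ab: "1 \<le> a" "a \<le> b" "b \<le> n - 1" "a \<notin> J" "b \<notin> J"
    "J \<inter> {1..n - 1} = {1..<a} \<union> {Suc b..n - 1}" "a = b \<Longrightarrow> a = 1 \<or> b = n - 1"
  proof (rule unique_growth_chain[OF ug _ _ cm cJ])
    show "adj k (Suc k) \<and> adj (Suc k) k" if "1 \<le> k" "k < n - 1" for k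
      using adj[of k] that by simp
    show "{1..n - 1} \<subseteq> {1..n}" by auto
  qed (rule that)
  have last: "{k..n - 1} = {k..<n}" for k using c by auto
  have shape: "J \<inter> {1..<n} = {1..<a} \<union> {Suc b..<n}" using ab(6) by (simp only: last)
  have "c \<notin> {1..<a} \<union> {Suc b..<n}" unfolding shape[symmetric] using cJ by simp
  then have ac: "a \<le> c" "c \<le> b" using c by auto
  have "a \<noteq> b" using ab(7) ac c by auto
  moreover have "a < c \<and> c < b" if n: "n \<in> J"
  proof (rule ccontr)
    assume "\<not> (a < c \<and> c < b)"
    then have "a = c \<or> b = c" using ac by auto
    then have "\<exists>v\<in>J. v < n \<and> v \<noteq> c \<and> adj v c"
    proof
      assume "a = c"
      then have "c - 1 \<in> J \<inter> {1..<n}" unfolding shape using c by auto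
      then show ?thesis using adjc c by (intro bexI[of _ "c - 1"]) auto
    next
      assume "b = c"
      then have "Suc c \<in> J \<inter> {1..<n}" unfolding shape using c by auto
      then show ?thesis using adjc' c by (intro bexI[of _ "Suc c"]) auto
    qed
    then obtain v where v: "v \<in> J" "v < n" "v \<noteq> c" "adj v c" by blast
    have C: "grown adj ?S J {c}" using c cJ by (intro grown_start) auto
    then have "grown adj ?S J (insert v {c})" using v by (intro grown_step[OF C]) auto
    then have "{c} = insert v {c}"
      using n v c by (intro unique_growthD[OF ug C _ n, of _ c c]) auto
    then show False using v(3) by auto
  qed
  ultimately show thesis using that[of a b] ab ac c shape by auto
qed


section \<open>Smooth sets in chains and forks\<close>

text \<open>Here \<open>a\<close> and \<open>b\<close> are the first and the last node outside \<open>J\<close>. The two end segments of a chain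
  that form \<open>J\<close> must be attached to different nodes, unless one of them is empty, and neither may
  contain both ends of the multiple bond between \<open>m\<close> and \<open>m + 1\<close>.\<close>

definition chain_shape :: "nat \<Rightarrow> nat \<Rightarrow> nat set \<Rightarrow> bool" where
  "chain_shape N m J \<longleftrightarrow> (\<exists>a b. 1 \<le> a \<and> a \<le> b \<and> b \<le> N \<and> (a = b \<longrightarrow> a = 1 \<or> b = N) \<and>
     (1 \<le> m \<and> m < N \<longrightarrow> a \<le> Suc m \<and> m \<le> b) \<and> J = {1..<a} \<union> {Suc b..N})"

text \<open>In a fork the node \<open>c\<close> lies outside \<open>J\<close>; if the node \<open>N\<close>, which is joined to \<open>c\<close>, is in \<open>J\<close>, then
  the segments of the chain must be attached to nodes other than \<open>c\<close>.\<close>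

definition fork_shape :: "nat \<Rightarrow> nat \<Rightarrow> nat set \<Rightarrow> bool" where
  "fork_shape N c J \<longleftrightarrow> (\<exists>a b K. 1 \<le> a \<and> a \<le> c \<and> c \<le> b \<and> b < N \<and> a < b \<and>
     (K = {} \<or> K = {N} \<and> a < c \<and> c < b) \<and> J = {1..<a} \<union> {Suc b..<N} \<union> K)"

text \<open>The diagrams of types \<open>A\<close>, \<open>B\<close>, \<open>C\<close>, \<open>F\<close> and \<open>G\<close>: a chain with at most one multiple bond, between the nodes \<open>m\<close> and \<open>m + 1\<close>; there is none if
  \<open>m\<close> is \<open>0\<close>.\<close>

locale chain_diagram = connected_diagram \<Phi> coroot \<Delta> \<alpha> N
  for \<Phi> :: "(rat ^ 'n) set" and coroot :: "rat ^ 'n \<Rightarrow> rat ^ 'n \<Rightarrow> rat" and \<Delta> \<alpha> N +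
  fixes m :: nat
  assumes chain: "i \<in> nodes \<Longrightarrow> j \<in> nodes \<Longrightarrow> i \<noteq> j \<Longrightarrow>
      coroot (\<alpha> i) (\<alpha> j) \<noteq> 0 \<longleftrightarrow> j = Suc i \<or> i = Suc j"
    and simple_bonds: "i \<in> nodes \<Longrightarrow> Suc i \<in> nodes \<Longrightarrow> i \<noteq> m \<Longrightarrow>
      coroot (\<alpha> i) (\<alpha> (Suc i)) = -1 \<and> coroot (\<alpha> (Suc i)) (\<alpha> i) = -1"
    and multiple_bond: "1 \<le> m \<Longrightarrow> m < N \<Longrightarrow>
      2 \<le> coroot (\<alpha> m) (\<alpha> (Suc m)) * coroot (\<alpha> (Suc m)) (\<alpha> m)"
begin

lemma chain_linked: "1 \<le> k \<Longrightarrow> k < N \<Longrightarrow> linked k (Suc k) \<and> linked (Suc k) k"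
  using chain[of k "Suc k"] chain[of "Suc k" k] by (simp add: nodes_iff)

lemma smooth_imp_chain_shape:
  assumes "smooth J" and J: "J \<subset> nodes"
  shows "chain_shape N m J"
proof -
  note indep = smooth_imp_independent[OF assms]
  have Jn: "J \<subseteq> nodes" using J by blast
  note ug = independent_unique_growth[OF Jn indep]
  obtain g where "g \<in> nodes" "g \<notin> J" using J by blast
  then have g: "g \<in> {1..N}" "g \<notin> J" by (simp_all add: nodes_def)
  obtain a b where ab: "1 \<le> a" "a \<le> b" "b \<le> N" "a \<notin> J" "b \<notin> J"
    "J \<inter> {1..N} = {1..<a} \<union> {Suc b..N}" "a = b \<Longrightarrow> a = 1 \<or> b = N"
  proof (rule unique_growth_chain[OF ug _ _ g])
    show "linked k (Suc k) \<and> linked (Suc k) k" if "1 \<le> k" "k < N" for k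
      using chain_linked[OF that] .
    show "{1..N} \<subseteq> nodes" by (simp add: nodes_def)
  qed (rule that)
  have J_eq: "J = {1..<a} \<union> {Suc b..N}" using ab(6) Jn by (simp add: nodes_def Int_absorb2)
  have "a \<le> Suc m \<and> m \<le> b" if m: "1 \<le> m" "m < N"
  proof (rule ccontr)
    assume "\<not> (a \<le> Suc m \<and> m \<le> b)"
    then consider "Suc m < a" | "b < m" by linarith
    then show False
    proof cases
      case 1
      have X: "grown linked nodes J {Suc (Suc m)..a}"
        by (rule grown_down[of N]) (use 1 ab(1-5) J_eq chain_linked in \<open>auto simp: nodes_iff\<close>)
      show False
      proof (rule independent_no_multiple_bond[OF Jn indep X, of "Suc m" "Suc (Suc m)" m])
        show "linked (Suc m) (Suc (Suc m))" using chain_linked[of "Suc m"] 1 ab(2,3) by simp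
        show "\<not> linked m i" if "i \<in> {Suc (Suc m)..a}" for i
          using chain[of m i] that m ab(2,3) by (auto simp: nodes_iff)
        show "2 \<le> entry (Suc m) m * entry m (Suc m)" using multiple_bond[OF m] by (simp add: mult.commute)
      qed (use 1 m J_eq in auto)
    next
      case 2
      have X: "grown linked nodes J {b..m - 1}"
        by (rule grown_up[of N]) (use 2 m ab(1-5) J_eq chain_linked in \<open>auto simp: nodes_iff\<close>)
      show False
      proof (rule independent_no_multiple_bond[OF Jn indep X, of m "m - 1" "Suc m"])
        show "linked m (m - 1)" using chain_linked[of "m - 1"] 2 ab(1,2) m by simp
        show "\<not> linked (Suc m) i" if "i \<in> {b..m - 1}" for i
        proof -
          have "i < m" "1 \<le> i" "b \<le> i" using that m ab(1,2) by auto
          then show ?thesis using chain[of "Suc m" i] m by (simp add: nodes_iff)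
        qed
        show "2 \<le> entry m (Suc m) * entry (Suc m) m" using multiple_bond[OF m] .
      qed (use 2 m J_eq in auto)
    qed
  qed
  then have "1 \<le> a \<and> a \<le> b \<and> b \<le> N \<and> (a = b \<longrightarrow> a = 1 \<or> b = N) \<and>
      (1 \<le> m \<and> m < N \<longrightarrow> a \<le> Suc m \<and> m \<le> b) \<and> J = {1..<a} \<union> {Suc b..N}"
    using ab(1-3,7) J_eq by blast
  then show ?thesis unfolding chain_shape_def by (intro exI)
qed

lemma chain_shape_imp_smooth:
  assumes "chain_shape N m J"
  shows "J \<subset> nodes \<and> smooth J"
proof
  obtain a b where ab: "1 \<le> a" "a \<le> b" "b \<le> N" "a = b \<longrightarrow> a = 1 \<or> b = N"
    and m: "1 \<le> m \<and> m < N \<longrightarrow> a \<le> Suc m \<and> m \<le> b"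
    and J: "J = {1..<a} \<union> {Suc b..N}"
    using assms unfolding chain_shape_def by (elim exE conjE)
  have "J \<subseteq> nodes" "a \<in> nodes" "a \<notin> J" using ab J by (auto simp: nodes_iff)
  then show Jn: "J \<subset> nodes" by blast
  define p where "p t = (if t < a then Suc t else t - 1)" for t
  define r where "r t = (if t < a then a - t else t - b)" for t
  have J_cases: "1 \<le> t \<and> t < a \<and> p t = Suc t \<or> a < t \<and> b < t \<and> t \<le> N \<and> Suc (p t) = t"
    if "t \<in> J" for t
    using that ab(1,2) by (auto simp: J p_def)
  have p: "p t \<in> nodes" if "t \<in> J" for t
    using J_cases[OF that] ab(1-3) unfolding nodes_iff by linarith
  have p_other: "p t \<noteq> t" if "t \<in> J" for t using J_cases[OF that] by linarith
  have bond: "entry t (p t) = -1 \<and> entry (p t) t = -1" if t: "t \<in> J" "p t \<in> J" for t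
    using J_cases[OF t(1)]
  proof
    assume lo: "1 \<le> t \<and> t < a \<and> p t = Suc t"
    then have "Suc t < a" using J_cases[OF t(2)] ab(2) by linarith
    then have "t \<in> nodes" "Suc t \<in> nodes" "t \<noteq> m"
      using lo m ab(1-3) unfolding nodes_iff by linarith+
    then show ?thesis using simple_bonds[of t] lo by simp
  next
    assume hi: "a < t \<and> b < t \<and> t \<le> N \<and> Suc (p t) = t"
    then have "b < p t" using J_cases[OF t(2)] ab(2) by linarith
    then have "p t \<in> nodes" "Suc (p t) \<in> nodes" "p t \<noteq> m"
      using hi m ab(1-3) unfolding nodes_iff by linarith+
    then show ?thesis using simple_bonds[of "p t"] hi by simp
  qed
  have "path_forest \<Phi> coroot \<Delta> \<alpha> N J p r"
  proof unfold_locales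
    show "J \<subseteq> nodes" using Jn by blast
    show "p t \<in> nodes" if "t \<in> J" for t by (rule p[OF that])
    show "inj_on p J"
    proof (rule inj_onI)
      fix t u assume "t \<in> J" "u \<in> J" "p t = p u"
      then show "t = u" using J_cases[of t] J_cases[of u] ab by linarith
    qed
    show "linked t (p t)" if "t \<in> J" for t
    proof -
      have "t \<in> nodes" "p t = Suc t \<or> t = Suc (p t)" using J_cases[OF that] Jn that by auto
      then show ?thesis using chain[OF _ p[OF that]] p_other[OF that] by metis
    qed
    show "r (p t) < r t" if "t \<in> J" for t
      using J_cases[OF that] ab(2) unfolding r_def by (cases "p t < a") auto
    show "v = p t \<or> v \<in> J \<and> p v = t" if "t \<in> J" "v \<in> nodes" "v \<noteq> t" "linked t v" for t v
    proof -
      have "t \<in> nodes" using that(1) Jn by blast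
      then have "v = Suc t \<or> t = Suc v" using chain[of t v] that by blast
      moreover have "1 \<le> v" "v \<le> N" using that(2) by (simp_all add: nodes_iff)
      moreover have "v \<in> J \<and> p v = t" if "1 \<le> t \<and> t < a" "t = Suc v"
        using that \<open>1 \<le> v\<close> by (simp add: J p_def)
      moreover have "v \<in> J \<and> p v = t" if "a < t \<and> b < t" "v = Suc t"
        using that \<open>v \<le> N\<close> by (simp add: J p_def)
      ultimately show ?thesis using J_cases[OF that(1)] by auto
    qed
    show "entry t (p t) = -1" "entry (p t) t = -1" if "t \<in> J" "p t \<in> J" for t
      using bond[OF that] by blast+
  qed
  then show "smooth J" using Jn by (rule path_forest_smooth)
qed

lemma chain_smooth_subsets:
  "smooth_subsets coroot \<Delta> = refl_set coroot \<alpha> ` {J. chain_shape N m J}"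
proof -
  have "J \<subset> nodes \<and> smooth J \<longleftrightarrow> chain_shape N m J" for J
    using smooth_imp_chain_shape chain_shape_imp_smooth by blast
  then show ?thesis by (simp add: smooth_subsets_eq)
qed

end

text \<open>The diagrams of types \<open>D\<close> and \<open>E\<close>: a simply laced chain \<open>1, \<dots>, N - 1\<close> with the node \<open>N\<close> joined to its inner node \<open>c\<close>.\<close>

locale fork_diagram = connected_diagram \<Phi> coroot \<Delta> \<alpha> N
  for \<Phi> :: "(rat ^ 'n) set" and coroot :: "rat ^ 'n \<Rightarrow> rat ^ 'n \<Rightarrow> rat" and \<Delta> \<alpha> N +
  fixes c :: nat
  assumes inner: "1 < c" "Suc c < N"
    and fork: "i \<in> nodes \<Longrightarrow> j \<in> nodes \<Longrightarrow> i \<noteq> j \<Longrightarrow>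
      coroot (\<alpha> i) (\<alpha> j) = (if i < N \<and> j < N \<and> (j = Suc i \<or> i = Suc j) \<or> {i, j} = {c, N} then -1 else 0)"
begin

lemma smooth_imp_fork_shape:
  assumes "smooth J" and J: "J \<subset> nodes"
  shows "fork_shape N c J"
proof -
  have Jn: "J \<subseteq> nodes" using J by blast
  have ug: "unique_growth linked {1..N} J"
    using independent_unique_growth[OF Jn smooth_imp_independent[OF assms]] by (simp add: nodes_def)
  have adj: "linked k (Suc k) \<and> linked (Suc k) k" if "1 \<le> k" "Suc k < N" for k
    using fork[of k "Suc k"] fork[of "Suc k" k] that by (simp add: nodes_iff)
  have adjc: "linked c N" "linked N c"
    using fork[of c N] fork[of N c] inner by (simp_all add: nodes_iff doubleton_eq_iff)
  obtain a b where ab: "1 \<le> a" "a \<le> c" "c \<le> b" "b < N" "a < b"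
    "J \<inter> {1..<N} = {1..<a} \<union> {Suc b..<N}" "N \<in> J \<Longrightarrow> a < c \<and> c < b"
  proof (rule unique_growth_fork[OF ug adj inner adjc])
    show "J \<subset> {1..N}" using J by (simp add: nodes_def)
  qed (assumption | rule that)+
  have "{1..N} = {1..<N} \<union> {N}" using inner by auto
  then have "J = (J \<inter> {1..<N}) \<union> (J \<inter> {N})" using Jn by (auto simp: nodes_def)
  then have "J = {1..<a} \<union> {Suc b..<N} \<union> (J \<inter> {N})" by (simp only: ab(6))
  moreover have "J \<inter> {N} = {} \<or> J \<inter> {N} = {N} \<and> a < c \<and> c < b" using ab(7) by blast
  ultimately have "1 \<le> a \<and> a \<le> c \<and> c \<le> b \<and> b < N \<and> a < b \<and>
      (J \<inter> {N} = {} \<or> J \<inter> {N} = {N} \<and> a < c \<and> c < b) \<and>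
      J = {1..<a} \<union> {Suc b..<N} \<union> (J \<inter> {N})"
    using ab(1-5) by simp
  then show ?thesis unfolding fork_shape_def by (intro exI)
qed

lemma fork_shape_imp_smooth:
  assumes "fork_shape N c J"
  shows "J \<subset> nodes \<and> smooth J"
proof
  obtain a b K where ab: "1 \<le> a" "a \<le> c" "c \<le> b" "b < N" "a < b"
    and K: "K = {} \<or> K = {N} \<and> a < c \<and> c < b"
    and J: "J = {1..<a} \<union> {Suc b..<N} \<union> K"
    using assms unfolding fork_shape_def by (elim exE conjE)
  have "J \<subseteq> nodes" using J K ab inner by (auto simp: nodes_iff)
  moreover have c_in: "c \<in> nodes" using ab inner by (simp add: nodes_iff)
  moreover have "c \<notin> J" using J K ab inner by auto
  ultimately show Jn: "J \<subset> nodes" by blast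
  define p where "p t = (if t = N then c else if t < a then Suc t else t - 1)" for t
  define r where "r t = (if t = N then 1 else if t < a then a - t else t - b)" for t
  have J_cases: "t = N \<and> p t = c \<and> a < c \<and> c < b \<or> 1 \<le> t \<and> t < a \<and> p t = Suc t \<or>
      b < t \<and> t < N \<and> Suc (p t) = t" if "t \<in> J" for t
    using that K ab by (auto simp: J p_def)
  have p: "p t \<in> nodes" if "t \<in> J" for t
    using J_cases[OF that] ab inner unfolding nodes_iff by linarith
  have linked_iff: "linked t v \<longleftrightarrow> t < N \<and> v < N \<and> (v = Suc t \<or> t = Suc v) \<or> t = c \<and> v = N \<or> t = N \<and> v = c"
    if "t \<in> nodes" "v \<in> nodes" "t \<noteq> v" for t v
    using fork[OF that] by (simp add: doubleton_eq_iff)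
  have entry_linked: "entry t v = -1" if "t \<in> nodes" "v \<in> nodes" "t \<noteq> v" "linked t v" for t v
    using fork[OF that(1-3)] that(4) by presburger
  have p_linked: "p t \<noteq> t \<and> linked t (p t) \<and> linked (p t) t" if "t \<in> J" for t
  proof -
    have t: "t \<in> nodes" using that Jn by blast
    have ne: "p t \<noteq> t" using J_cases[OF that] inner by linarith
    have "t < N \<and> p t < N \<and> (p t = Suc t \<or> t = Suc (p t)) \<or> t = N \<and> p t = c"
      using J_cases[OF that] ab inner by linarith
    then show ?thesis 
      using linked_iff[OF t p[OF that] ne[symmetric]] linked_iff[OF p[OF that] t ne] ne by auto
  qed
  have "path_forest \<Phi> coroot \<Delta> \<alpha> N J p r"
  proof unfold_locales
    show "J \<subseteq> nodes" using Jn by blast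
    show "p t \<in> nodes" if "t \<in> J" for t by (rule p[OF that])
    show "inj_on p J"
    proof (rule inj_onI)
      fix t u assume "t \<in> J" "u \<in> J" "p t = p u"
      then show "t = u" using J_cases[of t] J_cases[of u] ab by linarith
    qed
    show "linked t (p t)" if "t \<in> J" for t using p_linked[OF that] by blast
    show "r (p t) < r t" if "t \<in> J" for t
    proof -
      from J_cases[OF that] consider "t = N" "p t = c" "a < c" "c < b"
        | "1 \<le> t" "t < a" "p t = Suc t" | "b < t" "t < N" "Suc (p t) = t"
        by blast
      then show ?thesis using ab inner by cases (auto simp: r_def)
    qed
    show "v = p t \<or> v \<in> J \<and> p v = t" if "t \<in> J" "v \<in> nodes" "v \<noteq> t" "linked t v" for t v
    proof -
      have "t \<in> nodes" using that(1) Jn by blast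
      then have link: "t < N \<and> v < N \<and> (v = Suc t \<or> t = Suc v) \<or> t = c \<and> v = N \<or> t = N \<and> v = c"
        using linked_iff[of t v] that by blast
      have "1 \<le> v" using that(2) by (simp add: nodes_iff)
      from J_cases[OF that(1)] consider "t = N" "p t = c" | "1 \<le> t" "t < a" "p t = Suc t"
        | "b < t" "t < N" "Suc (p t) = t"
        by blast
      then show ?thesis
      proof cases
        case 1
        then show ?thesis using link inner by auto
      next
        case 2
        then have "v = Suc t \<or> t = Suc v" using link ab by linarith
        then show ?thesis
        proof
          assume "t = Suc v"
          then show ?thesis using 2 \<open>1 \<le> v\<close> ab by (simp add: J p_def)
        qed (simp add: 2)
      next
        case 3
        then have "v = Suc t \<and> v < N \<or> t = Suc v" using link ab by linarith
        then show ?thesis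
        proof
          assume "v = Suc t \<and> v < N"
          then show ?thesis using 3 ab by (simp add: J p_def)
        next
          assume "t = Suc v"
          then show ?thesis using 3 by simp
        qed
      qed
    qed
    show "entry t (p t) = -1" "entry (p t) t = -1" if "t \<in> J" "p t \<in> J" for t
      using entry_linked[of t "p t"] entry_linked[of "p t" t] p_linked[OF that(1)] p[OF that(1)] that(1) Jn
      by auto
  qed
  then show "smooth J" using Jn by (rule path_forest_smooth)
qed

lemma fork_smooth_subsets:
  "smooth_subsets coroot \<Delta> = refl_set coroot \<alpha> ` {J. fork_shape N c J}"
proof -
  have "J \<subset> nodes \<and> smooth J \<longleftrightarrow> fork_shape N c J" for J
    using smooth_imp_fork_shape fork_shape_imp_smooth by blast
  then show ?thesis by (simp add: smooth_subsets_eq)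
qed

end


section \<open>The classification\<close>

text \<open>For a given diagram the shapes can be listed by evaluation.\<close>

definition chain_list :: "nat \<Rightarrow> nat \<Rightarrow> nat set list" where
  "chain_list N m = map (\<lambda>(a, b). set [1..<a] \<union> set [Suc b..<Suc N])
     (filter (\<lambda>(a, b). a \<le> b \<and> (a = b \<longrightarrow> a = 1 \<or> b = N) \<and>
        (1 \<le> m \<and> m < N \<longrightarrow> a \<le> Suc m \<and> m \<le> b))
       (List.product [1..<Suc N] [1..<Suc N]))"

definition fork_list :: "nat \<Rightarrow> nat \<Rightarrow> nat set list" where
  "fork_list N c = map (\<lambda>(a, b, K). set [1..<a] \<union> set [Suc b..<N] \<union> K)
     (filter (\<lambda>(a, b, K). a < b \<and> (K = {} \<or> a < c \<and> c < b))
       (List.product [1..<Suc c] (List.product [c..<N] [{}, {N}])))"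

lemma Collect_chain_shape: "{J. chain_shape N m J} = set (chain_list N m)"
proof -
  have last: "{Suc b..N} = {Suc b..<Suc N}" for b by auto
  have "J \<in> set (chain_list N m) \<longleftrightarrow> (\<exists>a b. (a, b) \<in> {1..<Suc N} \<times> {1..<Suc N} \<and> (a \<le> b \<and>
      (a = b \<longrightarrow> a = 1 \<or> b = N) \<and> (1 \<le> m \<and> m < N \<longrightarrow> a \<le> Suc m \<and> m \<le> b)) \<and>
      J = {1..<a} \<union> {Suc b..<Suc N})" for J
    by (simp only: chain_list_def set_map set_filter set_product set_upt image_iff Bex_def
        mem_Collect_eq split_paired_Ex prod.case conj_assoc)
  then have "J \<in> set (chain_list N m) \<longleftrightarrow> chain_shape N m J" for J
    unfolding chain_shape_def last by (simp only:) (rule ex_cong1, rule ex_cong1, auto)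
  then show ?thesis by blast
qed

lemma Collect_fork_shape: "{J. fork_shape N c J} = set (fork_list N c)"
proof -
  have "J \<in> set (fork_list N c) \<longleftrightarrow> (\<exists>a b K. (a, b, K) \<in> {1..<Suc c} \<times> {c..<N} \<times> {{}, {N}} \<and>
      (a < b \<and> (K = {} \<or> a < c \<and> c < b)) \<and> J = {1..<a} \<union> {Suc b..<N} \<union> K)" for J
    by (simp only: fork_list_def set_map set_filter set_product set_upt image_iff Bex_def
        mem_Collect_eq split_paired_Ex prod.case conj_assoc list.set)
  then have "J \<in> set (fork_list N c) \<longleftrightarrow> fork_shape N c J" for J
    unfolding fork_shape_def by (simp only:) (rule ex_cong1, rule ex_cong1, rule ex_cong1, auto)
  then show ?thesis by blast
qed

lemma shape_A1: "{J. chain_shape 1 0 J} = {{}}"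
  unfolding Collect_chain_shape by code_simp

text \<open>A chain of two nodes with a multiple bond, as in types \<open>B\<^sub>2\<close> and \<open>G\<^sub>2\<close>.\<close>

lemma shape_B2: "{J. chain_shape 2 1 J} = {{}, {1}, {2}}"
  unfolding Collect_chain_shape by code_simp

lemma shape_F4:
  "{J. chain_shape 4 2 J} = {{}} \<union> {{1}, {1, 2}} \<union> {{4}, {3, 4}} \<union> {{1, 4}}"
  unfolding Collect_chain_shape by code_simp

lemma shape_E6: "{J. fork_shape 6 3 J} =
  {{}}
  \<union> {{1}, {1, 2}}
  \<union> {{5}, {4, 5}}
  \<union> {{6}}
  \<union> {{1, 5}, {1, 2, 5}, {1, 4, 5}}
  \<union> {{1, 6}}
  \<union> {{5, 6}}
  \<union> {{1, 5, 6}}"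
  unfolding Collect_fork_shape by code_simp

lemma shape_E7: "{J. fork_shape 7 4 J} =
  {{}}
  \<union> {{1}, {1, 2}, {1, 2, 3}}
  \<union> {{6}, {5, 6}}
  \<union> {{7}}
  \<union> {{1, 6}, {1, 2, 6}, {1, 2, 3, 6}, {1, 5, 6}, {1, 2, 5, 6}}
  \<union> {{6, 7}}
  \<union> {{1, 7}, {1, 2, 7}}
  \<union> {{1, 6, 7}, {1, 2, 6, 7}}"
  unfolding Collect_fork_shape by code_simp

lemma shape_E8: "{J. fork_shape 8 5 J} =
  {{}}
  \<union> {{1}, {1, 2}, {1, 2, 3}, {1, 2, 3, 4}}
  \<union> {{7}, {6, 7}}
  \<union> {{8}}
  \<union> {{1, 7}, {1, 2, 7}, {1, 2, 3, 7}, {1, 2, 3, 4, 7},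
     {1, 6, 7}, {1, 2, 6, 7}, {1, 2, 3, 6, 7}}
  \<union> {{7, 8}}
  \<union> {{1, 8}, {1, 2, 8}, {1, 2, 3, 8}}
  \<union> {{1, 7, 8}, {1, 2, 7, 8}, {1, 2, 3, 7, 8}}"
  unfolding Collect_fork_shape by code_simp

lemma chain_shapeI:
  "1 \<le> a \<Longrightarrow> a \<le> b \<Longrightarrow> b \<le> N \<Longrightarrow> a = b \<longrightarrow> a = 1 \<or> b = N \<Longrightarrow>
    1 \<le> m \<and> m < N \<longrightarrow> a \<le> Suc m \<and> m \<le> b \<Longrightarrow> chain_shape N m ({1..<a} \<union> {Suc b..N})"
  unfolding chain_shape_def by (rule exI[of _ a], rule exI[of _ b]) simp

lemma shape_A:
  assumes n: "2 \<le> n"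
  shows "{J. chain_shape n 0 J} = {{}}
    \<union> {{1..i} | i. 1 \<le> i \<and> i < n}
    \<union> {{j..n} | j. 1 < j \<and> j \<le> n}
    \<union> {{1..i} \<union> {j..n} | i j. 1 \<le> i \<and> i + 3 \<le> j \<and> j \<le> n}" (is "_ = ?R")
proof (intro equalityI subsetI)
  fix J assume "J \<in> {J. chain_shape n 0 J}"
  then obtain a b where ab: "1 \<le> a" "a \<le> b" "b \<le> n" "a = b \<longrightarrow> a = 1 \<or> b = n"
    and J: "J = {1..<a} \<union> {Suc b..n}"
    unfolding chain_shape_def mem_Collect_eq by (elim exE conjE)
  have left: "{1..<a} = {1..a - 1}" using ab(1) by auto
  consider "a = 1" "b = n" | "a = 1" "b < n" | "1 < a" "b = n" | "1 < a" "b < n" using ab by linarith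
  then show "J \<in> ?R"
  proof cases
    case 1
    then show ?thesis by (simp add: J)
  next
    case 2
    then have "J = {Suc b..n} \<and> 1 < Suc b \<and> Suc b \<le> n" using ab by (simp add: J)
    then show ?thesis by blast
  next
    case 3
    then have "J = {1..a - 1}" unfolding J left by simp
    moreover have "1 \<le> a - 1 \<and> a - 1 < n" using 3 ab by linarith
    ultimately show ?thesis by blast
  next
    case 4
    then have "1 \<le> a - 1 \<and> a - 1 + 3 \<le> Suc b \<and> Suc b \<le> n" using ab by linarith
    then show ?thesis unfolding J left by blast
  qed
next
  have right: "{j..n} = {Suc (j - 1)..n}" if "1 < j" for j using that by simp
  fix J assume "J \<in> ?R"
  then consider "J = {}" | i where "J = {1..i}" "1 \<le> i" "i < n" | j where "J = {j..n}" "1 < j" "j \<le> n"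
    | i j where "J = {1..i} \<union> {j..n}" "1 \<le> i" "i + 3 \<le> j" "j \<le> n"
    by blast
  then have "chain_shape n 0 J"
  proof cases
    case 1
    then show ?thesis using chain_shapeI[of 1 n n 0] n by simp
  next
    case (2 i)
    then show ?thesis using chain_shapeI[of "Suc i" n n 0] by (simp add: atLeastLessThanSuc_atLeastAtMost)
  next
    case (3 j)
    then show ?thesis using chain_shapeI[of 1 "j - 1" n 0] by simp
  next
    case (4 i j)
    then show ?thesis using chain_shapeI[of "Suc i" "j - 1" n 0]
      by (simp add: atLeastLessThanSuc_atLeastAtMost)
  qed
  then show "J \<in> {J. chain_shape n 0 J}" by simp
qed

lemma shape_BC:
  assumes n: "3 \<le> n"
  shows "{J. chain_shape n (n - 1) J} = {{}}
    \<union> {{1..i} | i. 1 \<le> i \<and> i < n}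
    \<union> {{n}}
    \<union> {{1..i} \<union> {n} | i. 1 \<le> i \<and> i + 3 \<le> n}" (is "_ = ?R")
proof (intro equalityI subsetI)
  fix J assume "J \<in> {J. chain_shape n (n - 1) J}"
  then obtain a b where ab: "1 \<le> a" "a \<le> b" "b \<le> n" "a = b \<longrightarrow> a = 1 \<or> b = n"
    and m: "1 \<le> n - 1 \<and> n - 1 < n \<longrightarrow> a \<le> Suc (n - 1) \<and> n - 1 \<le> b"
    and J: "J = {1..<a} \<union> {Suc b..n}"
    unfolding chain_shape_def mem_Collect_eq by (elim exE conjE)
  have left: "{1..<a} = {1..a - 1}" using ab(1) by auto
  have "b = n \<or> Suc b = n" using m n ab(3) by linarith
  then consider "a = 1" "b = n" | "a = 1" "Suc b = n" | "1 < a" "b = n" | "1 < a" "Suc b = n"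
    using ab(1) by linarith
  then show "J \<in> ?R"
  proof cases
    case 1
    then show ?thesis by (simp add: J)
  next
    case 2
    then have "J = {n}" by (simp add: J)
    then show ?thesis by blast
  next
    case 3
    then have "J = {1..a - 1}" unfolding J left by simp
    moreover have "1 \<le> a - 1 \<and> a - 1 < n" using 3 ab by linarith
    ultimately show ?thesis by blast
  next
    case 4
    then have "J = {1..a - 1} \<union> {n}" unfolding J left by simp
    moreover have "1 \<le> a - 1 \<and> a - 1 + 3 \<le> n" using 4 ab by linarith
    ultimately show ?thesis by blast
  qed
next
  fix J assume "J \<in> ?R"
  then consider "J = {}" | i where "J = {1..i}" "1 \<le> i" "i < n" | "J = {n}"
    | i where "J = {1..i} \<union> {n}" "1 \<le> i" "i + 3 \<le> n"
    by blast
  then have "chain_shape n (n - 1) J"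
  proof cases
    case 1
    then show ?thesis using chain_shapeI[of 1 n n "n - 1"] n by simp
  next
    case (2 i)
    then show ?thesis using chain_shapeI[of "Suc i" n n "n - 1"] by (simp add: atLeastLessThanSuc_atLeastAtMost)
  next
    case 3
    then show ?thesis using chain_shapeI[of 1 "n - 1" n "n - 1"] n by simp
  next
    case (4 i)
    then show ?thesis using chain_shapeI[of "Suc i" "n - 1" n "n - 1"] n
      by (simp add: atLeastLessThanSuc_atLeastAtMost)
  qed
  then show "J \<in> {J. chain_shape n (n - 1) J}" by simp
qed

lemma fork_shapeI:
  "1 \<le> a \<Longrightarrow> a \<le> c \<Longrightarrow> c \<le> b \<Longrightarrow> b < N \<Longrightarrow> a < b \<Longrightarrow> K = {} \<or> K = {N} \<and> a < c \<and> c < b \<Longrightarrow>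
    fork_shape N c ({1..<a} \<union> {Suc b..<N} \<union> K)"
  unfolding fork_shape_def by (rule exI[of _ a], rule exI[of _ b], rule exI[of _ K]) simp

lemma shape_D:
  assumes n: "4 \<le> n"
  shows "{J. fork_shape n (n - 2) J} = {{}}
    \<union> {{1..i} | i. 1 \<le> i \<and> i + 3 \<le> n}
    \<union> {{n - 1}}
    \<union> {{n}}
    \<union> {{1..i} \<union> {n - 1} | i. 1 \<le> i \<and> i + 4 \<le> n}
    \<union> {{1..i} \<union> {n} | i. 1 \<le> i \<and> i + 4 \<le> n}" (is "_ = ?R")
proof (intro equalityI subsetI)
  fix J assume "J \<in> {J. fork_shape n (n - 2) J}"
  then obtain a b K where ab: "1 \<le> a" "a \<le> n - 2" "n - 2 \<le> b" "b < n" "a < b"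
    and K: "K = {} \<or> K = {n} \<and> a < n - 2 \<and> n - 2 < b"
    and J: "J = {1..<a} \<union> {Suc b..<n} \<union> K"
    unfolding fork_shape_def mem_Collect_eq by (elim exE conjE)
  have left: "{1..<a} = {1..a - 1}" using ab(1) by auto
  have b: "b = n - 1 \<and> {Suc b..<n} = {} \<or> b = n - 2 \<and> {Suc b..<n} = {n - 1}" using ab(3,4) n by auto
  consider "b = n - 1" "J = {1..a - 1}"
    | "b = n - 2" "J = {1..a - 1} \<union> {n - 1}"
    | "b = n - 1" "J = {1..a - 1} \<union> {n}" "a < n - 2"
    using b K unfolding J left by auto
  then show "J \<in> ?R"
  proof cases
    case 1
    show ?thesis
    proof (cases "a = 1")
      case True
      then show ?thesis using 1 by simp
    next
      case False
      then have "1 \<le> a - 1 \<and> a - 1 + 3 \<le> n" using ab n by linarith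
      then show ?thesis using 1(2) by blast
    qed
  next
    case 2
    show ?thesis
    proof (cases "a = 1")
      case True
      then have "J = {n - 1}" using 2 by simp
      then show ?thesis by blast
    next
      case False
      then have "1 \<le> a - 1 \<and> a - 1 + 4 \<le> n" using ab n 2(1) by linarith
      then show ?thesis using 2(2) by blast
    qed
  next
    case 3
    show ?thesis
    proof (cases "a = 1")
      case True
      then have "J = {n}" using 3 by simp
      then show ?thesis by blast
    next
      case False
      then have "1 \<le> a - 1 \<and> a - 1 + 4 \<le> n" using ab n 3(3) by linarith
      then show ?thesis using 3(2) by blast
    qed
  qed
next
  have e: "{Suc (n - 1)..<n} = {}" "{Suc (n - 2)..<n} = {n - 1}" using n by auto
  have ar: "1 \<le> n - 2" "1 < n - 2" "n - 2 < n - 1" "n - 2 \<le> n - 1" "n - 1 < n" "1 < n - 1"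
    using n by linarith+
  fix J assume "J \<in> ?R"
  then consider "J = {}" | i where "J = {1..i}" "1 \<le> i" "i + 3 \<le> n" | "J = {n - 1}" | "J = {n}"
    | i where "J = {1..i} \<union> {n - 1}" "1 \<le> i" "i + 4 \<le> n"
    | i where "J = {1..i} \<union> {n}" "1 \<le> i" "i + 4 \<le> n"
    by blast
  then have "fork_shape n (n - 2) J"
  proof cases
    case 1
    then show ?thesis using fork_shapeI[of 1 "n - 2" "n - 1" n "{}"] ar unfolding e by simp
  next
    case (2 i)
    then show ?thesis using fork_shapeI[of "Suc i" "n - 2" "n - 1" n "{}"] ar unfolding e
      by (simp add: atLeastLessThanSuc_atLeastAtMost)
  next
    case 3
    then show ?thesis using fork_shapeI[of 1 "n - 2" "n - 2" n "{}"] ar unfolding e by simp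
  next
    case 4
    then show ?thesis using fork_shapeI[of 1 "n - 2" "n - 1" n "{n}"] ar unfolding e by simp
  next
    case (5 i)
    then show ?thesis using fork_shapeI[of "Suc i" "n - 2" "n - 2" n "{}"] ar unfolding e
      by (simp add: atLeastLessThanSuc_atLeastAtMost)
  next
    case (6 i)
    then show ?thesis using fork_shapeI[of "Suc i" "n - 2" "n - 1" n "{n}"] ar unfolding e
      by (simp add: atLeastLessThanSuc_atLeastAtMost)
  qed
  then show "J \<in> {J. fork_shape n (n - 2) J}" by simp
qed

lemma numbered_root_system_of_type:
  assumes "irreducible_weyl_group \<Phi> coroot \<Delta>" "has_type coroot \<Delta> \<alpha> X"
  shows "numbered_root_system \<Phi> coroot \<Delta> \<alpha> (type_rank X)"
proof -
  interpret irreducible_weyl_group \<Phi> coroot \<Delta> by (rule assms(1))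
  show ?thesis
  proof unfold_locales
    show "bij_betw \<alpha> {1..type_rank X} \<Delta>" using assms(2) by (simp add: has_type_def)
  qed (fact simple_subset simple_independent simple_signs)+
qed

lemma entry_of_type:
  assumes "has_type coroot \<Delta> \<alpha> X" "i \<in> {1..type_rank X}" "j \<in> {1..type_rank X}"
  shows "coroot (\<alpha> i) (\<alpha> j) = of_int (cartan X i j)"
  using assms unfolding has_type_def by blast

lemma cartan_eq_0_iff: "i \<noteq> j \<Longrightarrow> cartan X i j = 0 \<longleftrightarrow> \<not> joined X i j"
  by (cases X) (simp_all add: cartan_def)

lemma chain_type_smooth_subsets:
  assumes W: "irreducible_weyl_group \<Phi> coroot \<Delta>" and X: "has_type coroot \<Delta> \<alpha> X"
    and chain: "\<And>i j. joined X i j \<longleftrightarrow> j = Suc i \<or> i = Suc j"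
    and simple: "\<And>i. i \<noteq> m \<Longrightarrow> cartan X i (Suc i) = -1 \<and> cartan X (Suc i) i = -1"
    and multiple: "1 \<le> m \<Longrightarrow> m < type_rank X \<Longrightarrow> 2 \<le> cartan X m (Suc m) * cartan X (Suc m) m"
  shows "smooth_subsets coroot \<Delta> = refl_set coroot \<alpha> ` {J. chain_shape (type_rank X) m J}"
proof -
  interpret numbered_root_system \<Phi> coroot \<Delta> \<alpha> "type_rank X"
    by (rule numbered_root_system_of_type[OF W X])
  note entry = entry_of_type[OF X, folded nodes_def]
  have linked: "linked i j \<longleftrightarrow> j = Suc i \<or> i = Suc j" if "i \<in> nodes" "j \<in> nodes" "i \<noteq> j" for i j
    using that by (simp add: entry cartan_eq_0_iff chain)
  interpret chain_diagram \<Phi> coroot \<Delta> \<alpha> "type_rank X" m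
  proof unfold_locales
    fix i assume "i \<in> {2..type_rank X}"
    then obtain k where k: "i = Suc k" "k \<in> {1..<i}" "k \<in> nodes" "i \<in> nodes"
      by (cases i) (auto simp: nodes_iff)
    then have "linked i k \<and> linked k i" using linked[of i k] linked[of k i] by simp
    then show "\<exists>j\<in>{1..<i}. linked i j \<and> linked j i" using k(2) by blast
  next
    show "linked i j \<longleftrightarrow> j = Suc i \<or> i = Suc j" if "i \<in> nodes" "j \<in> nodes" "i \<noteq> j" for i j
      by (rule linked[OF that])
    show "entry i (Suc i) = -1 \<and> entry (Suc i) i = -1"
      if "i \<in> nodes" "Suc i \<in> nodes" "i \<noteq> m" for i
      using that simple[of i] by (simp add: entry)
    show "2 \<le> entry m (Suc m) * entry (Suc m) m" if m: "1 \<le> m" "m < type_rank X"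
    proof -
      have "m \<in> nodes" "Suc m \<in> nodes" using m by (simp_all add: nodes_iff)
      then have eq: "entry m (Suc m) * entry (Suc m) m =
          of_int (cartan X m (Suc m) * cartan X (Suc m) m)"
        by (simp add: entry)
      have "(of_int 2 :: rat) \<le> of_int (cartan X m (Suc m) * cartan X (Suc m) m)"
        using multiple[OF m] by (simp only: of_int_le_iff)
      then show ?thesis unfolding eq by (simp only: of_int_numeral)
    qed
  qed
  show ?thesis by (rule chain_smooth_subsets)
qed

lemma fork_type_smooth_subsets:
  assumes W: "irreducible_weyl_group \<Phi> coroot \<Delta>" and X: "has_type coroot \<Delta> \<alpha> X"
    and c: "1 < c" "Suc c < type_rank X"
    and fork: "\<And>i j. i \<noteq> j \<Longrightarrow> cartan X i j =
      (if i < type_rank X \<and> j < type_rank X \<and> (j = Suc i \<or> i = Suc j) \<or> {i, j} = {c, type_rank X}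
       then -1 else 0)"
  shows "smooth_subsets coroot \<Delta> = refl_set coroot \<alpha> ` {J. fork_shape (type_rank X) c J}"
proof -
  let ?N = "type_rank X"
  interpret numbered_root_system \<Phi> coroot \<Delta> \<alpha> ?N
    by (rule numbered_root_system_of_type[OF W X])
  note entry = entry_of_type[OF X, folded nodes_def]
  have linked: "linked i j" if "i \<in> nodes" "j \<in> nodes" "i \<noteq> j"
      "i < ?N \<and> j < ?N \<and> (j = Suc i \<or> i = Suc j) \<or> {i, j} = {c, ?N}" for i j
    using that fork[of i j] by (simp add: entry)
  interpret fork_diagram \<Phi> coroot \<Delta> \<alpha> ?N c
  proof unfold_locales
    fix i assume i: "i \<in> {2..?N}"
    define j where "j = (if i = ?N then c else i - 1)"
    have "j \<in> {1..<i}" "j \<in> nodes" "i \<in> nodes" "i \<noteq> j" "j \<noteq> i"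
      using i c by (auto simp: nodes_iff j_def)
    moreover have "i < ?N \<and> j < ?N \<and> (j = Suc i \<or> i = Suc j) \<or> {i, j} = {c, ?N}"
      using i by (auto simp: j_def)
    moreover from this have "j < ?N \<and> i < ?N \<and> (i = Suc j \<or> j = Suc i) \<or> {j, i} = {c, ?N}"
      by (auto simp: insert_commute)
    ultimately have "linked i j \<and> linked j i" using linked[of i j] linked[of j i] by simp
    then show "\<exists>j\<in>{1..<i}. linked i j \<and> linked j i" using \<open>j \<in> {1..<i}\<close> by blast
  next
    show "entry i j = (if i < ?N \<and> j < ?N \<and> (j = Suc i \<or> i = Suc j) \<or> {i, j} = {c, ?N} then - 1 else 0)"
      if "i \<in> nodes" "j \<in> nodes" "i \<noteq> j" for i j
      unfolding entry[OF that(1,2)] fork[OF that(3)]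
      by (simp only: of_int_minus of_int_1 of_int_0 if_distrib[of rat_of_int])
  qed (use c in auto)
  show ?thesis by (rule fork_smooth_subsets)
qed

theorem corollary3p5:
  fixes \<Phi> \<Delta> :: "(rat ^ 'n) set"
    and coroot :: "rat ^ 'n \<Rightarrow> rat ^ 'n \<Rightarrow> rat"
    and \<alpha> :: "nat \<Rightarrow> rat ^ 'n"
  assumes "irreducible_weyl_group \<Phi> coroot \<Delta>"
  shows
    "(has_type coroot \<Delta> \<alpha> (Type_A 1) \<longrightarrow>
        smooth_subsets coroot \<Delta> = {{}}) \<and>
     (\<forall>n\<ge>2. has_type coroot \<Delta> \<alpha> (Type_A n) \<longrightarrow>
        smooth_subsets coroot \<Delta> = refl_set coroot \<alpha> `
          ({{}}
           \<union> {{1..i} | i. 1 \<le> i \<and> i < n}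
           \<union> {{j..n} | j. 1 < j \<and> j \<le> n}
           \<union> {{1..i} \<union> {j..n} | i j. 1 \<le> i \<and> i + 3 \<le> j \<and> j \<le> n})) \<and>
     (has_type coroot \<Delta> \<alpha> (Type_B 2) \<longrightarrow>
        smooth_subsets coroot \<Delta> = refl_set coroot \<alpha> ` {{}, {1}, {2}}) \<and>
     (\<forall>n\<ge>3. has_type coroot \<Delta> \<alpha> (Type_B n) \<longrightarrow>
        smooth_subsets coroot \<Delta> = refl_set coroot \<alpha> `
          ({{}}
           \<union> {{1..i} | i. 1 \<le> i \<and> i < n}
           \<union> {{n}}
           \<union> {{1..i} \<union> {n} | i. 1 \<le> i \<and> i + 3 \<le> n})) \<and>
     (\<forall>n\<ge>3. has_type coroot \<Delta> \<alpha> (Type_C n) \<longrightarrow>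
        smooth_subsets coroot \<Delta> = refl_set coroot \<alpha> `
          ({{}}
           \<union> {{1..i} | i. 1 \<le> i \<and> i < n}
           \<union> {{n}}
           \<union> {{1..i} \<union> {n} | i. 1 \<le> i \<and> i + 3 \<le> n})) \<and>
     (\<forall>n\<ge>4. has_type coroot \<Delta> \<alpha> (Type_D n) \<longrightarrow>
        smooth_subsets coroot \<Delta> = refl_set coroot \<alpha> `
          ({{}}
           \<union> {{1..i} | i. 1 \<le> i \<and> i + 3 \<le> n}
           \<union> {{n - 1}}
           \<union> {{n}}
           \<union> {{1..i} \<union> {n - 1} | i. 1 \<le> i \<and> i + 4 \<le> n}
           \<union> {{1..i} \<union> {n} | i. 1 \<le> i \<and> i + 4 \<le> n})) \<and>
     (has_type coroot \<Delta> \<alpha> (Type_E 6) \<longrightarrow>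
        smooth_subsets coroot \<Delta> = refl_set coroot \<alpha> `
          ({{}}
           \<union> {{1}, {1, 2}}
           \<union> {{5}, {4, 5}}
           \<union> {{6}}
           \<union> {{1, 5}, {1, 2, 5}, {1, 4, 5}}
           \<union> {{1, 6}}
           \<union> {{5, 6}}
           \<union> {{1, 5, 6}})) \<and>
     (has_type coroot \<Delta> \<alpha> (Type_E 7) \<longrightarrow>
        smooth_subsets coroot \<Delta> = refl_set coroot \<alpha> `
          ({{}}
           \<union> {{1}, {1, 2}, {1, 2, 3}}
           \<union> {{6}, {5, 6}}
           \<union> {{7}}
           \<union> {{1, 6}, {1, 2, 6}, {1, 2, 3, 6}, {1, 5, 6}, {1, 2, 5, 6}}
           \<union> {{6, 7}}
           \<union> {{1, 7}, {1, 2, 7}}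
           \<union> {{1, 6, 7}, {1, 2, 6, 7}})) \<and>
     (has_type coroot \<Delta> \<alpha> (Type_E 8) \<longrightarrow>
        smooth_subsets coroot \<Delta> = refl_set coroot \<alpha> `
          ({{}}
           \<union> {{1}, {1, 2}, {1, 2, 3}, {1, 2, 3, 4}}
           \<union> {{7}, {6, 7}}
           \<union> {{8}}
           \<union> {{1, 7}, {1, 2, 7}, {1, 2, 3, 7}, {1, 2, 3, 4, 7},
              {1, 6, 7}, {1, 2, 6, 7}, {1, 2, 3, 6, 7}}
           \<union> {{7, 8}}
           \<union> {{1, 8}, {1, 2, 8}, {1, 2, 3, 8}}
           \<union> {{1, 7, 8}, {1, 2, 7, 8}, {1, 2, 3, 7, 8}})) \<and>
     (has_type coroot \<Delta> \<alpha> Type_F4 \<longrightarrow>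
        smooth_subsets coroot \<Delta> = refl_set coroot \<alpha> `
          ({{}}
           \<union> {{1}, {1, 2}}
           \<union> {{4}, {3, 4}}
           \<union> {{1, 4}})) \<and>
     (has_type coroot \<Delta> \<alpha> Type_G2 \<longrightarrow>
        smooth_subsets coroot \<Delta> = refl_set coroot \<alpha> ` {{}, {1}, {2}})"
proof (intro conjI allI impI)
  note chain = chain_type_smooth_subsets[OF assms]
  note fork = fork_type_smooth_subsets[OF assms]
  have A: "smooth_subsets coroot \<Delta> = refl_set coroot \<alpha> ` {J. chain_shape n 0 J}"
    if "has_type coroot \<Delta> \<alpha> (Type_A n)" for n
    using chain[OF that, of 0] by (simp add: cartan_def)
  have B: "smooth_subsets coroot \<Delta> = refl_set coroot \<alpha> ` {J. chain_shape n (n - 1) J}"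
    if "2 \<le> n" "has_type coroot \<Delta> \<alpha> (Type_B n)" for n
  proof -
    \<comment> \<open>With \<open>n\<close> in the form \<open>Suc k\<close> no truncated subtraction is left in the Cartan matrix.\<close>
    from that(1) obtain k where k: "n = Suc k" by (cases n) auto
    show ?thesis using chain[OF that(2), of k] unfolding k by (simp add: cartan_def)
  qed
  have C: "smooth_subsets coroot \<Delta> = refl_set coroot \<alpha> ` {J. chain_shape n (n - 1) J}"
    if "2 \<le> n" "has_type coroot \<Delta> \<alpha> (Type_C n)" for n
  proof -
    from that(1) obtain k where k: "n = Suc k" by (cases n) auto
    show ?thesis using chain[OF that(2), of k] unfolding k by (simp add: cartan_def)
  qed
  have D: "smooth_subsets coroot \<Delta> = refl_set coroot \<alpha> ` {J. fork_shape n (n - 2) J}"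
    if "4 \<le> n" "has_type coroot \<Delta> \<alpha> (Type_D n)" for n
  proof -
    have "1 < n - 2" "Suc (n - 2) < n" using that(1) by linarith+
    then show ?thesis using fork[OF that(2), of "n - 2"] by (simp add: cartan_def)
  qed
  have E: "smooth_subsets coroot \<Delta> = refl_set coroot \<alpha> ` {J. fork_shape n (n - 3) J}"
    if "6 \<le> n" "has_type coroot \<Delta> \<alpha> (Type_E n)" for n
  proof -
    have "1 < n - 3" "Suc (n - 3) < n" using that(1) by linarith+
    then show ?thesis using fork[OF that(2), of "n - 3"] by (simp add: cartan_def)
  qed
  have F: "smooth_subsets coroot \<Delta> = refl_set coroot \<alpha> ` {J. chain_shape 4 2 J}"
    if "has_type coroot \<Delta> \<alpha> Type_F4"
    using chain[OF that, of 2] by (simp add: cartan_def)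
  have G: "smooth_subsets coroot \<Delta> = refl_set coroot \<alpha> ` {J. chain_shape 2 1 J}"
    if "has_type coroot \<Delta> \<alpha> Type_G2"
    using chain[OF that, of 1] by (simp add: cartan_def cong: conj_cong)
  show "smooth_subsets coroot \<Delta> = {{}}"
    if "has_type coroot \<Delta> \<alpha> (Type_A 1)"
    unfolding A[OF that] shape_A1 by (simp add: refl_set_def)
  show "smooth_subsets coroot \<Delta> = refl_set coroot \<alpha> `
      ({{}}
       \<union> {{1..i} | i. 1 \<le> i \<and> i < n}
       \<union> {{j..n} | j. 1 < j \<and> j \<le> n}
       \<union> {{1..i} \<union> {j..n} | i j. 1 \<le> i \<and> i + 3 \<le> j \<and> j \<le> n})"
    if "2 \<le> n" "has_type coroot \<Delta> \<alpha> (Type_A n)" for n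
    unfolding A[OF that(2)] shape_A[OF that(1)] ..
  show "smooth_subsets coroot \<Delta> = refl_set coroot \<alpha> ` {{}, {1}, {2}}"
    if "has_type coroot \<Delta> \<alpha> (Type_B 2)"
    unfolding shape_B2[symmetric] using B[of 2] that by simp
  show "smooth_subsets coroot \<Delta> = refl_set coroot \<alpha> `
      ({{}}
       \<union> {{1..i} | i. 1 \<le> i \<and> i < n}
       \<union> {{n}}
       \<union> {{1..i} \<union> {n} | i. 1 \<le> i \<and> i + 3 \<le> n})"
    if "3 \<le> n" "has_type coroot \<Delta> \<alpha> (Type_B n)" for n
    using B[OF _ that(2)] that(1) unfolding shape_BC[OF that(1)] by simp
  show "smooth_subsets coroot \<Delta> = refl_set coroot \<alpha> `
      ({{}}
       \<union> {{1..i} | i. 1 \<le> i \<and> i < n}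
       \<union> {{n}}
       \<union> {{1..i} \<union> {n} | i. 1 \<le> i \<and> i + 3 \<le> n})"
    if "3 \<le> n" "has_type coroot \<Delta> \<alpha> (Type_C n)" for n
    using C[OF _ that(2)] that(1) unfolding shape_BC[OF that(1)] by simp
  show "smooth_subsets coroot \<Delta> = refl_set coroot \<alpha> `
      ({{}}
       \<union> {{1..i} | i. 1 \<le> i \<and> i + 3 \<le> n}
       \<union> {{n - 1}}
       \<union> {{n}}
       \<union> {{1..i} \<union> {n - 1} | i. 1 \<le> i \<and> i + 4 \<le> n}
       \<union> {{1..i} \<union> {n} | i. 1 \<le> i \<and> i + 4 \<le> n})"
    if "4 \<le> n" "has_type coroot \<Delta> \<alpha> (Type_D n)" for n
    unfolding D[OF that] shape_D[OF that(1)] ..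
  show "smooth_subsets coroot \<Delta> = refl_set coroot \<alpha> `
      ({{}}
       \<union> {{1}, {1, 2}}
       \<union> {{5}, {4, 5}}
       \<union> {{6}}
       \<union> {{1, 5}, {1, 2, 5}, {1, 4, 5}}
       \<union> {{1, 6}}
       \<union> {{5, 6}}
       \<union> {{1, 5, 6}})"
    if "has_type coroot \<Delta> \<alpha> (Type_E 6)"
    using E[of 6] that unfolding shape_E6[symmetric] by simp
  show "smooth_subsets coroot \<Delta> = refl_set coroot \<alpha> `
      ({{}}
       \<union> {{1}, {1, 2}, {1, 2, 3}}
       \<union> {{6}, {5, 6}}
       \<union> {{7}}
       \<union> {{1, 6}, {1, 2, 6}, {1, 2, 3, 6}, {1, 5, 6}, {1, 2, 5, 6}}
       \<union> {{6, 7}}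
       \<union> {{1, 7}, {1, 2, 7}}
       \<union> {{1, 6, 7}, {1, 2, 6, 7}})"
    if "has_type coroot \<Delta> \<alpha> (Type_E 7)"
    using E[of 7] that unfolding shape_E7[symmetric] by simp
  show "smooth_subsets coroot \<Delta> = refl_set coroot \<alpha> `
      ({{}}
       \<union> {{1}, {1, 2}, {1, 2, 3}, {1, 2, 3, 4}}
       \<union> {{7}, {6, 7}}
       \<union> {{8}}
       \<union> {{1, 7}, {1, 2, 7}, {1, 2, 3, 7}, {1, 2, 3, 4, 7},
          {1, 6, 7}, {1, 2, 6, 7}, {1, 2, 3, 6, 7}}
       \<union> {{7, 8}}
       \<union> {{1, 8}, {1, 2, 8}, {1, 2, 3, 8}}
       \<union> {{1, 7, 8}, {1, 2, 7, 8}, {1, 2, 3, 7, 8}})"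
    if "has_type coroot \<Delta> \<alpha> (Type_E 8)"
    using E[of 8] that unfolding shape_E8[symmetric] by simp
  show "smooth_subsets coroot \<Delta> = refl_set coroot \<alpha> `
      ({{}}
       \<union> {{1}, {1, 2}}
       \<union> {{4}, {3, 4}}
       \<union> {{1, 4}})"
    if "has_type coroot \<Delta> \<alpha> Type_F4"
    unfolding shape_F4[symmetric] by (rule F[OF that])
  show "smooth_subsets coroot \<Delta> = refl_set coroot \<alpha> ` {{}, {1}, {2}}"
    if "has_type coroot \<Delta> \<alpha> Type_G2"
    unfolding shape_B2[symmetric] by (rule G[OF that])
qed

end
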